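(* Let $r>0$, $\alpha\in\,]1,\infty[$, $c>0$, $a>0$ and $b\in\mathbb R$. If $$b_\mu(s)\sim c\,(1/s)^{a}(\log(1/s))^{b}\quad\text{as }s\to0,$$ then $$D_{\mu,r}^{\alpha}(R)\sim\left(b_\mu^{-1}\left(\frac{\alpha-1}{\alpha}R\right)\right)^{r}e^{-\frac{\alpha-1}{\alpha}R}\sim D_{\mu,r}^{\infty}\left(\frac{\alpha-1}{\alpha}R\right)\quad\text{as }R\to\infty.$$
   Context: Standing assumptions: $(E,\|\cdot\|)$ is a real separable Banach space of infinite dimension; $\mu$ is a non-atomic centered Gaussian Borel probability measure on $E$ whose support is all of $E$ (so all moments $\int\|x\|^r d\mu(x)$ are finite). For $a\in E$, $s>0$, $B(a,s)=\{x\in E:\|x-a\|\le s\}$ is the closed ball. The small ball function is $b_\mu(s)=-\log\mu(B(0,s))$, $s>0$ (natural logarithm); it is a continuous, strictly decreasing bijection of $]0,\infty[$ onto $]0,\infty[$, with inverse $b_\mu^{-1}$. A quantizer is a Borel-measurable map $f:E\to E$ whose image $f(E)$ is countable (finite or countably infinite); $\mathcal F$ is the set of all quantizers. The R\'enyi-$\alpha$-entropy of $f$ with respect to $\mu$ is $$H_\mu^\alpha(f)=\frac{1}{1-\alpha}\log\Big(\sum_{z\in f(E)}\mu(f^{-1}(z))^{\alpha}\Big)\ \text{ for }\alpha\in\,]1,\infty[,\qquad H_\mu^\infty(f)=-\log\big(\max\{\mu(f^{-1}(z)):z\in f(E)\}\big).$$ Put $D_{\mu,r}(f)=\int_E\|x-f(x)\|^r\,d\mu(x)$,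 and for $\alpha\in\,]1,\infty]$, $R\ge0$, $$D_{\mu,r}^{\alpha}(R)=\inf\{D_{\mu,r}(f): f\in\mathcal F,\ H_\mu^\alpha(f)\le R\}.$$ Notation: $f\sim g$ as $x\to x_*$ means $\lim_{x\to x_*}f(x)/g(x)=1$. *)

theory Defs
  imports "HOL-Probability.Probability" "HOL-Library.Landau_Symbols"
begin

definition infinite_dimensional :: "'a::real_vector itself \<Rightarrow> bool" where
  "infinite_dimensional (_ :: 'a itself) \<longleftrightarrow> \<not> (\<exists>B :: 'a set. finite B \<and> span B = UNIV)"

(* The degenerate one-dimensional Gaussian law, the point mass at 0, is allowed as the law of a
   functional; normal_density 0 0 is not its density, hence the separate case. *)
definition centered_gaussian :: "'a::real_normed_vector measure \<Rightarrow> bool" where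
  "centered_gaussian M \<longleftrightarrow> prob_space M \<and> sets M = sets borel \<and>
     (\<forall>f :: 'a \<Rightarrow> real. bounded_linear f \<longrightarrow>
        distr M borel f = return borel 0 \<or>
        (\<exists>\<sigma>>0. distr M borel f = density lborel (\<lambda>t. ennreal (normal_density 0 \<sigma> t))))"

definition non_atomic :: "'a measure \<Rightarrow> bool" where
  "non_atomic M \<longleftrightarrow> (\<forall>A\<in>sets M. 0 < emeasure M A \<longrightarrow>
     (\<exists>B\<in>sets M. B \<subseteq> A \<and> 0 < emeasure M B \<and> emeasure M B < emeasure M A))"

definition topological_support :: "'a::topological_space measure \<Rightarrow> 'a set" where
  "topological_support M = {x. \<forall>U. open U \<longrightarrow> x \<in> U \<longrightarrow> 0 < emeasure M U}"

definition small_ball :: "'a::real_normed_vector measure \<Rightarrow> real \<Rightarrow> real" where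
  "small_ball M s = - ln (measure M (cball 0 s))"

(* For a non-atomic centered Gaussian measure with full support on an infinite-dimensional
   separable Banach space, small_ball is a bijection of {0<..} onto {0<..}, and this is its
   inverse. *)
definition small_ball_inv :: "'a::real_normed_vector measure \<Rightarrow> real \<Rightarrow> real" where
  "small_ball_inv M = inv_into {0<..} (small_ball M)"

definition quantizers :: "('a::topological_space \<Rightarrow> 'a) set" where
  "quantizers = {f. f \<in> borel \<rightarrow>\<^sub>M borel \<and> countable (range f)}"

(* Only used for 1 < \<alpha> \<le> \<infinity>.  The cell probabilities sum to 1, so for \<alpha> < \<infinity> the sum converges and
   is positive, and for \<alpha> = \<infinity> the supremum is attained; Max would be unspecified when the set of
   cell probabilities is infinite. *)
definition renyi_entropy :: "'a::topological_space measure \<Rightarrow> ereal \<Rightarrow> ('a \<Rightarrow> 'a) \<Rightarrow> real" where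
  "renyi_entropy M \<alpha> f =
     (if \<alpha> = \<infinity> then - ln (SUP z\<in>range f. measure M (f -` {z}))
      else 1 / (1 - real_of_ereal \<alpha>) *
        ln (\<Sum>\<^sub>\<infinity>z\<in>range f. measure M (f -` {z}) powr real_of_ereal \<alpha>))"

definition distortion ::
  "'a::real_normed_vector measure \<Rightarrow> real \<Rightarrow> ('a \<Rightarrow> 'a) \<Rightarrow> ennreal" where
  "distortion M r f = (\<integral>\<^sup>+ x. ennreal (norm (x - f x) powr r) \<partial>M)"

(* Individual quantizers may have infinite distortion, so the infimum is taken in ennreal.  For
   R \<ge> 0 it is finite when M has finite r-th moment, since a constant map has entropy 0. *)
definition quantization_error ::
  "'a::real_normed_vector measure \<Rightarrow> real \<Rightarrow> ereal \<Rightarrow> real \<Rightarrow> real" where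
  "quantization_error M r \<alpha> R =
     enn2real (INF f\<in>{f \<in> quantizers. renyi_entropy M \<alpha> f \<le> R}. distortion M r f)"

end

(* With y = (alpha - 1) / alpha * R, the entropy constraint says that the sum of the alpha-th powers
   of the cell probabilities is at least exp (- alpha * y).  One cell of probability exp (- y) exhausts
   it, the rest of the space being quantized at arbitrarily small cost, and the cheapest such cell is a
   centered ball, of radius small_ball_inv M y by definition: this is the upper bound, and it also
   bounds the case alpha = infinity.  For the lower bound, a cell of probability q costs at least
   about q * small_ball_inv M (- ln q) powr r, because no ball has more mass than the centered ball of
   the same radius (Anderson's inequality) and, by regular variation, shrinking the radius by a
   constant factor makes the mass negligible.  Regular variation also shows that splitting the big
   cell into smaller ones with the same sum of alpha-th powers does not pay off.  Anderson's inequality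
   and the continuity of small_ball both come from log-concavity of the measure on balls, which is
   obtained from the one-dimensional Prekopa-Leindler inequality by adding functionals one at a time,
   each being an independent Gaussian variable plus a combination of the previous ones. *)

theory Submission
  imports Defs
begin

section \<open>Norming functionals\<close>

text \<open>\<open>centered_gaussian\<close> speaks of one functional at a time, while a ball
  involves infinitely many jointly. By Hahn-Banach and separability a closed ball is a countable
  intersection of slabs, so its measure is a limit of measures of finite cylinders. Those are
  determined by characteristic functions, because every linear combination of functionals is again
  Gaussian; this is also how uncorrelated functionals become independent. Log-concavity is only
  needed at midpoints: the centres z and - z yield Anderson's inequality, and equally spaced radii
  exclude jumps. On the quantization side the decisive quantity is the cost of a cell per unit of
  its contribution to the sum of the \<alpha>-th powers. For probability exp (- u) it is about S u
  powr r * exp ((\<alpha> - 1) * u), with S the inverse of the small ball function. Since \<alpha> >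
  1, the exponential outweighs the decay of S, so small cells are inefficient.\<close>

definition sublinear :: "('a::real_normed_vector \<Rightarrow> real) \<Rightarrow> bool" where
  "sublinear p \<longleftrightarrow> p 0 = 0 \<and> (\<forall>x y. p (x + y) \<le> p x + p y) \<and> (\<forall>c>0. \<forall>x. p (c *\<^sub>R x) \<le> c * p x)"

text \<open>\<open>sublinear\<close> asks for homogeneity only as an inequality, a form that passes
  to infima; applying it to the factor 1/t as well gives back the equality.\<close>

lemma sublinear_scale:
  assumes "sublinear p" "t \<ge> 0"
  shows "p (t *\<^sub>R y) = t * p y"
proof (cases "t = 0")
  case True
  then show ?thesis using assms by (simp add: sublinear_def)
next
  case False
  with assms have t: "t > 0" by simp
  have "p ((1/t) *\<^sub>R (t *\<^sub>R y)) \<le> (1/t) * p (t *\<^sub>R y)"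
    using assms t unfolding sublinear_def by (metis zero_less_divide_1_iff)
  then have "t * p y \<le> p (t *\<^sub>R y)" using t by (simp add: field_simps)
  moreover have "p (t *\<^sub>R y) \<le> t * p y" using assms t unfolding sublinear_def by blast
  ultimately show ?thesis by simp
qed

lemma sublinear_lower:
  assumes "sublinear p"
  shows "p (x + y) \<ge> p y - p (- x)"
proof -
  have "p ((x + y) + (- x)) \<le> p (x + y) + p (- x)"
    using assms unfolding sublinear_def by blast
  then show ?thesis by simp
qed

text \<open>The Hahn-Banach step: q x is the infimum over t >= 0 of p (x + t y) - t * p y. Taking t
  = 1 at x = - y gives the required bound, and subadditivity keeps the infimum above - p (- x). It
  serves twice, to prescribe the value at one vector and to show that minimal functionals are
  odd.\<close>

lemma sublinear_decrease:
  fixes p :: "'a::real_normed_vector \<Rightarrow> real"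
  assumes p: "sublinear p"
  shows "\<exists>q. sublinear q \<and> (\<forall>x. q x \<le> p x) \<and> q (- y) \<le> - p y"
proof -
  define F where "F x t = p (x + t *\<^sub>R y) - t * p y" for x t
  define q where "q x = (INF t\<in>{0..}. F x t)" for x
  have lb: "F x t \<ge> - p (- x)" if "t \<ge> 0" for x t
    using sublinear_lower[OF p, of "t *\<^sub>R y" x] sublinear_scale[OF p that, of y]
    by (simp add: F_def)
  have bdd: "bdd_below (F x ` {0..})" for x
    using lb by (auto intro!: bdd_belowI2)
  have le: "q x \<le> F x t" if "t \<ge> 0" for x t
    unfolding q_def by (rule cINF_lower[OF bdd]) (use that in auto)
  have ge: "m \<le> q x" if "\<And>t. t \<ge> 0 \<Longrightarrow> m \<le> F x t" for m x
    unfolding q_def by (rule cINF_greatest) (use that in auto)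
  have p0: "p 0 = 0" and sub: "p (u + v) \<le> p u + p v" for u v
    using p by (auto simp: sublinear_def)
  have qle: "q x \<le> p x" for x using le[of 0 x] by (simp add: F_def)
  have qy: "q (- y) \<le> - p y" using le[of 1 "-y"] by (simp add: F_def p0)
  have q0: "q 0 = 0"
  proof (rule antisym)
    show "q 0 \<le> 0" using qle[of 0] p0 by simp
    show "0 \<le> q 0" by (rule ge) (simp add: F_def sublinear_scale[OF p])
  qed
  have qadd: "q (x + x') \<le> q x + q x'" for x x'
  proof -
    have *: "q (x + x') \<le> F x t + F x' t'" if "t \<ge> 0" "t' \<ge> 0" for t t'
    proof -
      have "q (x + x') \<le> F (x + x') (t + t')" using that by (intro le) auto
      also have "\<dots> \<le> F x t + F x' t'"
        using sub[of "x + t *\<^sub>R y" "x' + t' *\<^sub>R y"] by (simp add: F_def algebra_simps)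
      finally show ?thesis .
    qed
    have "q (x + x') - F x t \<le> q x'" if "t \<ge> 0" for t
      by (rule ge) (use *[OF that] in \<open>simp add: algebra_simps\<close>)
    then have "q (x + x') - q x' \<le> q x"
      by (intro ge) (simp add: algebra_simps)
    then show ?thesis by simp
  qed
  have qs: "q (c *\<^sub>R x) \<le> c * q x" if c: "c > 0" for c x
  proof -
    have "q (c *\<^sub>R x) / c \<le> q x"
    proof (rule ge)
      fix t :: real assume t: "t \<ge> 0"
      have "q (c *\<^sub>R x) \<le> F (c *\<^sub>R x) (c * t)" using c t by (intro le) auto
      also have "\<dots> = c * F x t"
        using sublinear_scale[OF p, of c "x + t *\<^sub>R y"] c by (simp add: F_def algebra_simps)
      finally show "q (c *\<^sub>R x) / c \<le> F x t" using c by (simp add: field_simps)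
    qed
    then show ?thesis using c by (simp add: field_simps)
  qed
  from q0 qadd qs qle qy show ?thesis unfolding sublinear_def by blast
qed

text \<open>Zorn's lemma for the reversed pointwise order. The infimum over a chain is finite
  because 0 = q 0 <= q x + p (- x), and it is subadditive because two members of a chain have a
  common lower member.\<close>

lemma ex_minimal_sublinear:
  fixes p :: "'a::real_normed_vector \<Rightarrow> real"
  assumes p: "sublinear p"
  shows "\<exists>m. sublinear m \<and> m \<le> p \<and> (\<forall>q. sublinear q \<longrightarrow> q \<le> m \<longrightarrow> q = m)"
proof -
  define A where "A = {q. sublinear q \<and> q \<le> p}"
  have "\<exists>m\<in>A. \<forall>q\<in>A. m \<ge> q \<longrightarrow> q = m"
  proof (rule predicate_Zorn)
    show "partial_order_on A (relation_of (\<lambda>x y. y \<le> x) A)"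
      by (auto simp: partial_order_on_def preorder_on_def refl_on_def trans_def antisym_def
          relation_of_def)
  next
    fix C assume C: "C \<in> Chains (relation_of (\<lambda>x y. y \<le> x) A)"
    show "\<exists>u\<in>A. \<forall>a\<in>C. u \<le> a"
    proof (cases "C = {}")
      case True
      then show ?thesis using p by (auto simp: A_def)
    next
      case False
      have CA: "C \<subseteq> A" using C by (auto simp: Chains_def relation_of_def)
      have tot: "q \<le> q' \<or> q' \<le> q" if "q \<in> C" "q' \<in> C" for q q'
        using C that by (auto simp: Chains_def relation_of_def)
      define u where "u x = (INF q\<in>C. q x)" for x
      have lb: "- p (- x) \<le> q x" if "q \<in> C" for q x
      proof -
        have q: "sublinear q" "q \<le> p" using that CA by (auto simp: A_def)
        then have "q (- x) \<le> p (- x)" by (simp add: le_fun_def)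
        moreover have "q 0 - q (- x) \<le> q x" using sublinear_lower[OF q(1), of 0 x] by simp
        ultimately show ?thesis using q(1) by (simp add: sublinear_def)
      qed
      have bdd: "bdd_below ((\<lambda>q. q x) ` C)" for x using lb by (auto intro!: bdd_belowI2)
      have le: "u x \<le> q x" if "q \<in> C" for x q
        unfolding u_def by (rule cINF_lower[OF bdd that])
      have ge: "m \<le> u x" if "\<And>q. q \<in> C \<Longrightarrow> m \<le> q x" for m x
        unfolding u_def by (rule cINF_greatest) (use that False in auto)
      have sl: "sublinear q" if "q \<in> C" for q using that CA by (auto simp: A_def)
      have u0: "u 0 = 0"
      proof -
        obtain q where "q \<in> C" using False by auto
        then have "u 0 \<le> 0" using le[of q 0] sl[of q] by (simp add: sublinear_def)
        moreover have "0 \<le> u 0" by (rule ge) (simp add: sl[unfolded sublinear_def])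
        ultimately show ?thesis by simp
      qed
      have uadd: "u (x + y) \<le> u x + u y" for x y
      proof -
        have *: "u (x + y) \<le> q x + q' y" if "q \<in> C" "q' \<in> C" for q q'
        proof -
          from tot[OF that] that obtain q'' where q'': "q'' \<in> C" "q'' \<le> q" "q'' \<le> q'"
            by blast
          have "u (x + y) \<le> q'' (x + y)" by (rule le[OF q''(1)])
          also have "\<dots> \<le> q'' x + q'' y" using sl[OF q''(1)] by (simp add: sublinear_def)
          also have "\<dots> \<le> q x + q' y" using q''(2,3) by (simp add: le_fun_def add_mono)
          finally show ?thesis .
        qed
        have "u (x + y) - q x \<le> u y" if "q \<in> C" for q
          by (rule ge) (use *[OF that] in \<open>simp add: algebra_simps\<close>)
        then have "u (x + y) - u y \<le> u x"
          by (intro ge) (simp add: algebra_simps)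
        then show ?thesis by simp
      qed
      have us: "u (c *\<^sub>R x) \<le> c * u x" if c: "c > 0" for c x
      proof -
        have "u (c *\<^sub>R x) / c \<le> u x"
        proof (rule ge)
          fix q assume q: "q \<in> C"
          have "u (c *\<^sub>R x) \<le> q (c *\<^sub>R x)" by (rule le[OF q])
          also have "\<dots> \<le> c * q x" using sl[OF q] c by (simp add: sublinear_def)
          finally show "u (c *\<^sub>R x) / c \<le> q x" using c by (simp add: field_simps)
        qed
        then show ?thesis using c by (simp add: field_simps)
      qed
      have "sublinear u" using u0 uadd us by (simp add: sublinear_def)
      moreover have "u \<le> q" if "q \<in> C" for q using le[OF that] by (simp add: le_fun_def)
      moreover from this have "u \<le> p" using False CA unfolding A_def
        by (metis (no_types, lifting) equals0I mem_Collect_eq order_trans subsetD)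
      ultimately show ?thesis by (auto simp: A_def)
    qed
  qed
  then show ?thesis unfolding A_def using order_trans by blast
qed

text \<open>Minimality forces \<open>m (- y) = - m y\<close>, so a minimal sublinear functional is linear.\<close>

lemma ex_norming_functional:
  fixes x\<^sub>0 :: "'a::real_normed_vector"
  shows "\<exists>f :: 'a \<Rightarrow> real. bounded_linear f \<and> (\<forall>x. \<bar>f x\<bar> \<le> norm x) \<and> f x\<^sub>0 = norm x\<^sub>0"
proof -
  have "sublinear (norm :: 'a \<Rightarrow> real)"
    by (auto simp: sublinear_def norm_triangle_ineq)
  \<comment> \<open>Descending from q instead of the norm fixes the value at
    \<open>x\<^sub>0\<close>: every linear functional below q is at least norm
    \<open>x\<^sub>0\<close> there.\<close>
  from sublinear_decrease[OF this, of x\<^sub>0] obtain q where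
    q: "sublinear q" "\<And>x. q x \<le> norm x" "q (- x\<^sub>0) \<le> - norm x\<^sub>0" by blast
  from ex_minimal_sublinear[OF q(1)] obtain m where
    m: "sublinear m" "m \<le> q" "\<And>q. sublinear q \<Longrightarrow> q \<le> m \<Longrightarrow> q = m" by blast
  have mle: "m x \<le> q x" for x using m(2) by (simp add: le_fun_def)
  have neg: "m (- y) = - m y" for y
  proof -
    obtain q' where "sublinear q'" "\<And>x. q' x \<le> m x" "q' (- y) \<le> - m y"
      using sublinear_decrease[OF m(1), of y] by blast
    with m(3)[of q'] have "m (- y) \<le> - m y" by (simp add: le_fun_def)
    moreover have "m 0 - m (- y) \<le> m y" using sublinear_lower[OF m(1), of 0 y] by simp
    ultimately show ?thesis using m(1) by (simp add: sublinear_def)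
  qed
  have add: "m (x + y) = m x + m y" for x y
  proof -
    have "m (x + y) \<le> m x + m y" "m (- x + - y) \<le> m (- x) + m (- y)"
      using m(1) unfolding sublinear_def by blast+
    then show ?thesis using neg[of "x + y"] by (simp add: neg)
  qed
  have scale: "m (c *\<^sub>R x) = c *\<^sub>R m x" for c x
  proof (cases "c \<ge> 0")
    case True then show ?thesis using sublinear_scale[OF m(1)] by simp
  next
    case False
    then have "m ((- c) *\<^sub>R x) = - c * m x" by (intro sublinear_scale[OF m(1)]) auto
    then show ?thesis using neg[of "c *\<^sub>R x"] by simp
  qed
  have abs: "\<bar>m x\<bar> \<le> norm x" for x
    using mle[of x] mle[of "-x"] q(2)[of x] q(2)[of "-x"] neg[of x] by auto
  have "bounded_linear m"
    by (rule bounded_linear_intro[of m 1]) (use add scale abs in auto)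
  moreover have "m x\<^sub>0 = norm x\<^sub>0"
    using mle[of "- x\<^sub>0"] q(3) neg[of "x\<^sub>0"] abs[of x\<^sub>0] by auto
  ultimately show ?thesis using abs by blast
qed

section \<open>The one-dimensional Prekopa-Leindler inequality\<close>

lemma emeasure_lborel_vimage_midpoint:
  fixes S :: "real set"
  assumes [measurable]: "S \<in> sets borel"
  shows "emeasure lborel ((\<lambda>x. (x + b) / 2) -` S) = 2 * emeasure lborel S"
proof -
  have "emeasure lborel S = emeasure (density (distr lborel borel (\<lambda>x. b/2 + (1/2) * x)) (\<lambda>_. ennreal \<bar>1/2\<bar>)) S"
    using lborel_real_affine[of "1/2" "b/2"] by simp
  also have "\<dots> = ennreal (1/2) * emeasure lborel ((\<lambda>x. b/2 + (1/2) * x) -` S)"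
    by (simp add: emeasure_density nn_integral_cmult emeasure_distr)
  also have "(\<lambda>x. b/2 + (1/2) * x) = (\<lambda>x. (x + b) / 2)" by (auto simp: field_simps)
  finally have "2 * emeasure lborel S = (2 * ennreal (1/2)) * emeasure lborel ((\<lambda>x. (x + b) / 2) -` S)"
    by (simp add: mult.assoc)
  also have "2 * ennreal (1/2) = 1"
    using ennreal_mult[of 2 "1/2"] by simp
  finally show ?thesis by simp
qed

text \<open>C contains the midpoints of A \<inter> {..a} with the fixed point b, lying left of m =
  (a + b) / 2, and those of B \<inter> {b..} with the fixed point a, lying right of m. Each is a
  copy at half scale, and the two can meet only in the null set {m}.\<close>

lemma emeasure_split_add_le:
  fixes A B C :: "real set"
  assumes [measurable]: "A \<in> sets borel" "B \<in> sets borel" "C \<in> sets borel"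
    and mid: "\<And>x y. x \<in> A \<Longrightarrow> y \<in> B \<Longrightarrow> (x + y) / 2 \<in> C"
    and ab: "a \<in> A" "b \<in> B"
  shows "emeasure lborel (A \<inter> {..a}) + emeasure lborel (B \<inter> {b..}) \<le> 2 * emeasure lborel C"
proof -
  define m where "m = (a + b) / 2"
  have "emeasure lborel (A \<inter> {..a}) \<le> emeasure lborel ((\<lambda>x. (x + b) / 2) -` (C \<inter> {..m}))"
    by (rule emeasure_mono) (use mid ab in \<open>auto simp: m_def\<close>)
  then have 1: "emeasure lborel (A \<inter> {..a}) \<le> 2 * emeasure lborel (C \<inter> {..m})"
    by (subst (asm) emeasure_lborel_vimage_midpoint) auto
  have "emeasure lborel (B \<inter> {b..}) \<le> emeasure lborel ((\<lambda>x. (x + a) / 2) -` (C \<inter> {m..}))"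
    by (rule emeasure_mono) (use mid[OF ab(1)] in \<open>auto simp: m_def add.commute\<close>)
  then have 2: "emeasure lborel (B \<inter> {b..}) \<le> 2 * emeasure lborel (C \<inter> {m..})"
    by (subst (asm) emeasure_lborel_vimage_midpoint) auto
  have "C \<inter> {m..} \<subseteq> (C \<inter> {m<..}) \<union> {m}" by auto
  then have "emeasure lborel (C \<inter> {m..}) \<le> emeasure lborel ((C \<inter> {m<..}) \<union> {m})"
    by (intro emeasure_mono) auto
  also have "\<dots> \<le> emeasure lborel (C \<inter> {m<..}) + emeasure lborel {m}"
    by (intro emeasure_subadditive) auto
  finally have 3: "emeasure lborel (C \<inter> {m..}) \<le> emeasure lborel (C \<inter> {m<..})" by simp
  have "(C \<inter> {..m}) \<union> (C \<inter> {m<..}) = C" by auto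
  then have "emeasure lborel (C \<inter> {..m}) + emeasure lborel (C \<inter> {m<..}) = emeasure lborel C"
    by (subst plus_emeasure) auto
  then have "2 * emeasure lborel (C \<inter> {..m}) + 2 * emeasure lborel (C \<inter> {m..}) \<le> 2 * emeasure lborel C"
    using 3 by (metis add_left_mono distrib_left mult_left_mono zero_le)
  then show ?thesis using add_mono[OF 1 2] by (rule order_trans[rotated])
qed

text \<open>What lies beyond a point of S close to the supremum fits into an interval of length at
  most e. Such a point plays the part that the maximum plays for a compact set.\<close>

lemma emeasure_le_initial_segment:
  fixes S :: "real set"
  assumes [measurable]: "S \<in> sets borel" and "S \<noteq> {}" "bdd_above S" "e > 0"
  shows "\<exists>a\<in>S. emeasure lborel S \<le> emeasure lborel (S \<inter> {..a}) + ennreal e"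
proof -
  obtain a where a: "a \<in> S" "Sup S - e < a"
    using less_cSup_iff[OF assms(2,3), of "Sup S - e"] assms(4) by auto
  have "S \<subseteq> (S \<inter> {..a}) \<union> {a..Sup S}" using assms(3) by (auto intro: cSup_upper)
  then have "emeasure lborel S \<le> emeasure lborel ((S \<inter> {..a}) \<union> {a..Sup S})"
    by (intro emeasure_mono) auto
  also have "\<dots> \<le> emeasure lborel (S \<inter> {..a}) + emeasure lborel {a..Sup S}"
    by (intro emeasure_subadditive) auto
  also have "emeasure lborel {a..Sup S} \<le> ennreal e"
    using a cSup_upper[OF a(1) assms(3)] by (simp add: ennreal_leI)
  finally show ?thesis using a(1) by (auto simp: add_left_mono)
qed

lemma emeasure_le_final_segment:
  fixes S :: "real set"
  assumes [measurable]: "S \<in> sets borel" and "S \<noteq> {}" "bdd_below S" "e > 0"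
  shows "\<exists>a\<in>S. emeasure lborel S \<le> emeasure lborel (S \<inter> {a..}) + ennreal e"
proof -
  obtain a where a: "a \<in> S" "a < Inf S + e"
    using cInf_less_iff[OF assms(2,3), of "Inf S + e"] assms(4) by auto
  have "S \<subseteq> (S \<inter> {a..}) \<union> {Inf S..a}" using assms(3) by (auto intro: cInf_lower)
  then have "emeasure lborel S \<le> emeasure lborel ((S \<inter> {a..}) \<union> {Inf S..a})"
    by (intro emeasure_mono) auto
  also have "\<dots> \<le> emeasure lborel (S \<inter> {a..}) + emeasure lborel {Inf S..a}"
    by (intro emeasure_subadditive) auto
  also have "emeasure lborel {Inf S..a} \<le> ennreal e"
    using a cInf_lower[OF a(1) assms(3)] by (simp add: ennreal_leI)
  finally show ?thesis using a(1) by (auto simp: add_left_mono)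
qed

text \<open>Truncating A and B to [-n, n] makes suprema and infima finite; C stays whole, since it
  still contains the midpoints of the truncated sets. Monotone limits remove the truncation.\<close>

lemma Brunn_Minkowski_real:
  fixes A B C :: "real set"
  assumes [measurable]: "A \<in> sets borel" "B \<in> sets borel" "C \<in> sets borel"
    and mid: "\<And>x y. x \<in> A \<Longrightarrow> y \<in> B \<Longrightarrow> (x + y) / 2 \<in> C"
    and ne: "A \<noteq> {}" "B \<noteq> {}"
  shows "emeasure lborel A + emeasure lborel B \<le> 2 * emeasure lborel C"
proof -
  define A' where "A' n = A \<inter> {- real n..real n}" for n :: nat
  define B' where "B' n = B \<inter> {- real n..real n}" for n :: nat
  have [measurable]: "A' n \<in> sets borel" "B' n \<in> sets borel" for n by (auto simp: A'_def B'_def)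
  have UN: "(\<Union>n. S \<inter> {- real n..real n}) = S" for S :: "real set"
  proof -
    have "\<exists>n. - real n \<le> x \<and> x \<le> real n" for x
      using real_arch_simple[of "\<bar>x\<bar>"] by (metis abs_le_iff minus_le_iff)
    then show ?thesis by auto
  qed
  have lim: "(\<lambda>n. emeasure lborel (S \<inter> {- real n..real n})) \<longlonglongrightarrow> emeasure lborel S"
    if [measurable]: "S \<in> sets borel" for S :: "real set"
    by (subst (2) UN[of S, symmetric], rule Lim_emeasure_incseq)
       (auto simp: incseq_def)
  obtain x y where xy: "x \<in> A" "y \<in> B" using ne by auto
  have ev: "\<forall>\<^sub>F n in sequentially. emeasure lborel (A' n) + emeasure lborel (B' n) \<le> 2 * emeasure lborel C"
  proof -
    \<comment> \<open>From N on the truncated sets contain x and y, hence are nonempty.\<close>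
    obtain N where N: "real N \<ge> max \<bar>x\<bar> \<bar>y\<bar>" using real_arch_simple by blast
    have "emeasure lborel (A' n) + emeasure lborel (B' n) \<le> 2 * emeasure lborel C" if n: "n \<ge> N" for n
    proof (rule ennreal_le_epsilon)
      fix e :: real assume e: "e > 0"
      have "real N \<le> real n" using n by simp
      then have "x \<in> A' n" "y \<in> B' n" using N xy by (auto simp: A'_def B'_def)
      then have ne': "A' n \<noteq> {}" "B' n \<noteq> {}" by auto
      have bd: "bdd_above (A' n)" "bdd_below (B' n)"
        by (auto simp: A'_def B'_def intro: bdd_above_Int2 bdd_below_Int2)
      obtain a where a: "a \<in> A' n" "emeasure lborel (A' n) \<le> emeasure lborel (A' n \<inter> {..a}) + ennreal (e/2)"
        using emeasure_le_initial_segment[OF _ ne'(1) bd(1), of "e/2"] e by auto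
      obtain b where b: "b \<in> B' n" "emeasure lborel (B' n) \<le> emeasure lborel (B' n \<inter> {b..}) + ennreal (e/2)"
        using emeasure_le_final_segment[OF _ ne'(2) bd(2), of "e/2"] e by auto
      have "emeasure lborel (A' n \<inter> {..a}) + emeasure lborel (B' n \<inter> {b..}) \<le> 2 * emeasure lborel C"
        by (rule emeasure_split_add_le) (use a(1) b(1) mid in \<open>auto simp: A'_def B'_def\<close>)
      then have "(emeasure lborel (A' n \<inter> {..a}) + emeasure lborel (B' n \<inter> {b..})) + (ennreal (e/2) + ennreal (e/2))
          \<le> 2 * emeasure lborel C + ennreal e"
        using e by (intro add_mono) (auto simp flip: ennreal_plus)
      moreover have "emeasure lborel (A' n) + emeasure lborel (B' n) \<le>
         (emeasure lborel (A' n \<inter> {..a}) + emeasure lborel (B' n \<inter> {b..})) + (ennreal (e/2) + ennreal (e/2))"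
        using add_mono[OF a(2) b(2)] by (simp add: ac_simps)
      ultimately show "emeasure lborel (A' n) + emeasure lborel (B' n) \<le> 2 * emeasure lborel C + ennreal e"
        by (rule order_trans[rotated])
    qed
    then show ?thesis by (auto simp: eventually_sequentially)
  qed
  have "(\<lambda>n. emeasure lborel (A' n) + emeasure lborel (B' n)) \<longlonglongrightarrow> emeasure lborel A + emeasure lborel B"
    unfolding A'_def B'_def by (intro tendsto_add lim) auto
  from tendsto_upperbound[OF this ev] show ?thesis by simp
qed

section \<open>From level sets to functions\<close>

lemma nn_integral_layer_cake:
  fixes f :: "real \<Rightarrow> real"
  assumes [measurable]: "f \<in> borel_measurable borel"
  shows "(\<integral>\<^sup>+x. ennreal (f x) \<partial>lborel) = (\<integral>\<^sup>+l. indicator {0<..} l * emeasure lborel {x. l < f x} \<partial>lborel)"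
proof -
  have "(\<integral>\<^sup>+x. ennreal (f x) \<partial>lborel) = (\<integral>\<^sup>+x. emeasure lborel {0<..<f x} \<partial>lborel)"
  proof (rule nn_integral_cong)
    fix x show "ennreal (f x) = emeasure lborel {0<..<f x}"
      by (cases "f x \<ge> 0") (auto simp: ennreal_neg)
  qed
  also have "\<dots> = (\<integral>\<^sup>+x. \<integral>\<^sup>+l. indicator {p. 0 < snd p \<and> snd p < f (fst p)} (x, l) \<partial>lborel \<partial>lborel)"
  proof (rule nn_integral_cong)
    fix x
    have "(\<integral>\<^sup>+l. indicator {p. 0 < snd p \<and> snd p < f (fst p)} (x, l) \<partial>lborel) = (\<integral>\<^sup>+l. indicator {0<..<f x} l \<partial>lborel)"
      by (intro nn_integral_cong) (auto simp: indicator_def)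
    then show "emeasure lborel {0<..<f x} = (\<integral>\<^sup>+l. indicator {p. 0 < snd p \<and> snd p < f (fst p)} (x, l) \<partial>lborel)"
      by (simp only: nn_integral_indicator sets_lborel borel_open open_greaterThanLessThan)
  qed
  also have "\<dots> = (\<integral>\<^sup>+l. \<integral>\<^sup>+x. indicator {p. 0 < snd p \<and> snd p < f (fst p)} (x, l) \<partial>lborel \<partial>lborel)"
    by (rule lborel_pair.Fubini'[symmetric]) measurable
  also have "\<dots> = (\<integral>\<^sup>+l. indicator {0<..} l * emeasure lborel {x. l < f x} \<partial>lborel)"
  proof (rule nn_integral_cong)
    fix l :: real
    have "(\<integral>\<^sup>+x. indicator {p. 0 < snd p \<and> snd p < f (fst p)} (x, l) \<partial>lborel)
        = (\<integral>\<^sup>+x. indicator {0<..} l * indicator {x. l < f x} x \<partial>lborel)"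
      by (intro nn_integral_cong) (auto simp: indicator_def)
    also have "\<dots> = indicator {0<..} l * emeasure lborel {x. l < f x}"
      by (subst nn_integral_cmult) (auto simp: nn_integral_indicator)
    finally show "(\<integral>\<^sup>+x. indicator {p. 0 < snd p \<and> snd p < f (fst p)} (x, l) \<partial>lborel) = \<dots>" .
  qed
  finally show ?thesis .
qed

text \<open>With both suprema equal to 1, the level sets of f and g are nonempty at the same levels
  0 < l < 1, so Brunn-Minkowski applies level by level and the layer cake formula integrates it. At
  levels l >= 1 the left side vanishes.\<close>

lemma Prekopa_Leindler_real_normalized:
  fixes f g h :: "real \<Rightarrow> real"
  assumes [measurable]: "f \<in> borel_measurable borel" "g \<in> borel_measurable borel" "h \<in> borel_measurable borel"
    and le1: "\<And>x. f x \<le> 1" "\<And>x. g x \<le> 1" and nn: "\<And>x. h x \<ge> 0"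
    and ex: "\<And>l. l < 1 \<Longrightarrow> \<exists>x. l < f x" "\<And>l. l < 1 \<Longrightarrow> \<exists>x. l < g x"
    and mid: "\<And>x y. f x * g y \<le> (h ((x + y) / 2))\<^sup>2"
  shows "(\<integral>\<^sup>+x. ennreal (f x) \<partial>lborel) + (\<integral>\<^sup>+x. ennreal (g x) \<partial>lborel) \<le> 2 * (\<integral>\<^sup>+x. ennreal (h x) \<partial>lborel)"
proof -
  have meas[measurable]: "(\<lambda>l. indicator {0<..} l * emeasure lborel {x. l < u x}) \<in> borel_measurable (borel :: real measure)"
    if [measurable]: "u \<in> borel_measurable borel" for u :: "real \<Rightarrow> real"
  proof -
    have "(\<lambda>l::real. emeasure lborel {x. l < u x}) = (\<lambda>l. \<integral>\<^sup>+x. indicator {p. fst p < u (snd p)} (l, x) \<partial>lborel)"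
    proof
      fix l :: real
      have "(\<integral>\<^sup>+x. indicator {p. fst p < u (snd p)} (l, x) \<partial>lborel) = (\<integral>\<^sup>+x. indicator {x. l < u x} x \<partial>lborel)"
        by (intro nn_integral_cong) (auto simp: indicator_def)
      then show "emeasure lborel {x. l < u x} = (\<integral>\<^sup>+x. indicator {p. fst p < u (snd p)} (l, x) \<partial>lborel)"
        by (subst (asm) nn_integral_indicator) auto
    qed
    also have "\<dots> \<in> borel_measurable borel" by measurable
    finally show ?thesis by measurable
  qed
  have "(\<integral>\<^sup>+x. ennreal (f x) \<partial>lborel) + (\<integral>\<^sup>+x. ennreal (g x) \<partial>lborel)
      = (\<integral>\<^sup>+l. indicator {0<..} l * emeasure lborel {x. l < f x} + indicator {0<..} l * emeasure lborel {x. l < g x} \<partial>lborel)"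
    by (subst nn_integral_add) (auto simp: nn_integral_layer_cake)
  also have "\<dots> \<le> (\<integral>\<^sup>+l. 2 * (indicator {0<..} l * emeasure lborel {x. l < h x}) \<partial>lborel)"
  proof (rule nn_integral_mono)
    fix l :: real
    show "indicator {0<..} l * emeasure lborel {x. l < f x} + indicator {0<..} l * emeasure lborel {x. l < g x}
       \<le> 2 * (indicator {0<..} l * emeasure lborel {x. l < h x})"
    proof (cases "0 < l \<and> l < 1")
      case True
      have "emeasure lborel {x. l < f x} + emeasure lborel {x. l < g x} \<le> 2 * emeasure lborel {x. l < h x}"
      proof (rule Brunn_Minkowski_real)
        fix x y assume xy: "x \<in> {x. l < f x}" "y \<in> {x. l < g x}"
        have "l * l < f x * g y" by (rule mult_strict_mono) (use xy True in auto)
        then have "l\<^sup>2 < (h ((x + y) / 2))\<^sup>2" using mid[of x y] by (simp add: power2_eq_square)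
        then have "l < h ((x + y) / 2)" by (rule power2_less_imp_less) (rule nn)
        then show "(x + y) / 2 \<in> {x. l < h x}" by simp
      qed (use ex True in auto)
      then show ?thesis using True by simp
    next
      case False
      moreover have "{x. l < f x} = {}" "{x. l < g x} = {}" if "l \<ge> 1"
        using le1 that by (auto simp: not_less intro: order_trans)
      ultimately show ?thesis by (cases "0 < l") auto
    qed
  qed
  also have "\<dots> = 2 * (\<integral>\<^sup>+x. ennreal (h x) \<partial>lborel)"
    by (subst nn_integral_cmult) (auto simp: nn_integral_layer_cake)
  finally show ?thesis .
qed

lemma ennreal_mult_le_square_of_add_le:
  fixes u v w :: ennreal
  assumes "u + v \<le> 2 * w"
  shows "u * v \<le> w\<^sup>2"
proof (cases "w = \<top>")
  case True
  then show ?thesis by (simp add: power2_eq_square ennreal_top_mult)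
next
  case False
  then have "u + v \<noteq> \<top>" using assms by (auto simp: ennreal_mult_eq_top_iff top_unique)
  then have "u \<noteq> \<top>" "v \<noteq> \<top>" by auto
  then obtain a b c where abc: "u = ennreal a" "a \<ge> 0" "v = ennreal b" "b \<ge> 0" "w = ennreal c" "c \<ge> 0"
    using False by (metis ennreal_cases)
  have "ennreal (a + b) \<le> ennreal (2 * c)"
    using assms abc by (simp add: ennreal_mult ennreal_plus)
  then have ab: "a + b \<le> 2 * c" using abc by (subst (asm) ennreal_le_iff) auto
  have "0 \<le> (a - b)\<^sup>2" by simp
  moreover have "(a + b)\<^sup>2 \<le> (2 * c)\<^sup>2" using ab abc by (intro power_mono) auto
  ultimately have "a * b \<le> c\<^sup>2" by (simp add: power2_eq_square algebra_simps)
  then show ?thesis using abc by (simp add: ennreal_leI ennreal_power flip: ennreal_mult)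
qed

text \<open>Dividing f and g by their suprema F and G, and h by sqrt (F * G), preserves the midpoint
  hypothesis and leads to the normalized case; its additive bound becomes multiplicative by the
  inequality of arithmetic and geometric means.\<close>

lemma Prekopa_Leindler_real:
  fixes f g h :: "real \<Rightarrow> real"
  assumes [measurable]: "f \<in> borel_measurable borel" "g \<in> borel_measurable borel" "h \<in> borel_measurable borel"
    and nn: "\<And>x. f x \<ge> 0" "\<And>x. g x \<ge> 0" "\<And>x. h x \<ge> 0"
    and bd: "bdd_above (range f)" "bdd_above (range g)"
    and mid: "\<And>x y. f x * g y \<le> (h ((x + y) / 2))\<^sup>2"
  shows "(\<integral>\<^sup>+x. ennreal (f x) \<partial>lborel) * (\<integral>\<^sup>+x. ennreal (g x) \<partial>lborel) \<le> (\<integral>\<^sup>+x. ennreal (h x) \<partial>lborel)\<^sup>2"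
proof -
  define F where "F = Sup (range f)"
  define G where "G = Sup (range g)"
  have F: "f x \<le> F" and G: "g x \<le> G" for x
    unfolding F_def G_def using bd by (auto intro: cSup_upper)
  consider "F = 0" | "G = 0" | "F > 0" "G > 0"
    using F[of 0] G[of 0] nn(1,2)[of 0] by linarith
  then show ?thesis
  proof cases
    case 1
    then have "f x = 0" for x using F[of x] nn(1)[of x] by simp
    then show ?thesis by simp
  next
    case 2
    then have "g x = 0" for x using G[of x] nn(2)[of x] by simp
    then show ?thesis by simp
  next
    case 3
    define H where "H = sqrt (F * G)"
    have H: "H > 0" "H\<^sup>2 = F * G" using 3 by (auto simp: H_def)
    have scale: "(\<integral>\<^sup>+x. ennreal (u x) \<partial>lborel) = ennreal c * (\<integral>\<^sup>+x. ennreal (u x / c) \<partial>lborel)"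
      if [measurable]: "u \<in> borel_measurable borel" and c: "c > 0" and u: "\<And>x. u x \<ge> 0" for u :: "real \<Rightarrow> real" and c
    proof -
      have "ennreal (u x) = ennreal c * ennreal (u x / c)" for x
        using c u[of x] by (simp flip: ennreal_mult)
      then show ?thesis by (simp add: nn_integral_cmult)
    qed
    have "(\<integral>\<^sup>+x. ennreal (f x / F) \<partial>lborel) + (\<integral>\<^sup>+x. ennreal (g x / G) \<partial>lborel) \<le> 2 * (\<integral>\<^sup>+x. ennreal (h x / H) \<partial>lborel)"
    proof (rule Prekopa_Leindler_real_normalized)
      show "f x / F \<le> 1" "g x / G \<le> 1" "0 \<le> h x / H" for x using F G H nn 3 by auto
      fix l :: real assume l: "l < 1"
      have "l * F < Sup (range f)" "l * G < Sup (range g)" using l 3 by (auto simp: F_def[symmetric] G_def[symmetric])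
      then obtain x y where "l * F < f x" "l * G < g y"
        using less_cSup_iff[of "range f" "l * F"] less_cSup_iff[of "range g" "l * G"] bd by auto
      then show "\<exists>x. l < f x / F" "\<exists>x. l < g x / G" using 3 by (auto simp: field_simps)
    next
      fix x y
      show "f x / F * (g y / G) \<le> (h ((x + y) / 2) / H)\<^sup>2"
        using mid[of x y] 3 H by (simp add: power_divide divide_right_mono)
    qed auto
    from ennreal_mult_le_square_of_add_le[OF this]
    have "ennreal (F * G) * ((\<integral>\<^sup>+x. ennreal (f x / F) \<partial>lborel) * (\<integral>\<^sup>+x. ennreal (g x / G) \<partial>lborel))
        \<le> ennreal (F * G) * (\<integral>\<^sup>+x. ennreal (h x / H) \<partial>lborel)\<^sup>2"
      by (rule mult_left_mono) simp
    also have "\<dots> = (ennreal H * (\<integral>\<^sup>+x. ennreal (h x / H) \<partial>lborel))\<^sup>2"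
      using H by (simp add: power_mult_distrib ennreal_power)
    also have "\<dots> = (\<integral>\<^sup>+x. ennreal (h x) \<partial>lborel)\<^sup>2" using scale[of h H] H nn by simp
    finally show ?thesis
      using scale[of f F] scale[of g G] 3 nn by (simp add: ennreal_mult ac_simps)
  qed
qed

section \<open>A Cramer-Wold theorem\<close>

text \<open>Levy's uniqueness theorem after normalization: t = 0 in the cosine hypothesis shows that
  the total masses agree, and dividing by this mass gives probability laws with the same
  characteristic function. Total mass 0 is treated apart.\<close>

lemma finite_measure_eqI_cos_sin:
  fixes M N :: "real measure"
  assumes fin: "finite_measure M" "finite_measure N"
    and sets[simp]: "sets M = sets borel" "sets N = sets borel"
    and cos: "\<And>t. (\<integral>x. cos (t * x) \<partial>M) = (\<integral>x. cos (t * x) \<partial>N)"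
    and sin: "\<And>t. (\<integral>x. sin (t * x) \<partial>M) = (\<integral>x. sin (t * x) \<partial>N)"
  shows "M = N"
proof -
  interpret M: finite_measure M by fact
  interpret N: finite_measure N by fact
  have space[simp]: "space M = UNIV" "space N = UNIV"
    using sets_eq_imp_space_eq[OF sets(1)] sets_eq_imp_space_eq[OF sets(2)] by auto
  define c where "c = measure M UNIV"
  have cN: "measure N UNIV = c" using cos[of 0] by (simp add: c_def)
  show ?thesis
  proof (cases "c = 0")
    case True
    show ?thesis
    proof (rule measure_eqI)
      fix A assume "A \<in> sets M"
      have "emeasure M A \<le> emeasure M UNIV" "emeasure N A \<le> emeasure N UNIV"
        by (auto intro!: emeasure_mono)
      then show "emeasure M A = emeasure N A"
        using True cN by (simp add: M.emeasure_eq_measure N.emeasure_eq_measure c_def measure_le_0_iff)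
    qed simp
  next
    case False
    then have c: "c > 0" by (simp add: c_def zero_less_measure_iff)
    have norm: "real_distribution (density L (\<lambda>_. ennreal (1 / c)))"
      if L: "finite_measure L" "sets L = sets borel" "measure L UNIV = c" for L :: "real measure"
    proof -
      interpret finite_measure L by fact
      have [simp]: "space L = UNIV" using sets_eq_imp_space_eq[OF L(2)] by simp
      have m: "UNIV \<in> sets L" using L(2) by simp
      show ?thesis
        unfolding real_distribution_def real_distribution_axioms_def
      proof (intro conjI prob_spaceI)
        have "emeasure (density L (\<lambda>_. ennreal (1 / c))) UNIV = ennreal (1 / c) * ennreal c"
          using m L(3) by (simp add: emeasure_density nn_integral_cmult emeasure_eq_measure)
        also have "\<dots> = 1" using c by (simp flip: ennreal_mult)
        finally show "emeasure (density L (\<lambda>_. ennreal (1 / c))) (space (density L (\<lambda>_. ennreal (1 / c)))) = 1" by simp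
      qed (use L in auto)
    qed
    have ch: "char (density L (\<lambda>_. ennreal (1 / c))) t =
        complex_of_real ((\<integral>x. cos (t * x) \<partial>L) / c) + \<i> * complex_of_real ((\<integral>x. sin (t * x) \<partial>L) / c)"
      if L: "finite_measure L" "sets L = sets borel" for L :: "real measure" and t
    proof -
      interpret finite_measure L by fact
      have [measurable_cong]: "sets L = sets borel" by fact
      have int: "integrable L (\<lambda>x. complex_of_real (cos (t * x)))" "integrable L (\<lambda>x. complex_of_real (sin (t * x)))"
        by (auto intro!: integrable_const_bound[of _ 1])
      have "char (density L (\<lambda>_. ennreal (1 / c))) t = (\<integral>x. (1 / c) *\<^sub>R iexp (t * x) \<partial>L)"
        unfolding char_def by (subst integral_density) (use c in auto)
      also have "\<dots> = (1 / c) *\<^sub>R (\<integral>x. iexp (t * x) \<partial>L)" by simp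
      also have "(\<integral>x. iexp (t * x) \<partial>L) = (\<integral>x. complex_of_real (cos (t * x)) + \<i> * complex_of_real (sin (t * x)) \<partial>L)"
        by (intro Bochner_Integration.integral_cong) (auto simp: complex_eq_iff Re_exp Im_exp)
      also have "\<dots> = complex_of_real (\<integral>x. cos (t * x) \<partial>L) + \<i> * complex_of_real (\<integral>x. sin (t * x) \<partial>L)"
        using int by simp
      finally show ?thesis by (simp add: scaleR_conv_of_real add_divide_distrib distrib_left divide_inverse mult.commute)
    qed
    have eq: "density M (\<lambda>_. ennreal (1 / c)) = density N (\<lambda>_. ennreal (1 / c))"
      by (rule Levy_uniqueness) (auto intro!: norm fin cN simp: ch fin cos sin c_def[symmetric])
    show ?thesis
    proof (rule measure_eqI)
      fix A assume A: "A \<in> sets M"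
      have d: "emeasure L A = ennreal c * emeasure (density L (\<lambda>_. ennreal (1 / c))) A"
        if "A \<in> sets L" for L :: "real measure"
      proof -
        have "ennreal c * emeasure (density L (\<lambda>_. ennreal (1 / c))) A = (ennreal c * ennreal (1 / c)) * emeasure L A"
          using that by (simp add: emeasure_density nn_integral_cmult mult.assoc)
        also have "ennreal c * ennreal (1 / c) = 1" using c by (simp flip: ennreal_mult)
        finally show ?thesis by simp
      qed
      show "emeasure M A = emeasure N A"
        using d[of M] d[of N] A eq by simp
    qed simp
  qed
qed

text \<open>One-dimensional uniqueness for the laws of X under the density w. Nonnegativity of w
  makes these laws measures, and the bound c makes them finite.\<close>

lemma weighted_integral_eqI_cos_sin:
  fixes X w :: "'b \<Rightarrow> real"
  assumes fin: "finite_measure P" "finite_measure Q" and sets: "sets Q = sets P"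
    and [measurable]: "X \<in> borel_measurable P" "w \<in> borel_measurable P" "A \<in> sets borel"
    and w: "\<And>x. 0 \<le> w x" "\<And>x. w x \<le> c"
    and cos: "\<And>t. (\<integral>x. w x * cos (t * X x) \<partial>P) = (\<integral>x. w x * cos (t * X x) \<partial>Q)"
    and sin: "\<And>t. (\<integral>x. w x * sin (t * X x) \<partial>P) = (\<integral>x. w x * sin (t * X x) \<partial>Q)"
  shows "(\<integral>x. w x * indicator A (X x) \<partial>P) = (\<integral>x. w x * indicator A (X x) \<partial>Q)"
proof -
  have [measurable_cong]: "sets Q = sets P" by fact
  define D where "D L = distr (density L w) borel X" for L
  have fD: "finite_measure (D L)" if L: "finite_measure L" "sets L = sets P" for L
  proof -
    interpret finite_measure L by fact
    have [measurable_cong]: "sets L = sets P" by fact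
    have "integrable L w"
      by (rule integrable_const_bound[of _ c]) (use w in auto)
    then have "(\<integral>\<^sup>+x. ennreal (w x) \<partial>L) < \<infinity>"
      using w by (subst nn_integral_eq_integral) auto
    then have "finite_measure (density L w)"
      by (intro finite_measureI) (simp add: emeasure_density top.not_eq_extremum cong: nn_integral_cong)
    then show ?thesis unfolding D_def by (intro finite_measure.finite_measure_distr) auto
  qed
  have int: "(\<integral>x. g x \<partial>D L) = (\<integral>x. w x * g (X x) \<partial>L)"
    if L: "sets L = sets P" and [measurable]: "g \<in> borel_measurable borel" for L and g :: "real \<Rightarrow> real"
  proof -
    have [measurable_cong]: "sets L = sets P" by fact
    show ?thesis unfolding D_def
      by (subst integral_distr) (auto simp: integral_real_density w)
  qed
  have "D P = D Q"
    by (rule finite_measure_eqI_cos_sin) (use fin sets cos sin in \<open>auto intro!: fD simp: int\<close>, simp_all add: D_def)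
  moreover have "(\<integral>x. w x * indicator A (X x) \<partial>P) = (\<integral>x. indicator A x \<partial>D P)"
    by (rule int[symmetric]) auto
  moreover have "(\<integral>x. w x * indicator A (X x) \<partial>Q) = (\<integral>x. indicator A x \<partial>D Q)"
    by (rule int[symmetric]) (use sets in auto)
  ultimately show ?thesis by simp
qed

text \<open>The one-dimensional uniqueness theorem only applies to positive measures, so the law of
  \<open>X i\<close> is compared under the densities \<open>1 + cos \<circ> f\<close> and \<open>1 + sin \<circ> f\<close>. This
  shows that the hypotheses are inherited by the restrictions of \<open>P\<close> and \<open>Q\<close> to
  \<open>{X i \<in> A i}\<close>, and the coordinates can be treated one after the other.\<close>

lemma Cramer_Wold_measure:
  fixes X :: "'i \<Rightarrow> 'b \<Rightarrow> real"
  assumes "finite I" "finite_measure P" "finite_measure Q" "sets Q = sets P"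
    and V0: "(\<lambda>_. 0) \<in> V"
    and add: "\<And>f g t. f \<in> V \<Longrightarrow> g \<in> V \<Longrightarrow> (\<lambda>x. f x + t * g x) \<in> V"
    and V: "\<And>f. f \<in> V \<Longrightarrow> f \<in> borel_measurable P"
    and "\<And>f. f \<in> V \<Longrightarrow> (\<integral>x. cos (f x) \<partial>P) = (\<integral>x. cos (f x) \<partial>Q)"
    and "\<And>f. f \<in> V \<Longrightarrow> (\<integral>x. sin (f x) \<partial>P) = (\<integral>x. sin (f x) \<partial>Q)"
    and "\<And>i. i \<in> I \<Longrightarrow> X i \<in> V" "\<And>i. i \<in> I \<Longrightarrow> A i \<in> sets borel"
  shows "measure P {x\<in>space P. \<forall>i\<in>I. X i x \<in> A i} = measure Q {x\<in>space Q. \<forall>i\<in>I. X i x \<in> A i}"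
  using assms(1,2,3,4) V assms(8-)
proof (induction I arbitrary: P Q)
  case empty
  from empty.prems(5)[OF V0] show ?case by simp
next
  case (insert i I P Q)
  note V = insert.prems(4) and cos = insert.prems(5) and sin = insert.prems(6)
  have sQ[measurable_cong]: "sets Q = sets P" by fact
  interpret P: finite_measure P by fact
  interpret Q: finite_measure Q by fact
  have spQ: "space Q = space P" using sets_eq_imp_space_eq[OF sQ] .
  have [measurable]: "X i \<in> borel_measurable P" "A i \<in> sets borel" and XV: "X i \<in> V"
    using insert.prems V by auto
  have bounded: "integrable P g" "integrable Q g"
    if [measurable]: "g \<in> borel_measurable P" and "\<And>x. \<bar>g x\<bar> \<le> 1" for g :: "'b \<Rightarrow> real"
    by (auto intro!: P.integrable_const_bound[of _ 1] Q.integrable_const_bound[of _ 1] simp: that)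
  \<comment> \<open>Product-to-sum formulas turn these products into transforms of f + t * X i and f
    - t * X i, both of which lie in V.\<close>
  have trig: "(\<integral>x. cos (f x) * cos (t * X i x) \<partial>P) = (\<integral>x. cos (f x) * cos (t * X i x) \<partial>Q)"
    "(\<integral>x. sin (f x) * cos (t * X i x) \<partial>P) = (\<integral>x. sin (f x) * cos (t * X i x) \<partial>Q)"
    "(\<integral>x. cos (f x) * sin (t * X i x) \<partial>P) = (\<integral>x. cos (f x) * sin (t * X i x) \<partial>Q)"
    "(\<integral>x. sin (f x) * sin (t * X i x) \<partial>P) = (\<integral>x. sin (f x) * sin (t * X i x) \<partial>Q)"
    if f: "f \<in> V" for f t
  proof -
    have [measurable]: "f \<in> borel_measurable P" by (rule V[OF f])
    have p: "(\<lambda>x. f x + t * X i x) \<in> V" by (rule add[OF f XV])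
    have m: "(\<lambda>x. f x - t * X i x) \<in> V" using add[OF f XV, of "- t"] by simp
    show "(\<integral>x. cos (f x) * cos (t * X i x) \<partial>P) = (\<integral>x. cos (f x) * cos (t * X i x) \<partial>Q)"
      using cos[OF p] cos[OF m] by (simp add: cos_times_cos bounded)
    show "(\<integral>x. sin (f x) * cos (t * X i x) \<partial>P) = (\<integral>x. sin (f x) * cos (t * X i x) \<partial>Q)"
      using sin[OF p] sin[OF m] by (simp add: sin_times_cos bounded)
    show "(\<integral>x. cos (f x) * sin (t * X i x) \<partial>P) = (\<integral>x. cos (f x) * sin (t * X i x) \<partial>Q)"
      using sin[OF p] sin[OF m] by (simp add: cos_times_sin bounded)
    show "(\<integral>x. sin (f x) * sin (t * X i x) \<partial>P) = (\<integral>x. sin (f x) * sin (t * X i x) \<partial>Q)"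
      using cos[OF p] cos[OF m] by (simp add: sin_times_sin bounded)
  qed
  have X: "(\<integral>x. cos (t * X i x) \<partial>P) = (\<integral>x. cos (t * X i x) \<partial>Q)"
      "(\<integral>x. sin (t * X i x) \<partial>P) = (\<integral>x. sin (t * X i x) \<partial>Q)" for t
    using cos[OF add[OF V0 XV]] sin[OF add[OF V0 XV]] by simp_all
  let ?a = "\<lambda>x. indicator (A i) (X i x) :: real"
  have a: "(\<integral>x. ?a x \<partial>P) = (\<integral>x. ?a x \<partial>Q)"
    using weighted_integral_eqI_cos_sin[of P Q "X i" "\<lambda>_. 1" "A i" 1] insert.prems X by simp
  have abs: "\<bar>?a x * u\<bar> \<le> 1" "\<bar>?a x\<bar> \<le> 1" "\<bar>u * ?a x\<bar> \<le> 1" if "\<bar>u\<bar> \<le> 1" for x u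
    using that by (auto simp: indicator_def)
  have c: "(\<integral>x. cos (f x) * ?a x \<partial>P) = (\<integral>x. cos (f x) * ?a x \<partial>Q)" if f: "f \<in> V" for f
  proof -
    have [measurable]: "f \<in> borel_measurable P" by (rule V[OF f])
    have "(\<integral>x. (1 + cos (f x)) * ?a x \<partial>P) = (\<integral>x. (1 + cos (f x)) * ?a x \<partial>Q)"
    proof (rule weighted_integral_eqI_cos_sin[where c = 2])
      show "0 \<le> 1 + cos (f x)" "1 + cos (f x) \<le> 2" for x
        using cos_ge_minus_one[of "f x"] cos_le_one[of "f x"] by linarith+
    qed (use insert.prems trig[OF f] X in \<open>auto simp: distrib_right bounded abs_mult mult_le_one\<close>)
    then show ?thesis using a by (simp add: distrib_right bounded abs)
  qed
  have s: "(\<integral>x. sin (f x) * ?a x \<partial>P) = (\<integral>x. sin (f x) * ?a x \<partial>Q)" if f: "f \<in> V" for f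
  proof -
    have [measurable]: "f \<in> borel_measurable P" by (rule V[OF f])
    have "(\<integral>x. (1 + sin (f x)) * ?a x \<partial>P) = (\<integral>x. (1 + sin (f x)) * ?a x \<partial>Q)"
    proof (rule weighted_integral_eqI_cos_sin[where c = 2])
      show "0 \<le> 1 + sin (f x)" "1 + sin (f x) \<le> 2" for x
        using sin_ge_minus_one[of "f x"] sin_le_one[of "f x"] by linarith+
    qed (use insert.prems trig[OF f] X in \<open>auto simp: distrib_right bounded abs_mult mult_le_one\<close>)
    then show ?thesis using a by (simp add: distrib_right bounded abs)
  qed
  define R where "R L = density L (\<lambda>x. ennreal (?a x))" for L
  have R: "finite_measure (R L)" "\<And>g. g \<in> borel_measurable P \<Longrightarrow> (\<integral>x. g x \<partial>R L) = (\<integral>x. g x * ?a x \<partial>L)"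
    "measure (R L) {x \<in> space L. \<forall>j\<in>I. X j x \<in> A j} = measure L {x \<in> space L. \<forall>j\<in>insert i I. X j x \<in> A j}"
    if L: "finite_measure L" "sets L = sets P" for L
  proof -
    interpret finite_measure L by fact
    have [measurable_cong]: "sets L = sets P" by fact
    have sp: "space L = space P" using sets_eq_imp_space_eq[OF L(2)] .
    show "finite_measure (R L)"
    proof (rule finite_measureI)
      have "emeasure (R L) (space (R L)) = (\<integral>\<^sup>+x. ennreal (?a x) \<partial>L)"
        unfolding R_def by (simp add: emeasure_density cong: nn_integral_cong)
      also have "\<dots> \<le> (\<integral>\<^sup>+x. 1 \<partial>L)" by (intro nn_integral_mono) (auto simp: indicator_def)
      finally show "emeasure (R L) (space (R L)) \<noteq> \<infinity>" by (auto simp: top_unique)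
    qed
    show "(\<integral>x. g x \<partial>R L) = (\<integral>x. g x * ?a x \<partial>L)" if [measurable]: "g \<in> borel_measurable P" for g
      unfolding R_def by (subst integral_real_density) (auto simp: mult.commute)
    have [measurable]: "X j \<in> borel_measurable P" "A j \<in> sets borel" if "j \<in> I" for j
      using insert.prems V that by auto
    have [measurable]: "{x \<in> space P. \<forall>j\<in>I. X j x \<in> A j} \<in> sets P"
      using \<open>finite I\<close> by measurable
    have "emeasure (R L) {x \<in> space L. \<forall>j\<in>I. X j x \<in> A j}
        = (\<integral>\<^sup>+x. ennreal (?a x) * indicator {x \<in> space L. \<forall>j\<in>I. X j x \<in> A j} x \<partial>L)"
      unfolding R_def by (rule emeasure_density) (auto simp: sp)
    also have "\<dots> = (\<integral>\<^sup>+x. indicator {x \<in> space L. \<forall>j\<in>insert i I. X j x \<in> A j} x \<partial>L)"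
      by (rule nn_integral_cong) (auto split: split_indicator)
    also have "\<dots> = emeasure L {x \<in> space L. \<forall>j\<in>insert i I. X j x \<in> A j}"
    proof (rule nn_integral_indicator)
      have "{x \<in> space L. \<forall>j\<in>insert i I. X j x \<in> A j} = {x \<in> space P. \<forall>j\<in>I. X j x \<in> A j} \<inter> {x\<in>space P. X i x \<in> A i}"
        by (auto simp: sp)
      then show "{x \<in> space L. \<forall>j\<in>insert i I. X j x \<in> A j} \<in> sets L" by simp
    qed
    finally show "measure (R L) {x \<in> space L. \<forall>j\<in>I. X j x \<in> A j} = measure L {x \<in> space L. \<forall>j\<in>insert i I. X j x \<in> A j}"
      by (simp add: measure_def)
  qed
  have "measure (R P) {x\<in>space (R P). \<forall>j\<in>I. X j x \<in> A j} = measure (R Q) {x\<in>space (R Q). \<forall>j\<in>I. X j x \<in> A j}"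
  proof (rule insert.IH)
    show "finite_measure (R P)" "finite_measure (R Q)"
      using R(1) insert.prems(1,2) sQ by auto
    show "sets (R Q) = sets (R P)" using sQ by (simp add: R_def)
    show "f \<in> borel_measurable (R P)" if "f \<in> V" for f using V[OF that] by (simp add: R_def)
    show "(\<integral>x. cos (f x) \<partial>R P) = (\<integral>x. cos (f x) \<partial>R Q)"
      "(\<integral>x. sin (f x) \<partial>R P) = (\<integral>x. sin (f x) \<partial>R Q)" if f: "f \<in> V" for f
    proof -
      have [measurable]: "f \<in> borel_measurable P" by (rule V[OF f])
      show "(\<integral>x. cos (f x) \<partial>R P) = (\<integral>x. cos (f x) \<partial>R Q)"
        "(\<integral>x. sin (f x) \<partial>R P) = (\<integral>x. sin (f x) \<partial>R Q)"
        using c[OF f] s[OF f] insert.prems(1,2) sQ by (simp_all add: R(2))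
    qed
  qed (use insert.prems in auto)
  then show ?case
    using R(3)[OF insert.prems(1) refl] R(3)[OF insert.prems(2) sQ] by (simp add: R_def)
qed

text \<open>Boxes generate the product \<sigma>-algebra and are stable under intersection, so finite
  measures that agree on them are equal.\<close>

lemma Cramer_Wold_distr:
  fixes X :: "'i \<Rightarrow> 'b \<Rightarrow> real"
  assumes I: "finite I" and fin: "finite_measure P" "finite_measure Q" and sQ: "sets Q = sets P"
    and V0: "(\<lambda>_. 0) \<in> V"
    and add: "\<And>f g t. f \<in> V \<Longrightarrow> g \<in> V \<Longrightarrow> (\<lambda>x. f x + t * g x) \<in> V"
    and V: "\<And>f. f \<in> V \<Longrightarrow> f \<in> borel_measurable P"
    and cos: "\<And>f. f \<in> V \<Longrightarrow> (\<integral>x. cos (f x) \<partial>P) = (\<integral>x. cos (f x) \<partial>Q)"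
    and sin: "\<And>f. f \<in> V \<Longrightarrow> (\<integral>x. sin (f x) \<partial>P) = (\<integral>x. sin (f x) \<partial>Q)"
    and X: "\<And>i. i \<in> I \<Longrightarrow> X i \<in> V"
  shows "distr P (PiM I (\<lambda>_. borel)) (\<lambda>x. \<lambda>i\<in>I. X i x) = distr Q (PiM I (\<lambda>_. borel)) (\<lambda>x. \<lambda>i\<in>I. X i x)"
proof -
  have [measurable_cong]: "sets Q = sets P" by fact
  have spQ: "space Q = space P" using sets_eq_imp_space_eq[OF sQ] .
  interpret P: finite_measure P by fact
  interpret Q: finite_measure Q by fact
  have [measurable]: "X i \<in> borel_measurable P" if "i \<in> I" for i using V[OF X[OF that]] .
  have m[measurable]: "(\<lambda>x. \<lambda>i\<in>I. X i x) \<in> P \<rightarrow>\<^sub>M PiM I (\<lambda>_. borel)" by measurable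
  show ?thesis
  proof (rule measure_eqI_PiM_finite[OF I, where A = "\<lambda>_::nat. space (PiM I (\<lambda>_. borel))"])
    fix A :: "'i \<Rightarrow> real set" assume A: "\<And>i. i \<in> I \<Longrightarrow> A i \<in> sets borel"
    have PA: "Pi\<^sub>E I A \<in> sets (PiM I (\<lambda>_. borel))" using A I by (intro sets_PiM_I_finite) auto
    have vim: "(\<lambda>x. \<lambda>i\<in>I. X i x) -` Pi\<^sub>E I A \<inter> space P = {x\<in>space P. \<forall>i\<in>I. X i x \<in> A i}"
      by (auto simp: PiE_iff)
    have "measure P {x\<in>space P. \<forall>i\<in>I. X i x \<in> A i} = measure Q {x\<in>space Q. \<forall>i\<in>I. X i x \<in> A i}"
      by (rule Cramer_Wold_measure[OF I fin sQ V0 add V cos sin X A])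
    then show "emeasure (distr P (PiM I (\<lambda>_. borel)) (\<lambda>x. \<lambda>i\<in>I. X i x)) (Pi\<^sub>E I A) =
        emeasure (distr Q (PiM I (\<lambda>_. borel)) (\<lambda>x. \<lambda>i\<in>I. X i x)) (Pi\<^sub>E I A)"
      using PA by (simp add: emeasure_distr vim spQ P.emeasure_eq_measure Q.emeasure_eq_measure)
  next
    show "range (\<lambda>_::nat. space (PiM I (\<lambda>_. borel))) \<subseteq> prod_algebra I (\<lambda>_. borel :: real measure)"
      using I by (auto simp: space_PiM intro!: prod_algebraI_finite)
    interpret D: finite_measure "distr P (PiM I (\<lambda>_. borel)) (\<lambda>x. \<lambda>i\<in>I. X i x)"
      by (rule P.finite_measure_distr) (rule m)
    show "emeasure (distr P (PiM I (\<lambda>_. borel)) (\<lambda>x. \<lambda>i\<in>I. X i x)) (space (PiM I (\<lambda>_. borel))) \<noteq> \<infinity>" for i :: nat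
      by simp
  qed auto
qed

section \<open>Log-concavity of Gaussian measures\<close>

text \<open>Log-concavity of a measure in the functional (Prekopa-Leindler) form, which is stable under
  products by Fubini. Restricting to test functions bounded by 1 keeps all integrals finite.\<close>

definition log_concave_real :: "real measure \<Rightarrow> bool" where
  "log_concave_real N \<longleftrightarrow> (\<forall>\<phi> \<psi> \<eta>. \<phi> \<in> borel_measurable borel \<longrightarrow> \<psi> \<in> borel_measurable borel \<longrightarrow>
     \<eta> \<in> borel_measurable borel \<longrightarrow> (\<forall>u. \<phi> u \<le> 1 \<and> \<psi> u \<le> 1 \<and> \<eta> u \<le> 1) \<longrightarrow>
     (\<forall>u v. \<phi> u * \<psi> v \<le> (\<eta> ((u + v) / 2))\<^sup>2) \<longrightarrow>
     (\<integral>\<^sup>+u. \<phi> u \<partial>N) * (\<integral>\<^sup>+u. \<psi> u \<partial>N) \<le> (\<integral>\<^sup>+u. \<eta> u \<partial>N :: ennreal)\<^sup>2)"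

text \<open>The midpoint enters as a third point w of the product space, given by its coordinates in
  I, which avoids arithmetic on extensional functions.\<close>

definition log_concave_PiM :: "'i set \<Rightarrow> ('i \<Rightarrow> real) measure \<Rightarrow> bool" where
  "log_concave_PiM I N \<longleftrightarrow> (\<forall>\<phi> \<psi> \<eta>. \<phi> \<in> borel_measurable (PiM I (\<lambda>_. borel)) \<longrightarrow>
     \<psi> \<in> borel_measurable (PiM I (\<lambda>_. borel)) \<longrightarrow> \<eta> \<in> borel_measurable (PiM I (\<lambda>_. borel)) \<longrightarrow>
     (\<forall>u. \<phi> u \<le> 1 \<and> \<psi> u \<le> 1 \<and> \<eta> u \<le> 1) \<longrightarrow>
     (\<forall>u v w. u \<in> space (PiM I (\<lambda>_. borel :: real measure)) \<longrightarrow> v \<in> space (PiM I (\<lambda>_. borel :: real measure)) \<longrightarrow>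
        w \<in> space (PiM I (\<lambda>_. borel :: real measure)) \<longrightarrow>
        (\<forall>i\<in>I. w i = (u i + v i) / 2) \<longrightarrow> \<phi> u * \<psi> v \<le> (\<eta> w)\<^sup>2) \<longrightarrow>
     (\<integral>\<^sup>+u. \<phi> u \<partial>N) * (\<integral>\<^sup>+u. \<psi> u \<partial>N) \<le> (\<integral>\<^sup>+u. \<eta> u \<partial>N :: ennreal)\<^sup>2)"

lemma log_concave_return: "log_concave_real (return borel (0::real))"
proof -
  have "\<phi> 0 * \<psi> 0 \<le> (\<eta> 0)\<^sup>2"
    if "\<And>u v. \<phi> u * \<psi> v \<le> (\<eta> ((u + v) / 2))\<^sup>2" for \<phi> \<psi> \<eta> :: "real \<Rightarrow> ennreal"
    using that[of 0 0] by simp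
  then show ?thesis unfolding log_concave_real_def by (simp add: nn_integral_return)
qed

lemma normal_density_midpoint:
  assumes "\<sigma> > 0"
  shows "normal_density 0 \<sigma> x * normal_density 0 \<sigma> y \<le> (normal_density 0 \<sigma> ((x + y) / 2))\<^sup>2"
proof -
  have "- x\<^sup>2 / (2 * \<sigma>\<^sup>2) + - y\<^sup>2 / (2 * \<sigma>\<^sup>2) \<le> 2 * (- ((x + y) / 2)\<^sup>2 / (2 * \<sigma>\<^sup>2))"
  proof -
    have "0 \<le> (x - y)\<^sup>2" by simp
    then have "2 * ((x + y) / 2)\<^sup>2 \<le> x\<^sup>2 + y\<^sup>2" by (simp add: power2_eq_square field_simps)
    then have "(2 * ((x + y) / 2)\<^sup>2) / (2 * \<sigma>\<^sup>2) \<le> (x\<^sup>2 + y\<^sup>2) / (2 * \<sigma>\<^sup>2)"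
      by (rule divide_right_mono) simp
    then show ?thesis by (simp only: add_divide_distrib minus_divide_left[symmetric] times_divide_eq_right)
  qed
  then have "exp (- x\<^sup>2 / (2 * \<sigma>\<^sup>2)) * exp (- y\<^sup>2 / (2 * \<sigma>\<^sup>2)) \<le> (exp (- ((x + y) / 2)\<^sup>2 / (2 * \<sigma>\<^sup>2)))\<^sup>2"
    by (simp flip: exp_add exp_double)
  then have "(1 / sqrt (2 * pi * \<sigma>\<^sup>2))\<^sup>2 * (exp (- x\<^sup>2 / (2 * \<sigma>\<^sup>2)) * exp (- y\<^sup>2 / (2 * \<sigma>\<^sup>2)))
     \<le> (1 / sqrt (2 * pi * \<sigma>\<^sup>2))\<^sup>2 * (exp (- ((x + y) / 2)\<^sup>2 / (2 * \<sigma>\<^sup>2)))\<^sup>2"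
    by (rule mult_left_mono) simp
  then show ?thesis
    by (simp only: normal_density_def diff_0_right power_mult_distrib power2_eq_square ac_simps)
qed

text \<open>Prekopa-Leindler for the products of the test functions with the density, which
  satisfies the midpoint inequality itself. The bound 1 on the test functions makes
  \<open>enn2real\<close> lossless and keeps the products bounded.\<close>

lemma log_concave_normal:
  assumes \<sigma>: "\<sigma> > 0"
  shows "log_concave_real (density lborel (\<lambda>t. ennreal (normal_density 0 \<sigma> t)))"
  unfolding log_concave_real_def
proof (intro allI impI)
  fix \<phi> \<psi> \<eta> :: "real \<Rightarrow> ennreal"
  assume [measurable]: "\<phi> \<in> borel_measurable borel" "\<psi> \<in> borel_measurable borel" "\<eta> \<in> borel_measurable borel"
    and le1: "\<forall>u. \<phi> u \<le> 1 \<and> \<psi> u \<le> 1 \<and> \<eta> u \<le> 1"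
    and mid: "\<forall>u v. \<phi> u * \<psi> v \<le> (\<eta> ((u + v) / 2))\<^sup>2"
  let ?\<rho> = "normal_density 0 \<sigma>"
  let ?r = "\<lambda>\<phi> x. enn2real (\<phi> x) * ?\<rho> x"
  have int: "(\<integral>\<^sup>+u. f u \<partial>density lborel (\<lambda>t. ennreal (?\<rho> t))) = (\<integral>\<^sup>+u. ennreal (?r f u) \<partial>lborel)"
    if [measurable]: "f \<in> borel_measurable borel" and f: "\<And>u. f u \<le> 1" for f :: "real \<Rightarrow> ennreal"
  proof -
    have "f u < \<top>" for u using f[of u] by (simp add: order_le_less_trans)
    then have "ennreal (?r f u) = ennreal (?\<rho> u) * f u" for u
      by (simp add: ennreal_mult mult.commute)
    then show ?thesis by (simp add: nn_integral_density)
  qed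
  have r1: "enn2real (f u) \<le> 1" if "f u \<le> 1" for f :: "real \<Rightarrow> ennreal" and u
    using enn2real_mono[OF that] by simp
  have \<rho>le: "?\<rho> x \<le> 1 / sqrt (2 * pi * \<sigma>\<^sup>2)" for x
    unfolding normal_density_def using mult_left_mono[of "exp (- (x - 0)\<^sup>2 / (2 * \<sigma>\<^sup>2))" 1 "1 / sqrt (2 * pi * \<sigma>\<^sup>2)"]
    by simp
  have bdd: "bdd_above (range (?r f))" if "\<And>u. f u \<le> 1" for f
  proof (rule bdd_aboveI2)
    fix x show "?r f x \<le> 1 * (1 / sqrt (2 * pi * \<sigma>\<^sup>2))"
      by (intro mult_mono r1 that \<rho>le) auto
  qed
  have "(\<integral>\<^sup>+x. ennreal (?r \<phi> x) \<partial>lborel) * (\<integral>\<^sup>+x. ennreal (?r \<psi> x) \<partial>lborel) \<le> (\<integral>\<^sup>+x. ennreal (?r \<eta> x) \<partial>lborel)\<^sup>2"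
  proof (rule Prekopa_Leindler_real)
    fix x y
    have "\<eta> ((x + y) / 2) < \<top>" using le1 ennreal_one_less_top order_le_less_trans by blast
    then have "(\<eta> ((x + y) / 2))\<^sup>2 < \<top>" by (simp add: power2_eq_square ennreal_mult_less_top)
    then have "enn2real (\<phi> x) * enn2real (\<psi> y) \<le> (enn2real (\<eta> ((x + y) / 2)))\<^sup>2"
      using mid enn2real_mono[of "\<phi> x * \<psi> y" "(\<eta> ((x + y) / 2))\<^sup>2"]
      by (simp add: enn2real_mult power2_eq_square)
    then have "(enn2real (\<phi> x) * enn2real (\<psi> y)) * (?\<rho> x * ?\<rho> y)
        \<le> (enn2real (\<eta> ((x + y) / 2)))\<^sup>2 * (?\<rho> ((x + y) / 2))\<^sup>2"
      using normal_density_midpoint[OF \<sigma>] by (intro mult_mono) auto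
    then show "?r \<phi> x * ?r \<psi> y \<le> (?r \<eta> ((x + y) / 2))\<^sup>2"
      by (simp add: power_mult_distrib ac_simps)
  qed (use le1 bdd in auto)
  then show "(\<integral>\<^sup>+u. \<phi> u \<partial>density lborel (\<lambda>t. ennreal (?\<rho> t))) * (\<integral>\<^sup>+u. \<psi> u \<partial>density lborel (\<lambda>t. ennreal (?\<rho> t)))
    \<le> (\<integral>\<^sup>+u. \<eta> u \<partial>density lborel (\<lambda>t. ennreal (?\<rho> t)))\<^sup>2"
    using le1 by (simp add: int)
qed

text \<open>Integrating the new variable first turns a test function f into \<open>F f\<close>.
  Since \<open>T\<close> is affine, T u s and T v t have the midpoint T w ((s + t) / 2) when w is
  the midpoint of u and v. So log-concavity of N gives the midpoint inequality for the functions
  \<open>F f\<close>, to which log-concavity of the old coordinates applies.\<close>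

lemma log_concave_PiM_insert:
  fixes X :: "'i \<Rightarrow> 'b \<Rightarrow> real"
  assumes I: "finite I" "i \<notin> I" and P: "prob_space P" and N: "prob_space N" "sets N = sets borel"
    and X: "\<And>j. j \<in> I \<Longrightarrow> X j \<in> borel_measurable P"
    and lcX: "log_concave_PiM I (distr P (PiM I (\<lambda>_. borel)) (\<lambda>x. \<lambda>j\<in>I. X j x))"
    and lcN: "log_concave_real N"
  shows "log_concave_PiM (insert i I)
    (distr (P \<Otimes>\<^sub>M N) (PiM (insert i I) (\<lambda>_. borel))
      (\<lambda>p. \<lambda>j\<in>insert i I. if j = i then (\<Sum>k\<in>I. a k * X k (fst p)) + snd p else X j (fst p)))"
  unfolding log_concave_PiM_def
proof (intro allI impI)
  interpret P: prob_space P by fact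
  interpret N: prob_space N by fact
  have [measurable_cong]: "sets N = sets borel" by fact
  have [measurable]: "X j \<in> borel_measurable P" if "j \<in> I" for j using X[OF that] .
  define B where "B I = PiM I (\<lambda>_. borel :: real measure)" for I :: "'i set"
  let ?J = "insert i I"
  let ?Y = "\<lambda>p. \<lambda>j\<in>?J. if j = i then (\<Sum>k\<in>I. a k * X k (fst p)) + snd p else X j (fst p)"
  let ?X = "\<lambda>x. \<lambda>j\<in>I. X j x"
  define T where "T u t = (\<lambda>j\<in>?J. if j = i then (\<Sum>k\<in>I. a k * u k) + t else u j)" for u :: "'i \<Rightarrow> real" and t
  have T[measurable]: "(\<lambda>p. T (fst p) (snd p)) \<in> B I \<Otimes>\<^sub>M borel \<rightarrow>\<^sub>M B ?J"
    unfolding T_def B_def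
  proof (rule measurable_restrict)
    fix j assume "j \<in> ?J"
    then show "(\<lambda>p. if j = i then (\<Sum>k\<in>I. a k * fst p k) + snd p else fst p j) \<in> borel_measurable (PiM I (\<lambda>_. borel) \<Otimes>\<^sub>M borel)"
      by (cases "j = i") (auto intro!: borel_measurable_add borel_measurable_sum borel_measurable_times
          measurable_compose[OF measurable_fst] measurable_component_singleton)
  qed
  have Xm[measurable]: "?X \<in> P \<rightarrow>\<^sub>M B I" unfolding B_def by measurable
  have YT: "?Y p = T (?X (fst p)) (snd p)" for p
    unfolding T_def by (auto simp: restrict_def fun_eq_iff)
  have spB: "u \<in> space (B I) \<Longrightarrow> T u t \<in> space (B ?J)" for u t I
    by (auto simp: B_def T_def space_PiM)
  fix \<phi> \<psi> \<eta> :: "('i \<Rightarrow> real) \<Rightarrow> ennreal"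
  assume "\<phi> \<in> borel_measurable (PiM ?J (\<lambda>_. borel))" "\<psi> \<in> borel_measurable (PiM ?J (\<lambda>_. borel))"
    "\<eta> \<in> borel_measurable (PiM ?J (\<lambda>_. borel))"
    and le1: "\<forall>u. \<phi> u \<le> 1 \<and> \<psi> u \<le> 1 \<and> \<eta> u \<le> 1"
    and mid: "\<forall>u v w. u \<in> space (PiM ?J (\<lambda>_. borel :: real measure)) \<longrightarrow> v \<in> space (PiM ?J (\<lambda>_. borel :: real measure)) \<longrightarrow>
        w \<in> space (PiM ?J (\<lambda>_. borel :: real measure)) \<longrightarrow>
        (\<forall>i\<in>?J. w i = (u i + v i) / 2) \<longrightarrow> \<phi> u * \<psi> v \<le> (\<eta> w)\<^sup>2"
  then have meas: "\<phi> \<in> borel_measurable (B ?J)" "\<psi> \<in> borel_measurable (B ?J)" "\<eta> \<in> borel_measurable (B ?J)"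
    by (auto simp: B_def)
  define F where "F f u = (\<integral>\<^sup>+t. f (T u t) \<partial>N)" for f :: "('i \<Rightarrow> real) \<Rightarrow> ennreal" and u
  have Tm: "(\<lambda>t. T u t) \<in> borel \<rightarrow>\<^sub>M B ?J" if "u \<in> space (B I)" for u
  proof -
    have "(\<lambda>t. (u, t)) \<in> borel \<rightarrow>\<^sub>M B I \<Otimes>\<^sub>M borel" using that by measurable
    from measurable_compose[OF this T] show ?thesis by simp
  qed
  have Fm: "F f \<in> borel_measurable (B I)" if f[measurable]: "f \<in> borel_measurable (B ?J)" for f
  proof -
    have "(\<lambda>p. f (T (fst p) (snd p))) \<in> borel_measurable (B I \<Otimes>\<^sub>M N)"
      by measurable
    then show ?thesis unfolding F_def by (intro N.borel_measurable_nn_integral) (simp add: case_prod_beta')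
  qed
  have F: "(\<integral>\<^sup>+u. f u \<partial>distr (P \<Otimes>\<^sub>M N) (PiM ?J (\<lambda>_. borel)) ?Y) = (\<integral>\<^sup>+u. F f u \<partial>distr P (PiM I (\<lambda>_. borel)) ?X)"
    if f[measurable]: "f \<in> borel_measurable (B ?J)" for f
  proof -
    have "(\<lambda>p. (?X (fst p), snd p)) \<in> P \<Otimes>\<^sub>M N \<rightarrow>\<^sub>M B I \<Otimes>\<^sub>M borel" by measurable
    from measurable_compose[OF this T]
    have Tp[measurable]: "(\<lambda>p. T (?X (fst p)) (snd p)) \<in> P \<Otimes>\<^sub>M N \<rightarrow>\<^sub>M B ?J" by simp
    have Ym: "?Y \<in> P \<Otimes>\<^sub>M N \<rightarrow>\<^sub>M B ?J" unfolding YT by (rule Tp)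
    have "(\<integral>\<^sup>+u. f u \<partial>distr (P \<Otimes>\<^sub>M N) (B ?J) ?Y) = (\<integral>\<^sup>+p. f (T (?X (fst p)) (snd p)) \<partial>(P \<Otimes>\<^sub>M N))"
      by (subst nn_integral_distr[OF Ym]) (simp_all add: YT)
    also have "\<dots> = (\<integral>\<^sup>+x. \<integral>\<^sup>+t. f (T (?X x) t) \<partial>N \<partial>P)"
      by (subst N.nn_integral_fst[symmetric]) (auto intro!: nn_integral_cong)
    also have "\<dots> = (\<integral>\<^sup>+u. F f u \<partial>distr P (B I) ?X)"
      using Fm[OF f] by (subst nn_integral_distr) (auto simp: F_def)
    finally show ?thesis by (simp add: B_def)
  qed
  have "(\<integral>\<^sup>+u. F \<phi> u \<partial>distr P (PiM I (\<lambda>_. borel)) ?X) * (\<integral>\<^sup>+u. F \<psi> u \<partial>distr P (PiM I (\<lambda>_. borel)) ?X)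
      \<le> (\<integral>\<^sup>+u. F \<eta> u \<partial>distr P (PiM I (\<lambda>_. borel)) ?X)\<^sup>2"
  proof (rule lcX[unfolded log_concave_PiM_def, rule_format])
    have "F f u \<le> 1" if "\<And>u. f u \<le> 1" for f u
    proof -
      have "F f u \<le> (\<integral>\<^sup>+t. 1 \<partial>N)" unfolding F_def by (intro nn_integral_mono that)
      then show ?thesis by (simp add: N.emeasure_space_1)
    qed
    then show "F \<phi> u \<le> 1 \<and> F \<psi> u \<le> 1 \<and> F \<eta> u \<le> 1" for u using le1 by blast
  next
    fix u v w
    assume "u \<in> space (PiM I (\<lambda>_. borel :: real measure))" "v \<in> space (PiM I (\<lambda>_. borel :: real measure))"
      "w \<in> space (PiM I (\<lambda>_. borel :: real measure))" and w: "\<And>i. i \<in> I \<Longrightarrow> w i = (u i + v i) / 2"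
    then have uvw: "u \<in> space (B I)" "v \<in> space (B I)" "w \<in> space (B I)" by (auto simp: B_def)
    note [measurable] = Tm[OF uvw(1)] Tm[OF uvw(2)] Tm[OF uvw(3)] meas
    show "F \<phi> u * F \<psi> v \<le> (F \<eta> w)\<^sup>2"
      unfolding F_def
    proof (rule lcN[unfolded log_concave_real_def, rule_format])
      fix s t :: real
      have sum: "(\<Sum>k\<in>I. a k * w k) = ((\<Sum>k\<in>I. a k * u k) + (\<Sum>k\<in>I. a k * v k)) / 2"
        unfolding sum.distrib[symmetric] sum_divide_distrib
        by (rule sum.cong) (use w in \<open>auto simp: field_simps\<close>)
      show "\<phi> (T u s) * \<psi> (T v t) \<le> (\<eta> (T w ((s + t) / 2)))\<^sup>2"
      proof (rule mid[rule_format])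
        fix j assume "j \<in> ?J"
        then show "T w ((s + t) / 2) j = (T u s j + T v t j) / 2"
          using w by (auto simp: T_def sum field_simps)
      qed (use spB[OF uvw(1)] spB[OF uvw(2)] spB[OF uvw(3)] in \<open>auto simp: B_def\<close>)
    next
      show "\<phi> (T u t) \<le> 1 \<and> \<psi> (T v t) \<le> 1 \<and> \<eta> (T w t) \<le> 1" for t using le1 by blast
    next
      show "(\<lambda>t. \<phi> (T u t)) \<in> borel_measurable borel" "(\<lambda>t. \<psi> (T v t)) \<in> borel_measurable borel"
        "(\<lambda>t. \<eta> (T w t)) \<in> borel_measurable borel"
        by (rule measurable_compose[OF Tm meas(1)] measurable_compose[OF Tm meas(2)]
            measurable_compose[OF Tm meas(3)]; fact uvw)+
    qed
  next
    show "F \<phi> \<in> borel_measurable (PiM I (\<lambda>_. borel))" "F \<psi> \<in> borel_measurable (PiM I (\<lambda>_. borel))"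
      "F \<eta> \<in> borel_measurable (PiM I (\<lambda>_. borel))"
      using Fm meas by (auto simp: B_def)
  qed
  then show "(\<integral>\<^sup>+u. \<phi> u \<partial>distr (P \<Otimes>\<^sub>M N) (PiM ?J (\<lambda>_. borel)) ?Y) * (\<integral>\<^sup>+u. \<psi> u \<partial>distr (P \<Otimes>\<^sub>M N) (PiM ?J (\<lambda>_. borel)) ?Y)
      \<le> (\<integral>\<^sup>+u. \<eta> u \<partial>distr (P \<Otimes>\<^sub>M N) (PiM ?J (\<lambda>_. borel)) ?Y)\<^sup>2"
    using meas by (simp add: F)
qed

section \<open>Functionals of a Gaussian measure: variance, decorrelation, independence\<close>

lemma normal_cos_sin_second_moment:
  fixes \<sigma> :: real
  assumes \<sigma>: "\<sigma> > 0"
  defines "N \<equiv> density lborel (\<lambda>t. ennreal (normal_density 0 \<sigma> t))"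
  shows "integrable N (\<lambda>t. t\<^sup>2)" "(\<integral>t. t\<^sup>2 \<partial>N) = \<sigma>\<^sup>2"
    "(\<integral>t. cos t \<partial>N) = exp (- \<sigma>\<^sup>2 / 2)" "(\<integral>t. sin t \<partial>N) = 0"
proof -
  interpret prob_space N unfolding N_def by (rule prob_space_normal_density[OF \<sigma>])
  have [measurable_cong]: "sets N = sets borel" by (simp add: N_def)
  have hb: "has_bochner_integral lborel (\<lambda>x. normal_density 0 \<sigma> x * x\<^sup>2) (\<sigma>\<^sup>2)"
    using normal_moment_even[OF \<sigma>, of 0 1] by simp
  show "integrable N (\<lambda>t. t\<^sup>2)" unfolding N_def
    by (subst integrable_density) (use hb in \<open>auto simp: has_bochner_integral_iff\<close>)
  show "(\<integral>t. t\<^sup>2 \<partial>N) = \<sigma>\<^sup>2" unfolding N_def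
    by (subst integral_density) (use hb in \<open>auto simp: has_bochner_integral_iff\<close>)
  have "distributed N lborel (\<lambda>x. x) (normal_density 0 \<sigma>)"
    by (auto simp: distributed_def N_def distr_id2)
  then have "distributed N lborel (\<lambda>x. (x - 0) / \<sigma>) std_normal_density"
    by (subst (asm) normal_standard_normal_convert[OF \<sigma>])
  then have d: "distr N lborel (\<lambda>x. x / \<sigma>) = std_normal_distribution"
    by (simp add: distributed_def)
  have "(\<integral>x. iexp x \<partial>N) = (\<integral>x. iexp (\<sigma> * (x / \<sigma>)) \<partial>N)" using \<sigma> by simp
  also have "\<dots> = (\<integral>y. iexp (\<sigma> * y) \<partial>distr N lborel (\<lambda>x. x / \<sigma>))"
    by (subst integral_distr) auto
  also have "\<dots> = char std_normal_distribution \<sigma>" unfolding d char_def ..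
  also have "\<dots> = complex_of_real (exp (- \<sigma>\<^sup>2 / 2))" by (simp add: char_std_normal_distribution)
  finally have c: "(\<integral>x. iexp x \<partial>N) = complex_of_real (exp (- \<sigma>\<^sup>2 / 2))" .
  have int: "integrable N (\<lambda>x. iexp x)" by (rule integrable_iexp) auto
  have "(\<integral>t. cos t \<partial>N) = (\<integral>t. Re (iexp t) \<partial>N)" by (simp add: Re_exp)
  also have "\<dots> = Re (\<integral>x. iexp x \<partial>N)" using int by simp
  finally show "(\<integral>t. cos t \<partial>N) = exp (- \<sigma>\<^sup>2 / 2)" using c by simp
  have "(\<integral>t. sin t \<partial>N) = (\<integral>t. Im (iexp t) \<partial>N)" by (simp add: Im_exp)
  also have "\<dots> = Im (\<integral>x. iexp x \<partial>N)" using int by simp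
  finally show "(\<integral>t. sin t \<partial>N) = 0" using c by simp
qed

locale gaussian_measure =
  fixes M :: "'a::{banach, second_countable_topology} measure"
  assumes gaussian: "centered_gaussian M"
begin

sublocale prob_space M
  using gaussian by (simp add: centered_gaussian_def)

lemma sets_M[measurable_cong]: "sets M = sets borel"
  using gaussian by (simp add: centered_gaussian_def)

lemma space_M: "space M = UNIV"
  using sets_eq_imp_space_eq[OF sets_M] by simp

lemma bounded_linear_measurable: "bounded_linear (f :: 'a \<Rightarrow> real) \<Longrightarrow> f \<in> borel_measurable M"
  using borel_measurable_continuous_onI[OF linear_continuous_on] by (simp add: measurable_cong_sets[OF sets_M refl])

text \<open>With the variance as parameter instead of \<sigma>, the point mass at 0 obeys the same
  formulas as the nondegenerate laws, which frees the computations with transforms from case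
  distinctions.\<close>

lemma functional_cos_sin:
  fixes f :: "'a \<Rightarrow> real"
  assumes f: "bounded_linear f"
  shows "integrable M (\<lambda>x. (f x)\<^sup>2)"
    "(\<integral>x. cos (f x) \<partial>M) = exp (- (\<integral>x. (f x)\<^sup>2 \<partial>M) / 2)" "(\<integral>x. sin (f x) \<partial>M) = 0"
proof -
  have [measurable]: "f \<in> borel_measurable M" by (rule bounded_linear_measurable[OF f])
  let ?D = "distr M borel f"
  have *: "integrable M (\<lambda>x. (f x)\<^sup>2) \<longleftrightarrow> integrable ?D (\<lambda>t. t\<^sup>2)"
    "(\<integral>x. (f x)\<^sup>2 \<partial>M) = (\<integral>t. t\<^sup>2 \<partial>?D)" "(\<integral>x. cos (f x) \<partial>M) = (\<integral>t. cos t \<partial>?D)"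
    "(\<integral>x. sin (f x) \<partial>M) = (\<integral>t. sin t \<partial>?D)"
    by (simp_all add: integrable_distr_eq integral_distr)
  consider "?D = return borel 0" | \<sigma> where "\<sigma> > 0" "?D = density lborel (\<lambda>t. ennreal (normal_density 0 \<sigma> t))"
    using gaussian f by (auto simp: centered_gaussian_def)
  then have "integrable M (\<lambda>x. (f x)\<^sup>2) \<and>
    (\<integral>x. cos (f x) \<partial>M) = exp (- (\<integral>x. (f x)\<^sup>2 \<partial>M) / 2) \<and> (\<integral>x. sin (f x) \<partial>M) = 0"
  proof cases
    case 1
    have "integrable (return borel 0) (\<lambda>t::real. t\<^sup>2)"
      by (rule integrable_cong_AE_imp[of _ "\<lambda>_. 0"]) (auto simp: AE_return)
    then show ?thesis unfolding * unfolding 1 by (simp add: integral_return)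
  next
    case 2
    then show ?thesis unfolding * unfolding 2(2)
      using normal_cos_sin_second_moment[OF 2(1)] by simp
  qed
  then show "integrable M (\<lambda>x. (f x)\<^sup>2)"
    "(\<integral>x. cos (f x) \<partial>M) = exp (- (\<integral>x. (f x)\<^sup>2 \<partial>M) / 2)" "(\<integral>x. sin (f x) \<partial>M) = 0" by auto
qed

text \<open>No means are subtracted because the functionals are centered.\<close>

definition cov :: "('a \<Rightarrow> real) \<Rightarrow> ('a \<Rightarrow> real) \<Rightarrow> real" where
  "cov f g = (\<integral>x. f x * g x \<partial>M)"

lemma integrable_functional_mult:
  assumes f: "bounded_linear f" and g: "bounded_linear g"
  shows "integrable M (\<lambda>x. f x * g x :: real)"
proof (rule Bochner_Integration.integrable_bound)
  show "integrable M (\<lambda>x. (f x)\<^sup>2 + (g x)\<^sup>2)"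
    using functional_cos_sin(1)[OF f] functional_cos_sin(1)[OF g] by simp
  show "(\<lambda>x. f x * g x) \<in> borel_measurable M"
    using bounded_linear_measurable[OF f] bounded_linear_measurable[OF g] by measurable
  have "\<bar>a * b\<bar> \<le> \<bar>a\<^sup>2 + b\<^sup>2\<bar>" for a b :: real
  proof -
    have "2 * (\<bar>a\<bar> * \<bar>b\<bar>) \<le> a\<^sup>2 + b\<^sup>2" using sum_squares_bound[of "\<bar>a\<bar>" "\<bar>b\<bar>"] by simp
    moreover have "0 \<le> \<bar>a\<bar> * \<bar>b\<bar>" by simp
    ultimately show ?thesis unfolding abs_mult by linarith
  qed
  then show "AE x in M. norm (f x * g x) \<le> norm ((f x)\<^sup>2 + (g x)\<^sup>2)" by simp
qed

lemma cov_sym: "cov f g = cov g f"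
  by (simp add: cov_def mult.commute)

lemma cov_add_scale:
  assumes "bounded_linear f" "bounded_linear g" "bounded_linear h"
  shows "cov (\<lambda>x. f x + t * g x) h = cov f h + t * cov g h"
  using integrable_functional_mult[OF assms(1,3)] integrable_functional_mult[OF assms(2,3)]
  by (simp add: cov_def distrib_right mult.assoc)

lemma bounded_linear_add_scale:
  "bounded_linear f \<Longrightarrow> bounded_linear g \<Longrightarrow> bounded_linear (\<lambda>x. f x + t * g x :: real)"
  by (intro bounded_linear_add bounded_linear_mult_right[THEN bounded_linear_compose])

text \<open>If cov g g = 0, then g vanishes almost surely. This settles the case of zero variance in
  Gram-Schmidt orthogonalization.\<close>

lemma cov_degenerate:
  assumes f: "bounded_linear f" and g: "bounded_linear g" and 0: "cov g g = 0"
  shows "cov f g = 0"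
proof -
  have [measurable]: "g \<in> borel_measurable M" "f \<in> borel_measurable M"
    using bounded_linear_measurable f g by auto
  have "AE x in M. g x * g x = 0"
    using 0 integral_nonneg_eq_0_iff_AE[OF integrable_functional_mult[OF g g]] by (simp add: cov_def)
  then have "(\<integral>x. f x * g x \<partial>M) = (\<integral>x. 0 \<partial>M)"
    by (intro integral_cong_AE) (auto elim!: eventually_mono)
  then show ?thesis by (simp add: cov_def)
qed

text \<open>Gram-Schmidt for a possibly dependent family. Both f and X i are decorrelated from the X
  j with j \<in> I, which gives f' and s. Subtracting from f' its projection on s preserves this and
  decorrelates from s, hence also from X i, which is s plus a combination of these X j.\<close>

lemma ex_uncorrelated_residual:
  fixes X :: "'i \<Rightarrow> 'a \<Rightarrow> real"
  assumes "finite I" "\<And>i. i \<in> I \<Longrightarrow> bounded_linear (X i)" "bounded_linear f"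
  shows "\<exists>a. \<forall>i\<in>I. cov (\<lambda>x. f x - (\<Sum>j\<in>I. a j * X j x)) (X i) = 0"
  using assms
proof (induction I arbitrary: f)
  case empty
  then show ?case by simp
next
  case (insert i I)
  have blX: "bounded_linear (X j)" if "j \<in> I" for j using insert.prems that by simp
  have bli: "bounded_linear (X i)" using insert.prems by simp
  have bls: "bounded_linear (\<lambda>x. \<Sum>j\<in>I. a j * X j x)" for a
    by (intro bounded_linear_sum bounded_linear_mult_right[THEN bounded_linear_compose] blX)
  obtain a where a: "\<And>j. j \<in> I \<Longrightarrow> cov (\<lambda>x. f x - (\<Sum>j\<in>I. a j * X j x)) (X j) = 0"
    using insert.IH[of f] insert.prems by auto
  obtain b where b: "\<And>j. j \<in> I \<Longrightarrow> cov (\<lambda>x. X i x - (\<Sum>j\<in>I. b j * X j x)) (X j) = 0"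
    using insert.IH[of "X i"] insert.prems by auto
  define f' where "f' x = f x - (\<Sum>j\<in>I. a j * X j x)" for x
  define s where "s x = X i x - (\<Sum>j\<in>I. b j * X j x)" for x
  have bl: "bounded_linear f'" "bounded_linear s"
    unfolding f'_def s_def using insert.prems bli bls by (auto intro: bounded_linear_sub)
  \<comment> \<open>If cov s s = 0, division by zero makes c = 0, which is the right value because
    cov f' s = 0 in that case.\<close>
  define c where "c = cov f' s / cov s s"
  define g where "g x = f' x + (- c) * s x" for x
  have gbl: "bounded_linear g" unfolding g_def by (rule bounded_linear_add_scale[OF bl])
  have gX: "cov g (X j) = 0" if j: "j \<in> I" for j
  proof -
    have "cov g (X j) = cov f' (X j) + (- c) * cov s (X j)"
      unfolding g_def by (rule cov_add_scale[OF bl blX[OF j]])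
    then show ?thesis using a[OF j, folded f'_def] b[OF j, folded s_def] by simp
  qed
  have gs: "cov g s = 0"
  proof -
    have "cov g s = cov f' s + (- c) * cov s s"
      unfolding g_def by (rule cov_add_scale[OF bl bl(2)])
    then show ?thesis using cov_degenerate[OF bl] by (cases "cov s s = 0") (simp_all add: c_def)
  qed
  have sum0: "cov (\<lambda>x. \<Sum>j\<in>I. b j * X j x) g = 0"
  proof -
    have "cov (\<lambda>x. \<Sum>j\<in>I. b j * X j x) g = (\<Sum>j\<in>I. b j * cov (X j) g)"
      unfolding cov_def sum_distrib_right
      by (subst Bochner_Integration.integral_sum) (auto simp: mult.assoc intro!: integrable_functional_mult blX gbl)
    then show ?thesis using gX by (simp add: cov_sym)
  qed
  have "cov (X i) g = cov (\<lambda>x. s x + 1 * (\<Sum>j\<in>I. b j * X j x)) g"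
    by (simp add: s_def)
  also have "\<dots> = cov s g + 1 * cov (\<lambda>x. \<Sum>j\<in>I. b j * X j x) g"
    by (rule cov_add_scale[OF bl(2) bls gbl])
  also have "\<dots> = 0" using gs sum0 by (simp add: cov_sym)
  finally have gi: "cov g (X i) = 0" by (simp add: cov_sym)
  \<comment> \<open>The coefficients of f - g, read off from g = f' - c * s.\<close>
  define d where "d j = (if j = i then c else a j - c * b j)" for j
  have "(\<Sum>j\<in>insert i I. d j * X j x) = c * X i x + (\<Sum>j\<in>I. (a j - c * b j) * X j x)" for x
    using insert.hyps by (simp add: d_def) (rule sum.cong, auto)
  moreover have "(\<Sum>j\<in>I. (a j - c * b j) * X j x) = (\<Sum>j\<in>I. a j * X j x) - c * (\<Sum>j\<in>I. b j * X j x)" for x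
    by (simp add: sum_subtractf sum_distrib_left left_diff_distrib mult.assoc)
  ultimately have "f x - (\<Sum>j\<in>insert i I. d j * X j x) = g x" for x
    by (simp add: g_def f'_def s_def right_diff_distrib)
  then show ?case using gX gi by (intro exI[of _ d]) auto
qed

text \<open>Uncorrelated functionals look independent to characteristic functions: the variance of h
  + s * g is the sum of the variances of h and s * g, so its exponential factorizes, and so does the
  integral over the product measure, where the terms with sines vanish.\<close>

lemma cos_sin_pair:
  assumes h: "bounded_linear h" and g: "bounded_linear g" and hg: "cov h g = 0"
  defines "Q \<equiv> M \<Otimes>\<^sub>M distr M borel g"
  shows "(\<integral>x. cos (h x + s * g x) \<partial>M) = (\<integral>p. cos (h (fst p) + s * snd p) \<partial>Q)"
    "(\<integral>x. sin (h x + s * g x) \<partial>M) = (\<integral>p. sin (h (fst p) + s * snd p) \<partial>Q)"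
proof -
  have [measurable]: "g \<in> borel_measurable M" "h \<in> borel_measurable M"
    using bounded_linear_measurable g h by auto
  interpret D: prob_space "distr M borel g" by (rule prob_space_distr) simp
  interpret MD: pair_prob_space M "distr M borel g" ..
  have sg: "bounded_linear (\<lambda>x. s * g x)"
    by (intro bounded_linear_mult_right[THEN bounded_linear_compose] g)
  have hsg: "bounded_linear (\<lambda>x. h x + s * g x)" by (rule bounded_linear_add_scale[OF h g])
  have D: "(\<integral>t. cos (s * t) \<partial>distr M borel g) = (\<integral>x. cos (s * g x) \<partial>M)"
     "(\<integral>t. sin (s * t) \<partial>distr M borel g) = 0"
    using functional_cos_sin(3)[OF sg] by (simp_all add: integral_distr)
  have bdd: "integrable Q u" if "u \<in> borel_measurable Q" "\<And>x. \<bar>u x\<bar> \<le> 1" for u :: "_ \<Rightarrow> real"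
    using that unfolding Q_def by (intro MD.P.integrable_const_bound[of _ 1]) auto
  have bdd': "integrable M u" if "u \<in> borel_measurable M" "\<And>x. \<bar>u x\<bar> \<le> 1" for u :: "_ \<Rightarrow> real"
    using that by (intro integrable_const_bound[of _ 1]) auto
  have bddD: "integrable (distr M borel g) u" if "u \<in> borel_measurable borel" "\<And>x. \<bar>u x\<bar> \<le> 1" for u :: "_ \<Rightarrow> real"
    using that by (intro D.integrable_const_bound[of _ 1]) auto
  have Qint: "(\<integral>p. u (h (fst p) + s * snd p) \<partial>Q) = (\<integral>x. \<integral>t. u (h x + s * t) \<partial>distr M borel g \<partial>M)"
    if [measurable]: "u \<in> borel_measurable borel" and "\<And>x. \<bar>u x\<bar> \<le> 1" for u :: "real \<Rightarrow> real"
  proof -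
    have "integrable Q (\<lambda>p. u (h (fst p) + s * snd p))"
      by (rule bdd) (use that in \<open>simp_all add: Q_def\<close>)
    from MD.integral_fst'[OF this[unfolded Q_def]] show ?thesis by (simp add: Q_def)
  qed
  have prod: "(\<integral>p. cos (h (fst p) + s * snd p) \<partial>Q) = (\<integral>x. cos (h x) \<partial>M) * (\<integral>x. cos (s * g x) \<partial>M)"
    "(\<integral>p. sin (h (fst p) + s * snd p) \<partial>Q) = 0"
    using functional_cos_sin(3)[OF h] Qint[of cos] Qint[of sin]
    by (simp_all add: cos_add sin_add bddD bdd' D abs_mult)
  have "cov (\<lambda>x. h x + s * g x) (\<lambda>x. h x + s * g x) = cov h h + s\<^sup>2 * cov g g"
  proof -
    let ?F = "\<lambda>x. h x + s * g x"
    have "cov ?F ?F = cov h ?F + s * cov g ?F" by (rule cov_add_scale[OF h g hsg])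
    also have "cov h ?F = cov ?F h" by (rule cov_sym)
    also have "cov g ?F = cov ?F g" by (rule cov_sym)
    also have "cov ?F h = cov h h + s * cov g h" by (rule cov_add_scale[OF h g h])
    also have "cov ?F g = cov h g + s * cov g g" by (rule cov_add_scale[OF h g g])
    also have "cov g h = 0" using hg cov_sym[of g h] by simp
    finally show ?thesis using hg by (simp add: power2_eq_square)
  qed
  moreover have "cov (\<lambda>x. s * g x) (\<lambda>x. s * g x) = s\<^sup>2 * cov g g"
    by (simp add: cov_def power2_eq_square ac_simps flip: integral_mult_right_zero)
  ultimately have "(\<integral>x. cos (h x + s * g x) \<partial>M) = (\<integral>x. cos (h x) \<partial>M) * (\<integral>x. cos (s * g x) \<partial>M)"
    using functional_cos_sin(2)[OF hsg] functional_cos_sin(2)[OF h] functional_cos_sin(2)[OF sg]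
    by (simp add: cov_def power2_eq_square add_divide_distrib flip: exp_add)
  then show "(\<integral>x. cos (h x + s * g x) \<partial>M) = (\<integral>p. cos (h (fst p) + s * snd p) \<partial>Q)"
    using prod by simp
  show "(\<integral>x. sin (h x + s * g x) \<partial>M) = (\<integral>p. sin (h (fst p) + s * snd p) \<partial>Q)"
    using prod functional_cos_sin(3)[OF hsg] by simp
qed

end

context gaussian_measure begin

text \<open>The residual \<open>g\<close> is uncorrelated with \<open>X j\<close> for \<open>j \<in> I\<close>, so the law of
  \<open>x \<mapsto> (x, g x)\<close> agrees with the product law as far as these functionals can see.\<close>

lemma distr_insert_functional:
  fixes X :: "'i \<Rightarrow> 'a \<Rightarrow> real"
  assumes I: "finite I" and i: "i \<notin> I" and X: "\<And>j. j \<in> insert i I \<Longrightarrow> bounded_linear (X j)"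
    and a: "\<forall>j\<in>I. cov (\<lambda>x. X i x - (\<Sum>k\<in>I. a k * X k x)) (X j) = 0"
  defines "g \<equiv> (\<lambda>x. X i x - (\<Sum>k\<in>I. a k * X k x))"
  shows "distr M (PiM (insert i I) (\<lambda>_. borel)) (\<lambda>x. \<lambda>j\<in>insert i I. X j x) =
    distr (M \<Otimes>\<^sub>M distr M borel g) (PiM (insert i I) (\<lambda>_. borel))
      (\<lambda>p. \<lambda>j\<in>insert i I. if j = i then (\<Sum>k\<in>I. a k * X k (fst p)) + snd p else X j (fst p))"
proof -
  let ?J = "insert i I"
  let ?Y = "\<lambda>j p. if j = i then (\<Sum>k\<in>I. a k * X k (fst p)) + snd p else X j (fst p)"
  have bls: "bounded_linear (\<lambda>x. \<Sum>j\<in>I. a j * X j x)"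
    by (intro bounded_linear_sum bounded_linear_mult_right[THEN bounded_linear_compose] X) auto
  have g: "bounded_linear g" unfolding g_def by (intro bounded_linear_sub bls X) auto
  have [measurable]: "g \<in> borel_measurable M" by (rule bounded_linear_measurable[OF g])
  interpret D: prob_space "distr M borel g" by (rule prob_space_distr) simp
  interpret MD: pair_prob_space M "distr M borel g" ..
  \<comment> \<open>The joint law of x and g x, carried by the graph of g.\<close>
  define P where "P = distr M (M \<Otimes>\<^sub>M distr M borel g) (\<lambda>x. (x, g x))"
  have gm[measurable]: "(\<lambda>x. (x, g x)) \<in> M \<rightarrow>\<^sub>M M \<Otimes>\<^sub>M distr M borel g" by measurable
  interpret P: prob_space P unfolding P_def by (rule prob_space_distr) simp
  \<comment> \<open>Being uncorrelated with g is what \<open>cos_sin_pair\<close> asks of h, and it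
    survives linear combinations. The coordinates \<open>?Y j\<close> belong to this class: s = 1
    with the a-combination as h for j = i, and s = 0 with h = X j for j \<in> I.\<close>
  define V where "V = {\<lambda>p. h (fst p) + s * snd p | h s. bounded_linear h \<and> cov h g = 0}"
  have VI: "(\<lambda>p. h (fst p) + s * snd p) \<in> V" if "bounded_linear h" "cov h g = 0" for h s
    using that by (auto simp: V_def)
  have covX: "cov (X j) g = 0" if "j \<in> I" for j
    using a that by (simp add: g_def cov_sym)
  have Vm: "f \<in> borel_measurable (M \<Otimes>\<^sub>M distr M borel g)" if "f \<in> V" for f
  proof -
    from that obtain h s where hs: "f = (\<lambda>p. h (fst p) + s * snd p)" "bounded_linear h"
      unfolding V_def by auto
    have [measurable]: "h \<in> borel_measurable M" by (rule bounded_linear_measurable[OF hs(2)])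
    show ?thesis unfolding hs(1) by measurable
  qed
  have "distr P (PiM ?J (\<lambda>_. borel)) (\<lambda>p. \<lambda>j\<in>?J. ?Y j p)
      = distr (M \<Otimes>\<^sub>M distr M borel g) (PiM ?J (\<lambda>_. borel)) (\<lambda>p. \<lambda>j\<in>?J. ?Y j p)"
  proof (rule Cramer_Wold_distr[where V = V])
    show "finite ?J" using I by simp
    show "finite_measure P" "finite_measure (M \<Otimes>\<^sub>M distr M borel g)"
      by unfold_locales
    show "sets (M \<Otimes>\<^sub>M distr M borel g) = sets P" by (simp add: P_def)
    show "(\<lambda>_. 0) \<in> V"
      using VI[of "\<lambda>_. 0" 0] by (simp add: bounded_linear_zero cov_def)
  next
    fix f f' t assume "f \<in> V" "f' \<in> V"
    then obtain h s h' s' where *: "f = (\<lambda>p. h (fst p) + s * snd p)" "bounded_linear h" "cov h g = 0"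
      "f' = (\<lambda>p. h' (fst p) + s' * snd p)" "bounded_linear h'" "cov h' g = 0"
      unfolding V_def by auto
    have "bounded_linear (\<lambda>x. h x + t * h' x)" using * by (intro bounded_linear_add_scale)
    moreover have "cov (\<lambda>x. h x + t * h' x) g = 0"
      using cov_add_scale[OF *(2,5) g] * by simp
    ultimately have "(\<lambda>p. (h (fst p) + t * h' (fst p)) + (s + t * s') * snd p) \<in> V"
      by (rule VI)
    then show "(\<lambda>x. f x + t * f' x) \<in> V" by (simp add: * algebra_simps)
  next
    show "f \<in> borel_measurable P" if "f \<in> V" for f using Vm[OF that] by (simp add: P_def)
  next
    fix f assume f: "f \<in> V"
    then obtain h s where *: "f = (\<lambda>p. h (fst p) + s * snd p)" "bounded_linear h" "cov h g = 0"
      unfolding V_def by auto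
    note [measurable] = Vm[OF f]
    have P: "(\<integral>p. u (f p) \<partial>P) = (\<integral>x. u (h x + s * g x) \<partial>M)"
      if [measurable]: "u \<in> borel_measurable borel" for u :: "real \<Rightarrow> real"
      unfolding P_def by (subst integral_distr) (simp_all add: *(1)[symmetric], simp add: *(1))
    show "(\<integral>x. cos (f x) \<partial>P) = (\<integral>x. cos (f x) \<partial>(M \<Otimes>\<^sub>M distr M borel g))"
      "(\<integral>x. sin (f x) \<partial>P) = (\<integral>x. sin (f x) \<partial>(M \<Otimes>\<^sub>M distr M borel g))"
      using P[of cos] P[of sin] cos_sin_pair[OF *(2) g *(3), of s] by (simp_all add: *(1))
  next
    fix j assume j: "j \<in> ?J"
    show "?Y j \<in> V"
    proof (cases "j = i")
      case True
      have "cov (\<lambda>x. \<Sum>k\<in>I. a k * X k x) g = (\<Sum>k\<in>I. a k * cov (X k) g)"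
        unfolding cov_def sum_distrib_right using X g
        by (subst Bochner_Integration.integral_sum)
           (auto simp: mult.assoc intro!: integrable_functional_mult)
      also have "\<dots> = 0" using covX by simp
      finally show ?thesis using VI[OF bls, of 1] True by simp
    next
      case False
      then show ?thesis using VI[OF X[OF j] covX, of 0] j by simp
    qed
  qed
  moreover have "distr P (PiM ?J (\<lambda>_. borel)) (\<lambda>p. \<lambda>j\<in>?J. ?Y j p) = distr M (PiM ?J (\<lambda>_. borel)) (\<lambda>x. \<lambda>j\<in>?J. X j x)"
  proof -
    have Xm: "X j \<in> borel_measurable M" if "j \<in> ?J" for j
      using bounded_linear_measurable[OF X[OF that]] .
    have Ym: "(\<lambda>p. \<lambda>j\<in>?J. ?Y j p) \<in> M \<Otimes>\<^sub>M distr M borel g \<rightarrow>\<^sub>M PiM ?J (\<lambda>_. borel)"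
    proof (rule measurable_restrict)
      fix j assume j: "j \<in> ?J"
      have [measurable]: "X k \<in> borel_measurable M" if "k \<in> I" for k using Xm that by auto
      show "?Y j \<in> borel_measurable (M \<Otimes>\<^sub>M distr M borel g)"
        using j by (cases "j = i") auto
    qed
    \<comment> \<open>On the graph the second component is the residual, so adding back the
      combination recovers X i x.\<close>
    have "(\<lambda>j\<in>?J. ?Y j (x, g x)) = (\<lambda>j\<in>?J. X j x)" for x
      by (auto simp: restrict_def g_def)
    then show ?thesis
      unfolding P_def by (subst distr_distr[OF Ym gm]) (simp add: comp_def)
  qed
  ultimately show ?thesis by simp
qed

lemma log_concave_functional:
  assumes f: "bounded_linear f"
  shows "log_concave_real (distr M borel f)"
  using gaussian f log_concave_return log_concave_normal unfolding centered_gaussian_def by metis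

lemma log_concave_functionals:
  fixes X :: "'i \<Rightarrow> 'a \<Rightarrow> real"
  assumes "finite I" "\<And>j. j \<in> I \<Longrightarrow> bounded_linear (X j)"
  shows "log_concave_PiM I (distr M (PiM I (\<lambda>_. borel)) (\<lambda>x. \<lambda>j\<in>I. X j x))"
  using assms
proof (induction I)
  case empty
  \<comment> \<open>The product over the empty index set has this single point, so integrals are
    values at it.\<close>
  let ?u = "\<lambda>_::'i. undefined :: real"
  have "(\<integral>\<^sup>+u. \<phi> u \<partial>distr M (PiM {} (\<lambda>_. borel)) (\<lambda>x. \<lambda>j\<in>{}. X j x)) = \<phi> ?u"
    if "\<phi> \<in> borel_measurable (PiM {} (\<lambda>_. borel))" for \<phi> :: "('i \<Rightarrow> real) \<Rightarrow> ennreal"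
  proof -
    have "(\<lambda>x. \<lambda>j\<in>{}. X j x) \<in> M \<rightarrow>\<^sub>M PiM {} (\<lambda>_. borel)" by (rule measurable_restrict) simp
    then show ?thesis using that by (subst nn_integral_distr) (auto simp: emeasure_space_1 restrict_def)
  qed
  then show ?case unfolding log_concave_PiM_def by (auto simp: space_PiM)
next
  case (insert i I)
  have X: "bounded_linear (X j)" if "j \<in> insert i I" for j using insert.prems that .
  obtain a where a: "\<forall>j\<in>I. cov (\<lambda>x. X i x - (\<Sum>k\<in>I. a k * X k x)) (X j) = 0"
    using ex_uncorrelated_residual[of I X "X i"] insert.hyps X by auto
  let ?g = "\<lambda>x. X i x - (\<Sum>k\<in>I. a k * X k x)"
  have bls: "bounded_linear (\<lambda>x. \<Sum>j\<in>I. a j * X j x)"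
    by (intro bounded_linear_sum bounded_linear_mult_right[THEN bounded_linear_compose] X) auto
  have g: "bounded_linear ?g" by (intro bounded_linear_sub bls X) auto
  show ?case
  proof (subst distr_insert_functional[OF insert.hyps X a], assumption, rule log_concave_PiM_insert)
    show "prob_space (distr M borel ?g)"
      by (rule prob_space_distr[OF bounded_linear_measurable[OF g]])
    show "log_concave_real (distr M borel ?g)" by (rule log_concave_functional[OF g])
    show "log_concave_PiM I (distr M (PiM I (\<lambda>_. borel)) (\<lambda>x. \<lambda>j\<in>I. X j x))"
      by (rule insert.IH) (use X in auto)
  qed (use insert.hyps X in \<open>auto intro: bounded_linear_measurable prob_space_axioms\<close>)
qed

lemma measure_cylinder_log_concave:
  fixes X :: "'i \<Rightarrow> 'a \<Rightarrow> real"
  assumes I: "finite I" and X: "\<And>j. j \<in> I \<Longrightarrow> bounded_linear (X j)"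
    and sets: "\<And>j. j \<in> I \<Longrightarrow> A j \<in> sets borel" "\<And>j. j \<in> I \<Longrightarrow> B j \<in> sets borel" "\<And>j. j \<in> I \<Longrightarrow> C j \<in> sets borel"
    and mid: "\<And>j s t. j \<in> I \<Longrightarrow> s \<in> A j \<Longrightarrow> t \<in> B j \<Longrightarrow> (s + t) / 2 \<in> C j"
  shows "measure M {x. \<forall>j\<in>I. X j x \<in> A j} * measure M {x. \<forall>j\<in>I. X j x \<in> B j} \<le> (measure M {x. \<forall>j\<in>I. X j x \<in> C j})\<^sup>2"
proof -
  let ?N = "distr M (PiM I (\<lambda>_. borel)) (\<lambda>x. \<lambda>j\<in>I. X j x)"
  have [measurable]: "X j \<in> borel_measurable M" if "j \<in> I" for j using bounded_linear_measurable[OF X[OF that]] .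
  have m: "(\<lambda>x. \<lambda>j\<in>I. X j x) \<in> M \<rightarrow>\<^sub>M PiM I (\<lambda>_. borel)" by measurable
  have P: "Pi\<^sub>E I A \<in> sets (PiM I (\<lambda>_. borel))" if "\<And>j. j \<in> I \<Longrightarrow> A j \<in> sets borel" for A :: "'i \<Rightarrow> real set"
    using that I by (intro sets_PiM_I_finite) auto
  have int: "(\<integral>\<^sup>+u. indicator (Pi\<^sub>E I A) u \<partial>?N) = ennreal (measure M {x. \<forall>j\<in>I. X j x \<in> A j})"
    if "\<And>j. j \<in> I \<Longrightarrow> A j \<in> sets borel" for A
  proof -
    have "(\<lambda>x. \<lambda>j\<in>I. X j x) -` Pi\<^sub>E I A \<inter> space M = {x. \<forall>j\<in>I. X j x \<in> A j}"
      by (auto simp: PiE_iff space_M)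
    then show ?thesis using P[OF that] m by (simp add: emeasure_distr emeasure_eq_measure)
  qed
  have "(\<integral>\<^sup>+u. indicator (Pi\<^sub>E I A) u \<partial>?N) * (\<integral>\<^sup>+u. indicator (Pi\<^sub>E I B) u \<partial>?N) \<le> (\<integral>\<^sup>+u. indicator (Pi\<^sub>E I C) u \<partial>?N)\<^sup>2"
  proof (rule log_concave_functionals[OF I X, unfolded log_concave_PiM_def, rule_format])
    show "indicator (Pi\<^sub>E I A) u \<le> (1::ennreal) \<and> indicator (Pi\<^sub>E I B) u \<le> (1::ennreal) \<and> indicator (Pi\<^sub>E I C) u \<le> (1::ennreal)" for u
      by (auto simp: indicator_def)
  next
    fix u v w assume "w \<in> space (PiM I (\<lambda>_. borel :: real measure))" and w: "\<And>i. i \<in> I \<Longrightarrow> w i = (u i + v i) / 2"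
    then have "w \<in> Pi\<^sub>E I C" if "u \<in> Pi\<^sub>E I A" "v \<in> Pi\<^sub>E I B"
      using that mid by (auto simp: space_PiM PiE_iff w)
    then show "indicator (Pi\<^sub>E I A) u * indicator (Pi\<^sub>E I B) v \<le> (indicator (Pi\<^sub>E I C) w :: ennreal)\<^sup>2"
      by (auto simp: indicator_def)
  next
    show "indicator (Pi\<^sub>E I A) \<in> borel_measurable (PiM I (\<lambda>_. borel))" "indicator (Pi\<^sub>E I B) \<in> borel_measurable (PiM I (\<lambda>_. borel))"
      "indicator (Pi\<^sub>E I C) \<in> borel_measurable (PiM I (\<lambda>_. borel))"
      using P sets by (auto intro!: borel_measurable_indicator)
  qed auto
  then have "ennreal (measure M {x. \<forall>j\<in>I. X j x \<in> A j} * measure M {x. \<forall>j\<in>I. X j x \<in> B j})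
      \<le> ennreal ((measure M {x. \<forall>j\<in>I. X j x \<in> C j})\<^sup>2)"
    using sets by (simp add: int ennreal_mult ennreal_power)
  then show ?thesis by simp
qed

end

text \<open>Functionals that norm the points of a countable dense set suffice: if d n is within e/2
  of x, then f n x differs from norm (d n) by at most e/2, so norm x <= f n x + e.\<close>

lemma ex_norming_sequence:
  "\<exists>f :: nat \<Rightarrow> 'a::{real_normed_vector, second_countable_topology} \<Rightarrow> real.
    (\<forall>n. bounded_linear (f n)) \<and> (\<forall>x s. norm x \<le> s \<longleftrightarrow> (\<forall>n. \<bar>f n x\<bar> \<le> s))"
proof -
  obtain D :: "'a set" where D: "countable D" "\<And>X. open X \<Longrightarrow> X \<noteq> {} \<Longrightarrow> \<exists>d\<in>D. d \<in> X"
    using countable_dense_setE by blast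
  have ne: "D \<noteq> {}" using D(2)[of UNIV] by auto
  define d where "d = from_nat_into D"
  have "\<exists>f. bounded_linear f \<and> (\<forall>x. \<bar>f x\<bar> \<le> norm x) \<and> f (d n) = norm (d n)" for n
    by (rule ex_norming_functional)
  then obtain f where f: "\<And>n. bounded_linear (f n)" "\<And>n x. \<bar>f n x\<bar> \<le> norm x" "\<And>n. f n (d n) = norm (d n)"
    by metis
  have "norm x \<le> s" if le: "\<And>n. \<bar>f n x\<bar> \<le> s" for x s
  proof (rule field_le_epsilon)
    fix e :: real assume e: "e > 0"
    obtain n where n: "d n \<in> ball x (e/2)"
      using D(2)[of "ball x (e/2)"] e ne D(1) unfolding d_def by (metis ball_eq_empty from_nat_into_surj half_gt_zero not_le open_ball)
    interpret f: bounded_linear "f n" by (rule f)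
    have "norm (x - d n) \<le> e/2" using n by (simp add: dist_norm)
    moreover have "\<bar>f n x - norm (d n)\<bar> \<le> norm (x - d n)" using f(2)[of n "x - d n"] f(3)[of n] by (simp add: f.diff)
    moreover have "norm x \<le> norm (d n) + norm (x - d n)" by (metis add.commute diff_add_cancel norm_triangle_ineq)
    ultimately show "norm x \<le> s + e" using le[of n] by linarith
  qed
  then show ?thesis using f(1,2) order_trans by blast
qed

context gaussian_measure begin

text \<open>One sequence f serves all centres and radii, so that an inequality between cylinders
  with the same n passes to the limit for several balls at once.\<close>

lemma ex_cylinders_tendsto_cball:
  obtains f :: "nat \<Rightarrow> 'a \<Rightarrow> real" where "\<And>n. bounded_linear (f n)"
    "\<And>z s. (\<lambda>n. measure M {x. \<forall>j\<in>{..<n}. f j x \<in> {f j z - s..f j z + s}}) \<longlonglongrightarrow> measure M (cball z s)"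
proof -
  obtain f :: "nat \<Rightarrow> 'a \<Rightarrow> real" where f: "\<And>n. bounded_linear (f n)" "\<And>x s. norm x \<le> s \<longleftrightarrow> (\<forall>n. \<bar>f n x\<bar> \<le> s)"
    using ex_norming_sequence by blast
  have lim: "(\<lambda>n. measure M {x. \<forall>j\<in>{..<n}. f j x \<in> {f j z - s..f j z + s}}) \<longlonglongrightarrow> measure M (cball z s)" for z s
  proof -
    define A where "A n = {x. \<forall>j\<in>{..<n}. f j x \<in> {f j z - s..f j z + s}}" for n
    have fd: "f n (x - z) = f n x - f n z" for n x
      by (rule linear_diff[OF bounded_linear.linear[OF f(1)]])
    have "x \<in> cball z s \<longleftrightarrow> (\<forall>n. \<bar>f n x - f n z\<bar> \<le> s)" for x
      using f(2)[of "x - z" s] by (simp add: fd dist_norm norm_minus_commute)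
    moreover have "f j x \<in> {f j z - s..f j z + s} \<longleftrightarrow> \<bar>f j x - f j z\<bar> \<le> s" for j x
      by (auto simp: abs_le_iff)
    ultimately have "x \<in> cball z s \<longleftrightarrow> (\<forall>n. x \<in> A n)" for x
      unfolding A_def by (simp only: mem_Collect_eq lessThan_iff) (blast intro: lessI)
    then have eq: "cball z s = (\<Inter>n. A n)" by auto
    have [measurable]: "f j \<in> borel_measurable M" for j by (rule bounded_linear_measurable[OF f(1)])
    have "A n \<in> sets M" for n
    proof -
      have "A n = {x \<in> space M. \<forall>j\<in>{..<n}. f j x \<in> {f j z - s..f j z + s}}"
        by (simp add: A_def space_M)
      also have "\<dots> \<in> sets M" by measurable
      finally show ?thesis .
    qed
    moreover have "decseq A" by (auto simp: decseq_def A_def)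
    ultimately show ?thesis unfolding eq A_def[symmetric] by (intro finite_Lim_measure_decseq) auto
  qed
  show thesis by (rule that[OF f(1) lim])
qed

text \<open>For each functional, the midpoint of points from the intervals around f j z and f j w
  lies in the interval around the mean with the mean radius. Radii may be negative, with empty
  balls; this occurs in \<open>measure_cball_eq_ball\<close> for small n.\<close>

lemma measure_cball_log_concave:
  "measure M (cball z s) * measure M (cball w t) \<le> (measure M (cball ((1/2) *\<^sub>R (z + w)) ((s + t) / 2)))\<^sup>2"
proof -
  obtain f where f: "\<And>n. bounded_linear (f n)"
    and lim: "\<And>z s. (\<lambda>n. measure M {x. \<forall>j\<in>{..<n}. f j x \<in> {f j z - s..f j z + s}}) \<longlonglongrightarrow> measure M (cball z s)"
    using ex_cylinders_tendsto_cball by blast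
  define A where "A z s n = {x. \<forall>j\<in>{..<n}. f j x \<in> {f j z - s..f j z + s}}" for z s n
  have fm: "f n ((1/2) *\<^sub>R (x + y)) = (f n x + f n y) / 2" for n x y
  proof -
    interpret f: bounded_linear "f n" by (rule f)
    show ?thesis by (simp add: f.scaleR f.add)
  qed
  have "measure M (A z s n) * measure M (A w t n) \<le> (measure M (A ((1/2) *\<^sub>R (z + w)) ((s + t) / 2) n))\<^sup>2" for n
    unfolding A_def
  proof (rule measure_cylinder_log_concave)
    fix j and p q :: real
    assume "p \<in> {f j z - s..f j z + s}" "q \<in> {f j w - t..f j w + t}"
    then have "f j z + f j w - (s + t) \<le> p + q" "p + q \<le> f j z + f j w + (s + t)" by auto
    from divide_right_mono[OF this(1), of 2] divide_right_mono[OF this(2), of 2]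
    show "(p + q) / 2 \<in> {f j ((1/2) *\<^sub>R (z + w)) - (s + t) / 2..f j ((1/2) *\<^sub>R (z + w)) + (s + t) / 2}"
      unfolding fm by (simp only: atLeastAtMost_iff diff_divide_distrib add_divide_distrib)
  qed (use f in auto)
  moreover have "(\<lambda>n. measure M (A z s n) * measure M (A w t n)) \<longlonglongrightarrow> measure M (cball z s) * measure M (cball w t)"
    unfolding A_def by (intro tendsto_mult lim)
  moreover have "(\<lambda>n. (measure M (A ((1/2) *\<^sub>R (z + w)) ((s + t) / 2) n))\<^sup>2) \<longlonglongrightarrow> (measure M (cball ((1/2) *\<^sub>R (z + w)) ((s + t) / 2)))\<^sup>2"
    unfolding A_def by (intro tendsto_power lim)
  ultimately show ?thesis by (intro LIMSEQ_le) auto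
qed

text \<open>The sine transforms vanish and the cosine is even, so M and its image under negation
  have the same transforms on all bounded linear functionals.\<close>

lemma measure_cylinder_uminus:
  fixes X :: "'i \<Rightarrow> 'a \<Rightarrow> real"
  assumes I: "finite I" and X: "\<And>j. j \<in> I \<Longrightarrow> bounded_linear (X j)" and A: "\<And>j. j \<in> I \<Longrightarrow> A j \<in> sets borel"
  shows "measure M {x. \<forall>j\<in>I. X j x \<in> A j} = measure M {x. \<forall>j\<in>I. - X j x \<in> A j}"
proof -
  let ?V = "{f :: 'a \<Rightarrow> real. bounded_linear f}"
  let ?Q = "distr M borel uminus"
  have um[measurable]: "uminus \<in> M \<rightarrow>\<^sub>M (borel :: 'a measure)" by (simp add: measurable_cong_sets[OF sets_M refl])
  interpret Q: prob_space ?Q by (rule prob_space_distr) measurable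
  have Xm[measurable]: "f \<in> borel_measurable borel" if "bounded_linear f" for f :: "'a \<Rightarrow> real"
    using bounded_linear_measurable[OF that] by (simp add: measurable_cong_sets[OF sets_M refl])
  have Xu: "f (- x) = - f x" if "bounded_linear f" for f :: "'a \<Rightarrow> real" and x
    by (rule linear_neg[OF bounded_linear.linear[OF that]])
  have "measure M {x\<in>space M. \<forall>j\<in>I. X j x \<in> A j} = measure ?Q {x\<in>space ?Q. \<forall>j\<in>I. X j x \<in> A j}"
  proof (rule Cramer_Wold_measure[where V = ?V])
    show "finite_measure M" "finite_measure ?Q" by unfold_locales
    show "sets ?Q = sets M" by (simp add: sets_M)
    show "(\<lambda>_. 0) \<in> ?V" by (simp add: bounded_linear_zero)
    show "(\<lambda>x. f x + t * g x) \<in> ?V" if "f \<in> ?V" "g \<in> ?V" for f g t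
      using that bounded_linear_add_scale by simp
    show "f \<in> borel_measurable M" if "f \<in> ?V" for f using that bounded_linear_measurable by simp
    show "(\<integral>x. cos (f x) \<partial>M) = (\<integral>x. cos (f x) \<partial>?Q)" "(\<integral>x. sin (f x) \<partial>M) = (\<integral>x. sin (f x) \<partial>?Q)" if "f \<in> ?V" for f
      using that functional_cos_sin(3)[of f] by (simp_all add: integral_distr Xu)
  qed (use I X A in auto)
  also have "\<dots> = measure M {x. \<forall>j\<in>I. - X j x \<in> A j}"
  proof -
    have "{x. \<forall>j\<in>I. X j x \<in> A j} = {x\<in>space borel. \<forall>j\<in>I. X j x \<in> A j}" by simp
    also have "\<dots> \<in> sets borel"
    proof (rule sets.sets_Collect_finite_All[OF _ I])
      fix j assume j: "j \<in> I"
      have [measurable]: "X j \<in> borel_measurable borel" "A j \<in> sets borel" using Xm[OF X[OF j]] A[OF j] by auto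
      show "{x \<in> space borel. X j x \<in> A j} \<in> sets borel" by measurable
    qed
    finally show ?thesis
      by (simp add: measure_distr space_M vimage_def) (rule arg_cong[where f = "measure M"], auto simp: Xu X)
  qed
  finally show ?thesis by (simp add: space_M)
qed

lemma measure_cball_uminus: "measure M (cball (- z) s) = measure M (cball z s)"
proof -
  obtain f where f: "\<And>n. bounded_linear (f n)"
    and lim: "\<And>z s. (\<lambda>n. measure M {x. \<forall>j\<in>{..<n}. f j x \<in> {f j z - s..f j z + s}}) \<longlonglongrightarrow> measure M (cball z s)"
    using ex_cylinders_tendsto_cball by blast
  have fu: "f n (- x) = - f n x" for n x
    by (rule linear_neg[OF bounded_linear.linear[OF f]])
  have "measure M {x. \<forall>j\<in>{..<n}. f j x \<in> {f j (- z) - s..f j (- z) + s}} = measure M {x. \<forall>j\<in>{..<n}. f j x \<in> {f j z - s..f j z + s}}" for n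
    by (subst measure_cylinder_uminus) (auto simp: f fu algebra_simps intro!: arg_cong[where f = "measure M"])
  then show ?thesis using LIMSEQ_unique[OF lim lim] by (metis (no_types, lifting) LIMSEQ_unique lim ext)
qed

text \<open>The balls at z and - z have equal measure by symmetry, and the midpoint of their centres
  is 0.\<close>

lemma measure_cball_le_centered: "measure M (cball z s) \<le> measure M (cball 0 s)"
proof -
  have "(measure M (cball z s))\<^sup>2 \<le> (measure M (cball 0 s))\<^sup>2"
    using measure_cball_log_concave[of z s "- z" s] by (simp add: power2_eq_square measure_cball_uminus)
  then show ?thesis by (rule power2_le_imp_le) simp
qed

text \<open>A jump of \<open>s \<mapsto> measure M (cball 0 s)\<close> is incompatible with log-concavity applied to
  the radii \<open>s - 2 h\<close> and \<open>s\<close>, whose mean \<open>s - h\<close> still lies below the jump.\<close>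

lemma measure_cball_eq_ball:
  assumes pos: "measure M (ball 0 s) > 0"
  shows "measure M (cball 0 s) = measure M (ball 0 s)"
proof -
  \<comment> \<open>The values c = 2 and c = 1 are used: s - 1 / (n + 1) is the mean of s - 2 / (n +
    1) and s.\<close>
  have UN: "(\<Union>n. cball (0::'a) (s - c / real (Suc n))) = ball 0 s" if c: "c > 0" for c :: real
  proof safe
    fix x :: 'a and n assume "x \<in> cball 0 (s - c / real (Suc n))"
    moreover have "c / real (Suc n) > 0" using c by simp
    ultimately show "x \<in> ball (0::'a) s" by (simp only: mem_cball_0 mem_ball_0)
  next
    fix x :: 'a assume "x \<in> ball 0 s"
    then have "(s - norm x) / c > 0" using c by simp
    then obtain n where "inverse (real (Suc n)) < (s - norm x) / c" using reals_Archimedean by blast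
    then have "c / real (Suc n) < s - norm x" using c by (simp add: field_simps)
    then show "x \<in> (\<Union>n. cball 0 (s - c / real (Suc n)))" by (auto intro!: exI[of _ n])
  qed
  have lim: "(\<lambda>n. measure M (cball 0 (s - c / real (Suc n)))) \<longlonglongrightarrow> measure M (ball 0 s)" if c: "c > 0" for c :: real
  proof (subst UN[OF c, symmetric], rule finite_Lim_measure_incseq)
    show "incseq (\<lambda>n. cball (0::'a) (s - c / real (Suc n)))"
    proof (rule incseq_SucI)
      fix n
      have "c / real (Suc (Suc n)) \<le> c / real (Suc n)" using c by (intro divide_left_mono) auto
      then show "cball (0::'a) (s - c / real (Suc n)) \<subseteq> cball 0 (s - c / real (Suc (Suc n)))"
        by (intro subset_cball) simp
    qed
  qed (auto simp: sets_M)
  have "measure M (cball 0 (s - 2 / real (Suc n))) * measure M (cball 0 s) \<le> (measure M (cball 0 (s - 1 / real (Suc n))))\<^sup>2" for n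
  proof -
    have "(s - 2 / real (Suc n) + s) / 2 = s - 1 / real (Suc n)"
      by (simp add: field_simps)
    then show ?thesis using measure_cball_log_concave[of 0 "s - 2 / real (Suc n)" 0 s]
      by (simp only: add_0 scaleR_zero_right)
  qed
  \<comment> \<open>In the limit the balls of both smaller radii become the open ball, and one
    factor of its positive measure cancels.\<close>
  then have "measure M (ball 0 s) * measure M (cball 0 s) \<le> (measure M (ball 0 s))\<^sup>2"
    by (intro LIMSEQ_le[OF tendsto_mult[OF lim[of 2] tendsto_const] tendsto_power[OF lim[of 1], of 2]]) auto
  then have "measure M (cball 0 s) \<le> measure M (ball 0 s)"
    using pos by (simp add: power2_eq_square)
  moreover have "measure M (ball 0 s) \<le> measure M (cball 0 s)"
    by (rule finite_measure_mono) (auto simp: sets_M)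
  ultimately show ?thesis by simp
qed

end

section \<open>Regular variation\<close>

text \<open>\<open>b\<close> stands for the small ball function and \<open>S\<close> for its
  inverse, controlled from \<open>y\<^sub>0\<close> on. Of regular variation, \<open>rv\<close>
  retains that shrinking the argument by a fixed factor l multiplies b by at least some K >
  1.\<close>

locale inverse_regularly_varying =
  fixes b S :: "real \<Rightarrow> real" and y\<^sub>0 :: real
  assumes anti: "\<And>s t. 0 < s \<Longrightarrow> s < t \<Longrightarrow> b t < b s"
    and rv: "\<And>l. 0 < l \<Longrightarrow> l < 1 \<Longrightarrow> \<exists>K>1. \<forall>\<^sub>F s in at_right 0. b (l * s) \<ge> K * b s"
    and S: "\<And>y. y \<ge> y\<^sub>0 \<Longrightarrow> S y > 0 \<and> b (S y) = y"
begin

lemma S_le: "y \<ge> y\<^sub>0 \<Longrightarrow> s > 0 \<Longrightarrow> b s \<le> y \<Longrightarrow> S y \<le> s"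
  using anti[of s "S y"] S[of y] by force

text \<open>S tends to 0: once u >= b (\<open>s\<^sub>1\<close> / 2), S u is at most
  \<open>s\<^sub>1\<close> / 2. The quantifier over all u >= y gives the uniformity needed to
  compare a cell with all smaller ones.\<close>

lemma eventually_S_at_right_0:
  assumes "eventually P (at_right 0)"
  shows "\<forall>\<^sub>F y in at_top. \<forall>u\<ge>y. P (S u)"
proof -
  obtain s\<^sub>1 where s1: "s\<^sub>1 > 0" "\<And>s. 0 < s \<Longrightarrow> s < s\<^sub>1 \<Longrightarrow> P s"
    using assms by (auto simp: eventually_at_right_field)
  have "P (S u)" if "y \<ge> max y\<^sub>0 (b (s\<^sub>1 / 2))" "u \<ge> y" for y u
    using S_le[of u "s\<^sub>1 / 2"] S[of u] that s1 by auto
  then show ?thesis unfolding eventually_at_top_linorder by blast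
qed

lemma Potter_iterate:
  assumes "s > 0" and K: "K > 1" and l: "0 < l" "l < 1"
    and le: "\<And>t. 0 < t \<Longrightarrow> t \<le> s \<Longrightarrow> K * b t \<le> b (l * t)"
  shows "K ^ k * b s \<le> b (l ^ k * s)"
proof (induction k)
  case (Suc k)
  have "l ^ k * s \<le> 1 * s" using assms by (intro mult_right_mono power_le_one) auto
  then have "K * b (l ^ k * s) \<le> b (l * (l ^ k * s))" using assms by (intro le) auto
  moreover have "K * (K ^ k * b s) \<le> K * b (l ^ k * s)" using Suc K by (intro mult_left_mono) auto
  ultimately show ?case by (simp add: ac_simps)
qed simp

text \<open>A drop of S has to be paid for by growth of the argument. While S u >= l * S y with l
  powr r = 1 - e, only the factor 1 - e is lost. Otherwise S u lies just above l ^ n * S y for some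
  n >= 2, a loss of at most exp (- r * n * L); but then u >= K ^ (n - 1) * y, and for large y the
  exponential makes up for it.\<close>

lemma Potter_exp:
  assumes r: "r > 0" and p: "p > 0" and e: "0 < e" "e < 1"
  shows "\<forall>\<^sub>F y in at_top. \<forall>u\<ge>y. (1 - e) * (S y powr r * exp (p * y)) \<le> S u powr r * exp (p * u)"
proof -
  define l where "l = (1 - e) powr (1 / r)"
  have l: "0 < l" "l < 1"
    using e r powr_less_mono2[of "1/r" "1 - e" 1] by (auto simp: l_def)
  have lr: "l powr r = 1 - e" using e r by (simp add: l_def powr_powr)
  obtain K where K: "K > 1" "\<forall>\<^sub>F s in at_right 0. b (l * s) \<ge> K * b s" using rv[OF l] by blast
  then obtain s\<^sub>1 where s1: "s\<^sub>1 > 0" "\<And>s. 0 < s \<Longrightarrow> s < s\<^sub>1 \<Longrightarrow> K * b s \<le> b (l * s)"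
    by (auto simp: eventually_at_right_field)
  define L where "L = ln (1 / l)"
  have L: "L > 0" using l by (simp add: L_def)
  have expL: "exp (- t * L) = l powr t" for t
    using l by (simp add: L_def powr_def ln_div)
  \<comment> \<open>The threshold gives p * (K - 1) * y >= 2 * r * L, so that k = n - 1 factors K
    gain at least 2 * k * r * L in the exponent by Bernoulli's inequality; the 2 is there because n
    = k + 1 <= 2 * k.\<close>
  have ev: "\<forall>\<^sub>F y in at_top. y \<ge> 2 * r * L / (p * (K - 1)) \<and> y \<ge> y\<^sub>0 \<and> (\<forall>u\<ge>y. S u < s\<^sub>1)"
    using s1 by (intro eventually_conj eventually_ge_at_top eventually_S_at_right_0)
      (auto simp: eventually_at_right_field)
  then show ?thesis
  proof (eventually_elim, intro allI impI)
    fix y u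
    assume y: "y \<ge> 2 * r * L / (p * (K - 1)) \<and> y \<ge> y\<^sub>0 \<and> (\<forall>u\<ge>y. S u < s\<^sub>1)" and u: "u \<ge> y"
    have Sy: "S y > 0" "b (S y) = y" "S y < s\<^sub>1" using y S by auto
    have Su: "S u > 0" "b (S u) = u" using y u S[of u] by auto
    have pyu: "exp (p * y) \<le> exp (p * u)" using u p by simp
    show "(1 - e) * (S y powr r * exp (p * y)) \<le> S u powr r * exp (p * u)"
    proof (cases "S u \<ge> l * S y")
      case True
      then have "(l * S y) powr r \<le> S u powr r" using Sy l r by (intro powr_mono2) auto
      then have "(1 - e) * S y powr r \<le> S u powr r" using lr Sy l by (simp add: powr_mult)
      then have "((1 - e) * S y powr r) * exp (p * y) \<le> S u powr r * exp (p * u)"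
        using pyu by (intro mult_mono) auto
      then show ?thesis by simp
    next
      case False
      have "(\<lambda>n. l ^ n * S y) \<longlonglongrightarrow> 0 * S y" using l by (intro tendsto_mult tendsto_const LIMSEQ_power_zero) auto
      then have "\<forall>\<^sub>F n in sequentially. l ^ n * S y < S u" using Su by (intro order_tendstoD) auto
      then have ex: "\<exists>n. l ^ n * S y < S u" by (auto simp: eventually_sequentially)
      \<comment> \<open>Minimality of n gives S u <= l ^ k * S y for k = n - 1. The values n = 0 and
        n = 1 are excluded by S u <= S y and S u < l * S y, so k >= 1.\<close>
      define n where "n = (LEAST n. l ^ n * S y < S u)"
      have n: "l ^ n * S y < S u" unfolding n_def using ex by (rule LeastI_ex)
      have n': "m < n \<Longrightarrow> S u \<le> l ^ m * S y" for m
        unfolding n_def by (meson not_less not_less_Least)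
      have "S u \<le> S y" using S_le[of u "S y"] Sy y u by auto
      then have "\<not> S y < S u" "\<not> l * S y < S u" using False by auto
      then have "n \<noteq> 0" "n \<noteq> 1" using n by (metis power_0 mult_1, metis power_one_right)
      then obtain k where k: "n = Suc k" "k \<ge> 1" by (cases n) auto
      have "u \<ge> b (l ^ k * S y)"
      proof (cases "S u = l ^ k * S y")
        case False
        then have "S u < l ^ k * S y" using n'[of k] k by simp
        then show ?thesis using anti[of "S u" "l ^ k * S y"] Su by simp
      qed (use Su in simp)
      moreover have "K ^ k * y \<le> b (l ^ k * S y)"
        using Potter_iterate[OF Sy(1) K(1) l, of k] Sy s1 by auto
      moreover have "K ^ k \<ge> 1 + real k * (K - 1)"
        using Bernoulli_inequality[of "K - 1" k] K by simp
      moreover have y0: "y \<ge> 0"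

      proof -
        have "0 \<le> 2 * r * L / (p * (K - 1))" using L r p K by simp
        then show ?thesis using y by linarith
      qed
      ultimately have "u \<ge> (1 + real k * (K - 1)) * y"
        using mult_right_mono[of "1 + real k * (K - 1)" "K ^ k" y] by linarith
      then have "p * (u - y) \<ge> p * (real k * (K - 1) * y)"
        using p by (intro mult_left_mono) (auto simp: algebra_simps)
      moreover have "p * (real k * (K - 1) * y) \<ge> real k * (2 * r * L)"
      proof -
        have "2 * r * L \<le> (p * (K - 1)) * y" using y p K by (simp add: pos_divide_le_eq mult.commute)
        then have "real k * (2 * r * L) \<le> real k * ((p * (K - 1)) * y)" by (rule mult_left_mono) simp
        then show ?thesis by (simp add: ac_simps)
      qed
      moreover have "real k * (2 * r * L) \<ge> (r * real n) * L"
      proof -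
        have "real n \<le> 2 * real k" using k by simp
        then have "real n * (r * L) \<le> (2 * real k) * (r * L)" using r L by (intro mult_right_mono) auto
        then show ?thesis by (simp add: ac_simps)
      qed
      ultimately have "(r * real n) * L \<le> p * (u - y)" by linarith
      then have "exp (p * y) * exp ((r * real n) * L) \<le> exp (p * u)"
        by (simp add: exp_add[symmetric] algebra_simps)
      moreover have "S u powr r \<ge> exp (- (r * real n) * L) * S y powr r"
      proof -
        have "(l ^ n * S y) powr r \<le> S u powr r" using n Sy l r by (intro powr_mono2) auto
        moreover have "(l ^ n * S y) powr r = l powr (r * real n) * S y powr r"
          using l Sy by (simp add: powr_mult powr_powr powr_realpow[symmetric] mult.commute)
        ultimately show ?thesis unfolding expL by simp
      qed
      ultimately have "(exp (- (r * real n) * L) * S y powr r) * (exp (p * y) * exp ((r * real n) * L)) \<le> S u powr r * exp (p * u)"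
        by (intro mult_mono) auto
      moreover have "(exp (- (r * real n) * L) * S y powr r) * (exp (p * y) * exp ((r * real n) * L)) = S y powr r * exp (p * y)"
        by (simp add: exp_minus field_simps)
      moreover have "(1 - e) * (S y powr r * exp (p * y)) \<le> 1 * (S y powr r * exp (p * y))"
        using e by (intro mult_right_mono) auto
      ultimately show ?thesis by linarith
    qed
  qed
qed

text \<open>For the small ball function, exp (- b (l * S u)) is the mass of the ball with radius
  shrunk by l. Since b (l * S u) >= K * u with K > 1, it is at most exp (- (K - 1) * u) times exp (-
  u), and the first factor falls below e.\<close>

lemma scaled_radius_exponent:
  assumes l: "0 < l" "l < 1" and e: "0 < e"
  shows "\<forall>\<^sub>F y in at_top. \<forall>u\<ge>y. exp (- b (l * S u)) \<le> e * exp (- u)"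
proof -
  obtain K where K: "K > 1" "\<forall>\<^sub>F s in at_right 0. b (l * s) \<ge> K * b s" using rv[OF l] by blast
  have "\<forall>\<^sub>F y in at_top. y \<ge> y\<^sub>0 \<and> y \<ge> - ln e / (K - 1) \<and> (\<forall>u\<ge>y. b (l * S u) \<ge> K * b (S u))"
    by (intro eventually_conj eventually_ge_at_top eventually_S_at_right_0 K(2))
  then show ?thesis
  proof (eventually_elim, intro allI impI)
    fix y u assume y: "y \<ge> y\<^sub>0 \<and> y \<ge> - ln e / (K - 1) \<and> (\<forall>u\<ge>y. b (l * S u) \<ge> K * b (S u))" and u: "u \<ge> y"
    then have "b (l * S u) \<ge> K * u" using S[of u] by auto
    moreover have "- ln e \<le> (K - 1) * u"
    proof -
      have "- ln e / (K - 1) \<le> u" using y u by linarith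
      then show ?thesis using pos_divide_le_eq[of "K - 1" "- ln e" u] K(1) by (simp only: diff_gt_0_iff_gt mult.commute)
    qed
    ultimately have "- b (l * S u) \<le> ln e - u" by (simp add: algebra_simps)
    then have "exp (- b (l * S u)) \<le> exp (ln e - u)" by simp
    also have "\<dots> = e * exp (- u)" using e by (simp add: exp_diff exp_minus field_simps)
    finally show "exp (- b (l * S u)) \<le> e * exp (- u)" .
  qed
qed

end

section \<open>Consequences of the asymptotics at 0\<close>

lemma filterlim_ln_inverse_at_right_0: "filterlim (\<lambda>s::real. ln (1 / s)) at_top (at_right 0)"
  by (rule filterlim_compose[OF ln_at_top])
     (simp add: filterlim_inverse_at_top_right flip: inverse_eq_divide)

text \<open>The logarithmic factor varies slowly: ln (1 / (l * s)) / ln (1 / s) tends to 1, and so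
  does its power d. Hence the ratio tends to (1 / l) powr a > 1, and K is taken halfway between 1
  and this limit.\<close>

lemma regularly_varying_ratio:
  fixes b :: "real \<Rightarrow> real"
  assumes c: "c > 0" and a: "a > 0" and l: "0 < l" "l < 1"
    and b: "b \<sim>[at_right 0] (\<lambda>s. c * (1 / s) powr a * ln (1 / s) powr d)"
    and pos: "\<forall>\<^sub>F s in at_right 0. b s > 0"
  shows "\<exists>K>1. \<forall>\<^sub>F s in at_right 0. b (l * s) \<ge> K * b s"
proof -
  let ?G = "\<lambda>s. c * (1 / s) powr a * ln (1 / s) powr d"
  have lim: "filterlim (\<lambda>s. l * s) (at_right 0) (at_right 0)"
    using filterlim_times_pos[OF filterlim_ident l(1), of 0 0] by simp
  have "(\<lambda>s. b (l * s)) \<sim>[at_right 0] (\<lambda>s. ?G (l * s))"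
    using asymp_equiv_compose'[OF b lim] .
  then have "(\<lambda>s. b (l * s) / b s) \<sim>[at_right 0] (\<lambda>s. ?G (l * s) / ?G s)"
    by (intro asymp_equiv_intros b)
  moreover have "((\<lambda>s. ?G (l * s) / ?G s) \<longlongrightarrow> (1 / l) powr a) (at_right 0)"
  proof (rule Lim_transform_eventually)
    have "((\<lambda>s. (ln (1 / l) / ln (1 / s) + 1) powr d) \<longlongrightarrow> (0 + 1) powr d) (at_right 0)"
      by (intro tendsto_powr tendsto_add tendsto_const real_tendsto_divide_at_top[OF tendsto_const] filterlim_ln_inverse_at_right_0) auto
    from tendsto_mult[OF tendsto_const this, of "(1 / l) powr a"]
    show "((\<lambda>s. (1 / l) powr a * (ln (1 / l) / ln (1 / s) + 1) powr d) \<longlongrightarrow> (1 / l) powr a) (at_right 0)"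
      by simp
    have "\<forall>\<^sub>F s in at_right (0::real). 0 < s \<and> s < 1"
      unfolding eventually_at_right_field by (intro exI[of _ 1]) auto
    then show "\<forall>\<^sub>F s in at_right 0. (1 / l) powr a * (ln (1 / l) / ln (1 / s) + 1) powr d = ?G (l * s) / ?G s"
    proof eventually_elim
      case (elim s)
      have L: "ln (1 / s) > 0" "ln (1 / l) > 0" using elim l by auto
      have "ln (1 / (l * s)) = ln (1 / l) + ln (1 / s)"
        using elim l by (simp add: ln_div ln_mult)
      also have "\<dots> = (ln (1 / l) / ln (1 / s) + 1) * ln (1 / s)" using L by (simp add: field_simps)
      finally have "ln (1 / (l * s)) powr d = (ln (1 / l) / ln (1 / s) + 1) powr d * ln (1 / s) powr d"
        using L by (simp add: powr_mult)
      moreover have "(1 / (l * s)) powr a = (1 / l) powr a * (1 / s) powr a"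
        using elim l by (simp flip: powr_mult)
      moreover have "ln (1 / s) powr d > 0" "(1 / s) powr a > 0" using L elim by auto
      ultimately show ?case using c by simp
    qed
  qed
  ultimately have lim: "((\<lambda>s. b (l * s) / b s) \<longlongrightarrow> (1 / l) powr a) (at_right 0)"
    using tendsto_asymp_equiv_cong by blast
  define K where "K = (1 + (1 / l) powr a) / 2"
  have "1 < (1 / l) powr a" using l a by (simp add: gr_one_powr)
  then have K: "1 < K" "K < (1 / l) powr a" by (auto simp: K_def)
  have "\<forall>\<^sub>F s in at_right 0. K < b (l * s) / b s" using lim K(2) by (rule order_tendstoD)
  with pos have "\<forall>\<^sub>F s in at_right 0. b (l * s) \<ge> K * b s"
    by eventually_elim (simp add: field_simps)
  with K show ?thesis by blast
qed

text \<open>With x = ln (1 / s) the model function is c * exp (a * x + d * ln x). Since ln x / x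
  tends to 0, the term a * x dominates even for negative d.\<close>

lemma asymp_equiv_at_top_at_right_0:
  fixes b :: "real \<Rightarrow> real"
  assumes c: "c > 0" and a: "a > 0"
    and b: "b \<sim>[at_right 0] (\<lambda>s. c * (1 / s) powr a * ln (1 / s) powr d)"
  shows "filterlim b at_top (at_right 0)"
proof -
  have "filterlim (\<lambda>s. c * (1 / s) powr a * ln (1 / s) powr d) at_top (at_right 0)"
  proof (rule filterlim_mono_eventually)
    let ?x = "\<lambda>s::real. ln (1 / s)"
    have "((\<lambda>s. a + d * (ln (?x s) / ?x s)) \<longlongrightarrow> a + d * 0) (at_right 0)"
      by (intro tendsto_intros filterlim_compose[OF ln_x_over_x_tendsto_0] filterlim_ln_inverse_at_right_0)
    then have "filterlim (\<lambda>s. (a + d * (ln (?x s) / ?x s)) * ?x s) at_top (at_right 0)"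
      using a by (intro filterlim_tendsto_pos_mult_at_top[OF _ _ filterlim_ln_inverse_at_right_0]) auto
    then show "filterlim (\<lambda>s. c * exp ((a + d * (ln (?x s) / ?x s)) * ?x s)) at_top (at_right 0)"
      using c by (intro filterlim_tendsto_pos_mult_at_top[OF tendsto_const] filterlim_compose[OF exp_at_top])
    have "\<forall>\<^sub>F s in at_right (0::real). 0 < s \<and> s < 1"
      unfolding eventually_at_right_field by (intro exI[of _ 1]) auto
    then show "\<forall>\<^sub>F s in at_right 0. c * exp ((a + d * (ln (?x s) / ?x s)) * ?x s) = c * (1 / s) powr a * ?x s powr d"
    proof eventually_elim
      case (elim s)
      then have L: "ln (1 / s) > 0" by simp
      have "(a + d * (ln (?x s) / ?x s)) * ?x s = a * ?x s + d * ln (?x s)"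
        using L by (simp add: distrib_right)
      then show ?case using L elim by (simp add: powr_def exp_add)
    qed
  qed auto
  then show ?thesis using asymp_equiv_at_top_transfer[OF asymp_equiv_symI[OF b]] by blast
qed

lemma asymp_equivI_lower_upper:
  fixes f g :: "real \<Rightarrow> real"
  assumes up: "\<forall>\<^sub>F x in F. f x \<le> g x" and pos: "\<forall>\<^sub>F x in F. g x > 0"
    and low: "\<And>e. 0 < e \<Longrightarrow> e < 1 \<Longrightarrow> \<forall>\<^sub>F x in F. (1 - e) * g x \<le> f x"
  shows "f \<sim>[F] g"
proof (rule asymp_equivI')
  show "((\<lambda>x. f x / g x) \<longlongrightarrow> 1) F"
  proof (rule order_tendstoI)
    fix a :: real assume a: "a < 1"
    \<comment> \<open>Halving 1 - a keeps 1 - e strictly above a; the cap 1/2 keeps e below 1 when a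
      <= -1.\<close>
    define e where "e = min (1/2) ((1 - a) / 2)"
    have e: "0 < e" "e < 1" "a < 1 - e" using a by (auto simp: e_def min_def field_simps)
    show "\<forall>\<^sub>F x in F. a < f x / g x"
      using low[OF e(1,2)] pos
    proof eventually_elim
      case (elim x)
      then have "1 - e \<le> f x / g x" by (simp add: field_simps)
      then show ?case using e by simp
    qed
  next
    fix a :: real assume a: "a > 1"
    show "\<forall>\<^sub>F x in F. f x / g x < a"
      using up pos
    proof eventually_elim
      case (elim x)
      then have "f x / g x \<le> 1" by simp
      then show ?case using a by simp
    qed
  qed
qed

section \<open>Quantization of Gaussian measures\<close>

locale full_gaussian_measure = gaussian_measure M
  for M :: "'a::{banach, second_countable_topology} measure" +
  assumes full: "topological_support M = UNIV"
    and nontrivial: "\<exists>x::'a. x \<noteq> 0"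
begin

section \<open>The small ball function\<close>

lemma measure_open_pos:
  assumes "open U" "U \<noteq> {}"
  shows "measure M U > 0"
proof -
  obtain x where x: "x \<in> U" using assms by auto
  have "x \<in> topological_support M" by (simp add: full)
  then have "0 < emeasure M U" using x assms unfolding topological_support_def by blast
  then show ?thesis by (simp add: emeasure_eq_measure)
qed

lemma measure_ball_pos: "s > 0 \<Longrightarrow> measure M (ball 0 s) > 0"
  by (rule measure_open_pos) auto

lemma measure_cball_pos: "s > 0 \<Longrightarrow> measure M (cball 0 s) > 0"
  using measure_cball_eq_ball measure_ball_pos by simp

lemma exp_small_ball: "s > 0 \<Longrightarrow> exp (- small_ball M s) = measure M (cball 0 s)"
  using measure_cball_pos by (simp add: small_ball_def)

text \<open>The open shell between the radii contains a vector of norm (s + t) / 2, obtained by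
  scaling any nonzero vector, and full support gives it positive measure.\<close>

lemma measure_cball_strict_mono:
  assumes s: "0 < s" "s < t"
  shows "measure M (cball 0 s) < measure M (cball 0 t)"
proof -
  let ?U = "ball 0 t - cball (0::'a) s"
  obtain x :: 'a where "x \<noteq> 0" using nontrivial by blast
  then have "((s + t) / 2 / norm x) *\<^sub>R x \<in> ?U" using s by auto
  then have "?U \<noteq> {}" by blast
  then have "measure M ?U > 0" by (intro measure_open_pos open_Diff) auto
  moreover have "measure M (cball 0 s \<union> ?U) = measure M (cball 0 s) + measure M ?U"
    by (rule finite_measure_Union) (auto simp: sets_M)
  moreover have "measure M (cball 0 s \<union> ?U) \<le> measure M (cball 0 t)"
    using s by (intro finite_measure_mono) (auto simp: sets_M)
  ultimately show ?thesis by linarith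
qed

lemma small_ball_strict_antimono: "0 < s \<Longrightarrow> s < t \<Longrightarrow> small_ball M t < small_ball M s"
  using measure_cball_strict_mono[of s t] measure_cball_pos[of s] by (simp add: small_ball_def)

text \<open>The measure of centered balls is the distribution function of the norm. Its jump at s is
  the measure of the sphere, which is 0 because closed and open balls have equal measure.\<close>

lemma isCont_small_ball:
  assumes s: "s > 0"
  shows "isCont (small_ball M) s"
proof -
  have [measurable]: "norm \<in> borel_measurable M" by (simp add: measurable_cong_sets[OF sets_M refl])
  interpret D: real_distribution "distr M borel norm" by (rule real_distribution_distr) simp
  have cdf: "cdf (distr M borel norm) = (\<lambda>s. measure M (cball 0 s))"
    by (auto simp: cdf_def measure_distr space_M vimage_def intro!: arg_cong[where f = "measure M"])
  have "measure (distr M borel norm) {s} = measure M (cball 0 s - ball 0 s)"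
    by (subst measure_distr) (auto simp: space_M intro!: arg_cong[where f = "measure M"])
  also have "\<dots> = measure M (cball 0 s) - measure M (ball 0 s)"
    by (rule finite_measure_Diff) (auto simp: sets_M)
  also have "\<dots> = 0" using measure_cball_eq_ball[OF measure_ball_pos[OF s]] by simp
  finally have "isCont (\<lambda>s. measure M (cball 0 s)) s"
    using D.isCont_cdf cdf by metis
  then show ?thesis unfolding small_ball_def[abs_def]
    using measure_cball_pos[OF s] by (intro continuous_intros) auto
qed

text \<open>\<open>inv_into\<close> is meaningful only on the image. The intermediate value theorem
  on [s, 1] puts y there: y >= small_ball M 1 at the right end, and divergence at 0 provides a left
  end s with small_ball M s >= y.\<close>

lemma small_ball_inv:
  assumes lim: "filterlim (small_ball M) at_top (at_right 0)" and y: "y \<ge> small_ball M 1"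
  shows "small_ball_inv M y > 0 \<and> small_ball M (small_ball_inv M y) = y"
proof -
  have "\<forall>\<^sub>F s in at_right 0. y \<le> small_ball M s" using lim by (simp add: filterlim_at_top)
  then obtain e where e: "e > 0" "\<And>s. 0 < s \<Longrightarrow> s < e \<Longrightarrow> y \<le> small_ball M s"
    by (auto simp: eventually_at_right_field)
  define s where "s = min 1 (e / 2)"
  have s: "0 < s" "s \<le> 1" "y \<le> small_ball M s" using e by (auto simp: s_def min_def)
  have "\<exists>t\<ge>s. t \<le> 1 \<and> small_ball M t = y"
    by (rule IVT2) (use s y isCont_small_ball in auto)
  then have "y \<in> small_ball M ` {0<..}" using s by (auto intro: less_le_trans)
  then show ?thesis unfolding small_ball_inv_def
    using inv_into_into[of y "small_ball M" "{0<..}"] f_inv_into_f[of y "small_ball M" "{0<..}"] by auto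
qed

section \<open>Cells: distortion and entropy\<close>

lemma quantizer_cell: "f \<in> quantizers \<Longrightarrow> f -` {z} \<in> sets M"
  using measurable_sets[of f borel borel "{z}"] by (auto simp: quantizers_def sets_M)

text \<open>Points of A farther than t from z cost at least t powr r each, and the others have at
  most the mass of the centered ball, wherever z is.\<close>

lemma cell_distortion_ge:
  assumes A: "A \<in> sets M" and t: "t \<ge> 0" and r: "r > 0"
  shows "ennreal (t powr r * (measure M A - measure M (cball 0 t)))
    \<le> (\<integral>\<^sup>+x. indicator A x * ennreal (norm (x - z) powr r) \<partial>M)"
proof -
  have B: "cball z t \<in> sets M" by (auto simp: sets_M)
  have "measure M A \<le> measure M ((A - cball z t) \<union> cball z t)"
    using A B by (intro finite_measure_mono) auto
  also have "\<dots> \<le> measure M (A - cball z t) + measure M (cball z t)"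
    using A B by (intro measure_Un_le) auto
  also have "\<dots> \<le> measure M (A - cball z t) + measure M (cball 0 t)"
    using measure_cball_le_centered by simp
  finally have "ennreal (t powr r * (measure M A - measure M (cball 0 t))) \<le> ennreal (t powr r * measure M (A - cball z t))"
    by (intro ennreal_leI mult_left_mono) auto
  also have "\<dots> = (\<integral>\<^sup>+x. ennreal (t powr r) * indicator (A - cball z t) x \<partial>M)"
    using A B by (simp add: nn_integral_cmult_indicator emeasure_eq_measure ennreal_mult)
  also have "\<dots> \<le> (\<integral>\<^sup>+x. indicator A x * ennreal (norm (x - z) powr r) \<partial>M)"
  proof (rule nn_integral_mono)
    fix x show "ennreal (t powr r) * indicator (A - cball z t) x \<le> indicator A x * ennreal (norm (x - z) powr r)"
      using t r by (auto simp: indicator_def dist_norm norm_minus_commute intro!: ennreal_leI powr_mono2)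
  qed
  finally show ?thesis .
qed

lemma sum_cells_le_distortion:
  assumes f: "f \<in> quantizers" and F: "finite F"
  shows "(\<Sum>z\<in>F. \<integral>\<^sup>+x. indicator (f -` {z}) x * ennreal (norm (x - z) powr r) \<partial>M) \<le> distortion M r f"
proof -
  have [measurable]: "f -` {z} \<in> sets M" for z by (rule quantizer_cell[OF f])
  have "(\<Sum>z\<in>F. \<integral>\<^sup>+x. indicator (f -` {z}) x * ennreal (norm (x - z) powr r) \<partial>M)
      = (\<integral>\<^sup>+x. (\<Sum>z\<in>F. indicator (f -` {z}) x * ennreal (norm (x - z) powr r)) \<partial>M)"
    by (rule nn_integral_sum[symmetric]) measurable
  also have "\<dots> \<le> distortion M r f"
    unfolding distortion_def
  proof (rule nn_integral_mono)
    fix x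
    have "(\<Sum>z\<in>F. indicator (f -` {z}) x * ennreal (norm (x - z) powr r))
       = (\<Sum>z\<in>F. if f x = z then ennreal (norm (x - f x) powr r) else 0)"
      by (rule sum.cong) (auto simp: indicator_def)
    also have "\<dots> \<le> ennreal (norm (x - f x) powr r)" using F by (simp add: sum.delta)
    finally show "(\<Sum>z\<in>F. indicator (f -` {z}) x * ennreal (norm (x - z) powr r)) \<le> ennreal (norm (x - f x) powr r)" .
  qed
  finally show ?thesis .
qed

lemma ex_cell_pos:
  assumes f: "f \<in> quantizers"
  shows "\<exists>z\<in>range f. measure M (f -` {z}) > 0"
proof (rule ccontr)
  assume "\<not> ?thesis"
  then have 0: "measure M (f -` {z}) = 0" if "z \<in> range f" for z
    using that by (metis zero_less_measure_iff)
  have "(\<Union>z\<in>range f. f -` {z}) \<in> null_sets M"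
  proof (rule null_sets_UN')
    show "countable (range f)" using f by (simp add: quantizers_def)
    show "f -` {z} \<in> null_sets M" if "z \<in> range f" for z
      using 0[OF that] quantizer_cell[OF f] by (auto simp: emeasure_eq_measure)
  qed
  moreover have "(\<Union>z\<in>range f. f -` {z}) = space M" by (auto simp: space_M)
  ultimately show False using emeasure_space_1 by auto
qed

lemma summable_cells_powr:
  assumes f: "f \<in> quantizers" and \<alpha>: "\<alpha> > 1"
  shows "(\<lambda>z. measure M (f -` {z}) powr \<alpha>) summable_on A"
proof (rule nonneg_bdd_above_summable_on)
  show "bdd_above (sum (\<lambda>z. measure M (f -` {z}) powr \<alpha>) ` {F. F \<subseteq> A \<and> finite F})"
  proof (rule bdd_aboveI2)
    fix F assume F: "F \<in> {F. F \<subseteq> A \<and> finite F}"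
    have "(\<Sum>z\<in>F. measure M (f -` {z}) powr \<alpha>) \<le> (\<Sum>z\<in>F. measure M (f -` {z}))"
    proof (rule sum_mono)
      fix z
      have "measure M (f -` {z}) powr \<alpha> \<le> measure M (f -` {z}) powr 1"
        using \<alpha> by (intro powr_mono') auto
      then show "measure M (f -` {z}) powr \<alpha> \<le> measure M (f -` {z})" by simp
    qed
    also have "\<dots> = measure M (\<Union>z\<in>F. f -` {z})"
      using F quantizer_cell[OF f]
      by (intro finite_measure_finite_Union[symmetric]) (auto simp: disjoint_family_on_def)
    also have "\<dots> \<le> 1" by simp
    finally show "(\<Sum>z\<in>F. measure M (f -` {z}) powr \<alpha>) \<le> 1" .
  qed
qed simp

lemma sum_cells_powr_pos:
  assumes f: "f \<in> quantizers" and \<alpha>: "\<alpha> > 1"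
  shows "(\<Sum>\<^sub>\<infinity>z\<in>range f. measure M (f -` {z}) powr \<alpha>) > 0"
proof -
  obtain z where z: "z \<in> range f" "measure M (f -` {z}) > 0" using ex_cell_pos[OF f] by blast
  have "(\<Sum>z\<in>{z}. measure M (f -` {z}) powr \<alpha>) \<le> (\<Sum>\<^sub>\<infinity>z\<in>range f. measure M (f -` {z}) powr \<alpha>)"
    by (rule finite_sum_le_infsum) (use z summable_cells_powr[OF f \<alpha>] in auto)
  then have "measure M (f -` {z}) powr \<alpha> \<le> (\<Sum>\<^sub>\<infinity>z\<in>range f. measure M (f -` {z}) powr \<alpha>)" by simp
  moreover have "measure M (f -` {z}) powr \<alpha> > 0" using z by simp
  ultimately show ?thesis by linarith
qed

lemma renyi_entropy_le_iff:
  assumes f: "f \<in> quantizers" and \<alpha>: "\<alpha> > 1"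
  shows "renyi_entropy M (ereal \<alpha>) f \<le> \<alpha> / (\<alpha> - 1) * y \<longleftrightarrow>
    exp (- \<alpha> * y) \<le> (\<Sum>\<^sub>\<infinity>z\<in>range f. measure M (f -` {z}) powr \<alpha>)"
proof -
  let ?s = "\<Sum>\<^sub>\<infinity>z\<in>range f. measure M (f -` {z}) powr \<alpha>"
  have "renyi_entropy M (ereal \<alpha>) f = - ln ?s / (\<alpha> - 1)"
    using \<alpha> by (simp add: renyi_entropy_def field_simps)
  also have "- ln ?s / (\<alpha> - 1) \<le> \<alpha> / (\<alpha> - 1) * y \<longleftrightarrow> - \<alpha> * y \<le> ln ?s"
    unfolding times_divide_eq_left divide_le_cancel using \<alpha> by auto
  also have "\<dots> \<longleftrightarrow> exp (- \<alpha> * y) \<le> ?s"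
    using sum_cells_powr_pos[OF f \<alpha>] by (simp add: ln_ge_iff)
  finally show ?thesis .
qed

text \<open>The supremum of the cell probabilities is at most the \<alpha>-th root of the sum of
  their \<alpha>-th powers. So the admissible quantizers for \<infinity> are among those for
  \<alpha>, and an upper bound for \<infinity> together with a lower bound for \<alpha> settles both
  problems.\<close>

lemma renyi_entropy_le_of_infinity:
  assumes f: "f \<in> quantizers" and \<alpha>: "\<alpha> > 1" and y: "renyi_entropy M \<infinity> f \<le> y"
  shows "renyi_entropy M (ereal \<alpha>) f \<le> \<alpha> / (\<alpha> - 1) * y"
proof -
  let ?q = "\<lambda>z. measure M (f -` {z})"
  let ?s = "\<Sum>\<^sub>\<infinity>z\<in>range f. ?q z powr \<alpha>"
  have s: "?s > 0" by (rule sum_cells_powr_pos[OF f \<alpha>])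
  obtain z where z: "z \<in> range f" "?q z > 0" using ex_cell_pos[OF f] by blast
  have bdd: "bdd_above (?q ` range f)" by (rule bdd_aboveI2[of _ _ 1]) simp
  have "?q z \<le> (SUP z\<in>range f. ?q z)" by (rule cSUP_upper[OF z(1) bdd])
  with z have sup: "(SUP z\<in>range f. ?q z) > 0" by linarith
  have "(SUP z\<in>range f. ?q z) \<le> ?s powr (1 / \<alpha>)"
  proof (rule cSUP_least)
    fix z assume z: "z \<in> range f"
    have "(\<Sum>z\<in>{z}. ?q z powr \<alpha>) \<le> ?s"
      by (rule finite_sum_le_infsum) (use z summable_cells_powr[OF f \<alpha>] in auto)
    then have "(?q z powr \<alpha>) powr (1 / \<alpha>) \<le> ?s powr (1 / \<alpha>)"
      using \<alpha> by (intro powr_mono2) auto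
    then show "?q z \<le> ?s powr (1 / \<alpha>)" using \<alpha> by (simp add: powr_powr)
  qed auto
  then have "ln (SUP z\<in>range f. ?q z) \<le> ln (?s powr (1 / \<alpha>))"
    by (rule iffD2[OF ln_le_cancel_iff, rotated 2]) (use sup less_imp_neq[OF s] in auto)
  moreover have "- y \<le> ln (SUP z\<in>range f. ?q z)" using y by (simp add: renyi_entropy_def)
  ultimately have "- y \<le> ln ?s / \<alpha>" using s by (simp add: ln_powr)
  then have "- \<alpha> * y \<le> ln ?s" using \<alpha> by (simp add: field_simps)
  then show ?thesis using s \<alpha> by (subst renyi_entropy_le_iff[OF f \<alpha>]) (simp add: ln_ge_iff)
qed

text \<open>Outside the ball f takes the first sufficiently close member of a dense sequence, which
  keeps it measurable with countable range. The number of cells is irrelevant, since the entropy is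
  bounded through the single large cell.\<close>

lemma ex_ball_quantizer:
  assumes s: "s > 0" and r: "r > 0" and d: "d > 0"
  shows "\<exists>f\<in>quantizers. renyi_entropy M \<infinity> f \<le> small_ball M s \<and>
    distortion M r f \<le> ennreal (s powr r * exp (- small_ball M s)) + ennreal d"
proof -
  \<comment> \<open>Chosen so that an error below e costs at most d.\<close>
  define e where "e = d powr (1 / r)"
  have e: "e > 0" "e powr r = d" using d r by (auto simp: e_def powr_powr)
  obtain D :: "'a set" where D: "countable D" "\<And>X. open X \<Longrightarrow> X \<noteq> {} \<Longrightarrow> \<exists>d\<in>D. d \<in> X"
    using countable_dense_setE by blast
  have ne: "D \<noteq> {}" using D(2)[of UNIV] by auto
  define x where "x = from_nat_into D"
  have ex: "\<exists>n. norm (y - x n) < e" for y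
  proof -
    obtain d where "d \<in> D" "d \<in> ball y e" using D(2)[of "ball y e"] e by auto
    moreover obtain n where "x n = d" using from_nat_into_surj[OF D(1) \<open>d \<in> D\<close>] by (auto simp: x_def)
    ultimately show ?thesis by (auto simp: dist_norm)
  qed
  define N where "N y = (LEAST n. norm (y - x n) < e)" for y
  have N: "norm (y - x (N y)) < e" for y unfolding N_def using ex by (rule LeastI_ex)
  define f where "f y = (if norm y \<le> s then 0 else x (N y))" for y
  have [measurable]: "N \<in> borel \<rightarrow>\<^sub>M count_space UNIV" unfolding N_def[abs_def] by measurable
  have "(\<lambda>y. x (N y)) \<in> borel \<rightarrow>\<^sub>M borel"
    by (rule measurable_compose[where N = "count_space UNIV"]) auto
  then have fm: "f \<in> borel \<rightarrow>\<^sub>M borel" unfolding f_def[abs_def] by measurable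
  have "range f \<subseteq> insert 0 (range x)" by (auto simp: f_def)
  then have "countable (range f)" by (rule countable_subset) simp
  then have fq: "f \<in> quantizers" using fm by (simp add: quantizers_def)
  \<comment> \<open>Only an inequality, since 0 may also occur in the dense sequence and then the
    cell of 0 can exceed the ball.\<close>
  have "measure M (cball 0 s) \<le> measure M (f -` {0})"
    using quantizer_cell[OF fq] by (intro finite_measure_mono) (auto simp: f_def)
  also have "\<dots> \<le> (SUP z\<in>range f. measure M (f -` {z}))"
  proof (rule cSUP_upper)
    have "f 0 = 0" using s by (simp add: f_def)
    then show "0 \<in> range f" by (metis rangeI)
    show "bdd_above ((\<lambda>z. measure M (f -` {z})) ` range f)" by (rule bdd_aboveI2[of _ _ 1]) simp
  qed
  finally have "renyi_entropy M \<infinity> f \<le> small_ball M s"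
    using measure_cball_pos[OF s] by (simp add: renyi_entropy_def small_ball_def)
  moreover have "distortion M r f \<le> ennreal (s powr r * exp (- small_ball M s)) + ennreal d"
  proof -
    have "distortion M r f \<le> (\<integral>\<^sup>+y. ennreal (s powr r) * indicator (cball 0 s) y + ennreal d \<partial>M)"
      unfolding distortion_def
    proof (rule nn_integral_mono)
      fix y
      show "ennreal (norm (y - f y) powr r) \<le> ennreal (s powr r) * indicator (cball 0 s) y + ennreal d"
      proof (cases "norm y \<le> s")
        case True
        then have "ennreal (norm (y - f y) powr r) \<le> ennreal (s powr r)"
          using r by (intro ennreal_leI powr_mono2) (auto simp: f_def)
        also have "ennreal (s powr r) \<le> ennreal (s powr r) + ennreal d"
          using add_left_mono[of 0 "ennreal d" "ennreal (s powr r)"] by simp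
        finally show ?thesis using True by simp
      next
        case False
        have "norm (y - x (N y)) powr r \<le> e powr r" using N[of y] r by (intro powr_mono2) auto
        then show ?thesis using False e by (simp add: f_def ennreal_leI)
      qed
    qed
    also have "\<dots> = ennreal (s powr r) * emeasure M (cball 0 s) + ennreal d"
      proof -
      have "cball 0 s \<in> sets M" by (simp add: sets_M)
      then have "(\<integral>\<^sup>+y. ennreal (s powr r) * indicator (cball 0 s) y \<partial>M) = ennreal (s powr r) * emeasure M (cball 0 s)"
        by (rule nn_integral_cmult_indicator)
      moreover have "(\<integral>\<^sup>+y. ennreal (s powr r) * indicator (cball 0 s) y + ennreal d \<partial>M)
          = (\<integral>\<^sup>+y. ennreal (s powr r) * indicator (cball 0 s) y \<partial>M) + (\<integral>\<^sup>+y. ennreal d \<partial>M)"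
        using \<open>cball 0 s \<in> sets M\<close>
        by (intro nn_integral_add borel_measurable_times_ennreal borel_measurable_const borel_measurable_indicator)
      ultimately show ?thesis by (simp only: nn_integral_const emeasure_space_1 mult_1_right)
    qed
    also have "ennreal (s powr r) * emeasure M (cball 0 s) = ennreal (s powr r * exp (- small_ball M s))"
      using s by (simp add: exp_small_ball emeasure_eq_measure ennreal_mult)
    finally show ?thesis .
  qed
  ultimately show ?thesis using fq by blast
qed

end

context full_gaussian_measure begin

text \<open>If some cell has probability at least \<open>exp (- y)\<close>, that cell alone has the required
  distortion. Otherwise every cell has probability \<open>exp (- u)\<close> with \<open>u > y\<close>, and
  \<open>Potter_exp\<close> says that the distortion a cell costs per unit of \<open>probability powr \<alpha>\<close> is
  then at least the one of a single ball of probability \<open>exp (- y)\<close>.\<close>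

lemma distortion_ge:
  assumes irv: "inverse_regularly_varying (small_ball M) (small_ball_inv M) y\<^sub>0"
    and r: "r > 0" and \<alpha>: "\<alpha> > 1" and e: "0 < e" "e < 1"
  shows "\<forall>\<^sub>F y in at_top. \<forall>f\<in>quantizers. renyi_entropy M (ereal \<alpha>) f \<le> \<alpha> / (\<alpha> - 1) * y \<longrightarrow>
    ennreal ((1 - e) ^ 3 * (small_ball_inv M y powr r * exp (- y))) \<le> distortion M r f"
proof -
  interpret irv: inverse_regularly_varying "small_ball M" "small_ball_inv M" y\<^sub>0 by (rule irv)
  let ?S = "small_ball_inv M"
  define G where "G u = ?S u powr r * exp (- u)" for u
  \<comment> \<open>Shrinking a radius by l costs the factor l powr r = 1 - e. In (1 - e) ^ 3 this
    is one factor; another is the mass lost to the shrunk ball in \<open>cell\<close>, and the last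
    comes from \<open>Potter_exp\<close>.\<close>
  define l where "l = (1 - e) powr (1 / r)"
  have l: "0 < l" "l < 1" "l powr r = 1 - e"
    using e r powr_less_mono2[of "1/r" "1 - e" 1] by (auto simp: l_def powr_powr)
  have "\<alpha> - 1 > 0" using \<alpha> by simp
  \<comment> \<open>\<open>Potter_exp\<close> is used with p = \<alpha> - 1, because G u / exp (-
    \<alpha> * u) = ?S u powr r * exp ((\<alpha> - 1) * u).\<close>
  note ev = irv.Potter_exp[OF r this e] irv.scaled_radius_exponent[OF l(1,2) e(1)] eventually_ge_at_top[of y\<^sub>0]
  from ev show ?thesis
  proof (eventually_elim, intro ballI impI)
    fix y f
    assume P: "\<forall>u\<ge>y. (1 - e) * (?S y powr r * exp ((\<alpha> - 1) * y)) \<le> ?S u powr r * exp ((\<alpha> - 1) * u)"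
      and R: "\<forall>u\<ge>y. exp (- small_ball M (l * ?S u)) \<le> e * exp (- u)"
      and y: "y\<^sub>0 \<le> y" and f: "f \<in> quantizers"
      and H: "renyi_entropy M (ereal \<alpha>) f \<le> \<alpha> / (\<alpha> - 1) * y"
    let ?q = "\<lambda>z. measure M (f -` {z})"
    let ?D = "\<lambda>z. \<integral>\<^sup>+x. indicator (f -` {z}) x * ennreal (norm (x - z) powr r) \<partial>M"
    have cell: "ennreal ((1 - e) ^ 2 * G u) \<le> ?D z" if u: "u \<ge> y" and q: "exp (- u) \<le> ?q z" for u z
    proof -
      have S: "?S u > 0" using irv.S[of u] u y by auto
      then have "measure M (cball 0 (l * ?S u)) \<le> e * exp (- u)"
        using R u l by (simp flip: exp_small_ball)
      then have "(1 - e) * exp (- u) \<le> ?q z - measure M (cball 0 (l * ?S u))"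
        using q by (simp add: algebra_simps)
      then have "((1 - e) * ?S u powr r) * ((1 - e) * exp (- u)) \<le> (l * ?S u) powr r * (?q z - measure M (cball 0 (l * ?S u)))"
        using S l e by (simp add: powr_mult mult_left_mono)
      then have "ennreal ((1 - e) ^ 2 * G u) \<le> ennreal ((l * ?S u) powr r * (?q z - measure M (cball 0 (l * ?S u))))"
        by (intro ennreal_leI) (simp add: G_def power2_eq_square ac_simps)
      also have "\<dots> \<le> ?D z"
        by (rule cell_distortion_ge[OF quantizer_cell[OF f] _ r]) (use S l in auto)
      finally show ?thesis .
    qed
    have Gy: "G y > 0" using irv.S[OF y] by (simp add: G_def)
    \<comment> \<open>Up to (1 - e) ^ 3, the cost G y of a ball of probability exp (- y) per unit of
      its contribution exp (- \<alpha> * y) to the entropy sum.\<close>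
    define C where "C = (1 - e) ^ 3 * G y * exp (\<alpha> * y)"
    have C: "C > 0" using e Gy by (simp add: C_def)
    show "ennreal ((1 - e) ^ 3 * (?S y powr r * exp (- y))) \<le> distortion M r f"
    proof (cases "\<exists>z. exp (- y) \<le> ?q z")
      case True
      then obtain z where z: "exp (- y) \<le> ?q z" by blast
      have "(1 - e) ^ 3 * G y \<le> (1 - e) ^ 2 * G y"
        using e Gy by (intro mult_right_mono power_decreasing) auto
      then have "ennreal ((1 - e) ^ 3 * G y) \<le> ennreal ((1 - e) ^ 2 * G y)" by (rule ennreal_leI)
      also have "\<dots> \<le> ?D z" by (rule cell) (use z in auto)
      also have "\<dots> \<le> distortion M r f" using sum_cells_le_distortion[OF f, of "{z}" r] by simp
      finally show ?thesis by (simp add: G_def)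
    next
      case False
      have Cq: "ennreal (C * ?q z powr \<alpha>) \<le> ?D z" for z
      proof (cases "?q z = 0")
        case False
        then have q: "?q z > 0" by (simp add: zero_less_measure_iff)
        define u where "u = - ln (?q z)"
        have qu: "?q z = exp (- u)" using q by (simp add: u_def)
        have "\<not> exp (- y) \<le> exp (- u)" using \<open>\<not> (\<exists>z. exp (- y) \<le> ?q z)\<close> qu by metis
        then have u: "u \<ge> y" by simp
        have "?q z powr \<alpha> = exp (- \<alpha> * u)" unfolding qu by (simp add: powr_def)
        then have "C * ?q z powr \<alpha> = (1 - e) ^ 2 * exp (- \<alpha> * u) * ((1 - e) * (?S y powr r * (exp (- y) * exp (\<alpha> * y))))"
          by (simp add: C_def G_def power3_eq_cube power2_eq_square)
        also have "exp (- y) * exp (\<alpha> * y) = exp ((\<alpha> - 1) * y)"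
          by (simp add: algebra_simps flip: exp_add)
        also have "(1 - e) ^ 2 * exp (- \<alpha> * u) * ((1 - e) * (?S y powr r * exp ((\<alpha> - 1) * y)))
            \<le> (1 - e) ^ 2 * exp (- \<alpha> * u) * (?S u powr r * exp ((\<alpha> - 1) * u))"
          using P u by (intro mult_left_mono) auto
        also have "\<dots> = (1 - e) ^ 2 * (?S u powr r * (exp (- \<alpha> * u) * exp ((\<alpha> - 1) * u)))" by simp
        also have "exp (- \<alpha> * u) * exp ((\<alpha> - 1) * u) = exp (- u)"
          by (simp add: algebra_simps flip: exp_add)
        finally have "ennreal (C * ?q z powr \<alpha>) \<le> ennreal ((1 - e) ^ 2 * G u)"
          unfolding G_def by (rule ennreal_leI)
        also have "\<dots> \<le> ?D z" by (rule cell[OF u]) (simp add: qu)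
        finally show ?thesis .
      qed simp
      \<comment> \<open>For finite distortion d, summing \<open>Cq\<close> over the cells bounds the
        entropy sum by d / C, while the constraint makes that sum at least exp (- \<alpha> *
        y).\<close>
      show ?thesis
      proof (cases "distortion M r f = \<top>")
        case False
        then obtain d where d: "d \<ge> 0" "distortion M r f = ennreal d" by (metis ennreal_cases)
        have "(\<Sum>\<^sub>\<infinity>z\<in>range f. ?q z powr \<alpha>) \<le> d / C"
        proof (rule infsum_le_finite_sums[OF summable_cells_powr[OF f \<alpha>]])
          fix F :: "'a set" assume F: "finite F"
          have "ennreal (\<Sum>z\<in>F. C * ?q z powr \<alpha>) = (\<Sum>z\<in>F. ennreal (C * ?q z powr \<alpha>))"
            using C by (intro sum_ennreal[symmetric]) auto
          also have "\<dots> \<le> (\<Sum>z\<in>F. ?D z)" by (intro sum_mono Cq)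
          also have "\<dots> \<le> ennreal d" using sum_cells_le_distortion[OF f F, of r] d(2) by simp
          finally have "(\<Sum>z\<in>F. C * ?q z powr \<alpha>) \<le> d" using d by simp
          then show "(\<Sum>z\<in>F. ?q z powr \<alpha>) \<le> d / C"
            using C by (simp add: field_simps flip: sum_distrib_left)
        qed
        moreover have "exp (- \<alpha> * y) \<le> (\<Sum>\<^sub>\<infinity>z\<in>range f. ?q z powr \<alpha>)"
          using H renyi_entropy_le_iff[OF f \<alpha>] by simp
        ultimately have "exp (- \<alpha> * y) \<le> d / C" by linarith
        then have "C * exp (- \<alpha> * y) \<le> d" using C by (simp add: field_simps)
        moreover have "C * exp (- \<alpha> * y) = (1 - e) ^ 3 * G y"
          by (simp add: C_def exp_minus)
        ultimately show ?thesis using d by (simp add: G_def ennreal_leI)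
      qed simp
    qed
  qed
qed

section \<open>The two asymptotic equivalences\<close>

lemma quantization_error_infinity_le:
  assumes s: "s > 0" and r: "r > 0"
  shows "(INF f\<in>{f \<in> quantizers. renyi_entropy M \<infinity> f \<le> small_ball M s}. distortion M r f)
    \<le> ennreal (s powr r * exp (- small_ball M s))"
proof (rule ennreal_le_epsilon)
  fix d :: real assume d: "d > 0"
  obtain f where "f \<in> quantizers" "renyi_entropy M \<infinity> f \<le> small_ball M s"
    "distortion M r f \<le> ennreal (s powr r * exp (- small_ball M s)) + ennreal d"
    using ex_ball_quantizer[OF s r d] by blast
  then show "(INF f\<in>{f \<in> quantizers. renyi_entropy M \<infinity> f \<le> small_ball M s}. distortion M r f)
    \<le> ennreal (s powr r * exp (- small_ball M s)) + ennreal d"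
    by (intro INF_lower2[of f]) auto
qed

text \<open>Both relations come from one chain, valid for large y: (1 - e) * G y is at most the
  infimum for \<alpha>, which is at most the infimum for \<infinity>, which is at most G y.\<close>

lemma quantization_error_asymp:
  assumes irv: "inverse_regularly_varying (small_ball M) (small_ball_inv M) y\<^sub>0"
    and r: "r > 0" and \<alpha>: "\<alpha> > 1"
  defines "G \<equiv> \<lambda>y. small_ball_inv M y powr r * exp (- y)"
  shows "(\<lambda>y. quantization_error M r (ereal \<alpha>) (\<alpha> / (\<alpha> - 1) * y)) \<sim>[at_top] G"
    and "(\<lambda>y. quantization_error M r \<infinity> y) \<sim>[at_top] G"
proof -
  interpret irv: inverse_regularly_varying "small_ball M" "small_ball_inv M" y\<^sub>0 by (rule irv)
  define I where "I \<beta> y = (INF f\<in>{f \<in> quantizers. renyi_entropy M \<beta> f \<le> y}. distortion M r f)" for \<beta> y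
  have le: "I (ereal \<alpha>) (\<alpha> / (\<alpha> - 1) * y) \<le> I \<infinity> y" for y
    unfolding I_def by (rule INF_superset_mono) (use renyi_entropy_le_of_infinity[OF _ \<alpha>] in blast, simp)
  have up: "I \<infinity> y \<le> ennreal (G y)" if "y \<ge> y\<^sub>0" for y
    using quantization_error_infinity_le[of "small_ball_inv M y", OF _ r] irv.S[OF that] by (simp add: I_def G_def)
  have G: "G y > 0" if "y \<ge> y\<^sub>0" for y using irv.S[OF that] by (simp add: G_def)
  have low: "\<forall>\<^sub>F y in at_top. ennreal ((1 - e) * G y) \<le> I (ereal \<alpha>) (\<alpha> / (\<alpha> - 1) * y)" if e: "0 < e" "e < 1" for e
  proof -
    \<comment> \<open>By Bernoulli's inequality three factors 1 - e / 3 lose at most e.\<close>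
    have "0 < e / 3" "e / 3 < 1" using e by auto
    from distortion_ge[OF irv r \<alpha> this] eventually_ge_at_top[of y\<^sub>0] show ?thesis
    proof eventually_elim
      case (elim y)
      have "1 + real 3 * (- (e / 3)) \<le> (1 + - (e / 3)) ^ 3" by (rule Bernoulli_inequality) (use e in auto)
      then have "(1 - e) * G y \<le> (1 - e / 3) ^ 3 * G y"
        using G[OF elim(2)] by (intro mult_right_mono) auto
      then have "ennreal ((1 - e) * G y) \<le> ennreal ((1 - e / 3) ^ 3 * G y)" by (rule ennreal_leI)
      also have "\<dots> \<le> I (ereal \<alpha>) (\<alpha> / (\<alpha> - 1) * y)"
        unfolding I_def by (rule INF_greatest) (use elim(1) in \<open>auto simp: G_def\<close>)
      finally show ?case .
    qed
  qed
  \<comment> \<open>\<open>enn2real\<close> sends \<top> to 0, so a lower bound survives the passage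
    to reals only for finite values; the upper bound g supplies the finiteness.\<close>
  have real: "(1 - e) * g \<le> enn2real a"
    if "a \<le> ennreal g" "ennreal ((1 - e) * g) \<le> a" "g > 0" "e < 1" for a :: ennreal and e g
  proof -
    have "a < \<top>" using that(1) by (rule order_le_less_trans) simp
    moreover have "0 \<le> (1 - e) * g" using that by simp
    ultimately show ?thesis using enn2real_mono[OF that(2)] by simp
  qed
  have ev: "\<forall>\<^sub>F y in at_top. I (ereal \<alpha>) (\<alpha> / (\<alpha> - 1) * y) \<le> ennreal (G y) \<and> I \<infinity> y \<le> ennreal (G y) \<and> G y > 0"
    using eventually_ge_at_top[of y\<^sub>0] by eventually_elim (use le up G order_trans in blast)
  have enn: "enn2real a \<le> g" if "a \<le> ennreal g" "g > 0" for a g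
    using enn2real_mono[OF that(1)] that(2) by simp
  show "(\<lambda>y. quantization_error M r (ereal \<alpha>) (\<alpha> / (\<alpha> - 1) * y)) \<sim>[at_top] G"
  proof (rule asymp_equivI_lower_upper)
    show "\<forall>\<^sub>F y in at_top. quantization_error M r (ereal \<alpha>) (\<alpha> / (\<alpha> - 1) * y) \<le> G y"
      using ev unfolding quantization_error_def I_def[symmetric] by eventually_elim (auto intro: enn)
    show "\<forall>\<^sub>F y in at_top. (1 - e) * G y \<le> quantization_error M r (ereal \<alpha>) (\<alpha> / (\<alpha> - 1) * y)" if e: "0 < e" "e < 1" for e
      using ev low[OF e] unfolding quantization_error_def I_def[symmetric]
      by eventually_elim (use real e in blast)
    show "\<forall>\<^sub>F y in at_top. 0 < G y" using ev by eventually_elim auto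
  qed
  show "(\<lambda>y. quantization_error M r \<infinity> y) \<sim>[at_top] G"
  proof (rule asymp_equivI_lower_upper)
    show "\<forall>\<^sub>F y in at_top. quantization_error M r \<infinity> y \<le> G y"
      using ev unfolding quantization_error_def I_def[symmetric] by eventually_elim (auto intro: enn)
    show "\<forall>\<^sub>F y in at_top. (1 - e) * G y \<le> quantization_error M r \<infinity> y" if e: "0 < e" "e < 1" for e
      using ev low[OF e] unfolding quantization_error_def I_def[symmetric]
      by eventually_elim (use real e le order_trans in blast)
    show "\<forall>\<^sub>F y in at_top. 0 < G y" using ev by eventually_elim auto
  qed
qed

end

theorem theorem3p15:
  fixes M :: "'a::{banach, second_countable_topology} measure"
    and r \<alpha> c a b :: real
  assumes "infinite_dimensional TYPE('a)"
    and "centered_gaussian M"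
    and "non_atomic M"
    and "topological_support M = UNIV"
    and "r > 0" and "\<alpha> > 1" and "c > 0" and "a > 0"
    and "small_ball M \<sim>[at_right 0] (\<lambda>s. c * (1 / s) powr a * ln (1 / s) powr b)"
  shows "(\<lambda>R. quantization_error M r (ereal \<alpha>) R) \<sim>[at_top]
           (\<lambda>R. small_ball_inv M ((\<alpha> - 1) / \<alpha> * R) powr r * exp (- ((\<alpha> - 1) / \<alpha> * R)))
       \<and> (\<lambda>R. small_ball_inv M ((\<alpha> - 1) / \<alpha> * R) powr r * exp (- ((\<alpha> - 1) / \<alpha> * R))) \<sim>[at_top]
           (\<lambda>R. quantization_error M r \<infinity> ((\<alpha> - 1) / \<alpha> * R))"
proof -
  have nontrivial: "\<exists>x::'a. x \<noteq> 0"
  proof (rule ccontr)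
    assume "\<not> ?thesis"
    then have "span {0::'a} = UNIV" by auto
    then show False using assms(1) unfolding infinite_dimensional_def by blast
  qed
  interpret full_gaussian_measure M
    using assms(2,4) nontrivial by unfold_locales auto
  have lim: "filterlim (small_ball M) at_top (at_right 0)"
    by (rule asymp_equiv_at_top_at_right_0[OF assms(7,8,9)])
  then have pos: "\<forall>\<^sub>F s in at_right 0. small_ball M s > 0" by (simp add: filterlim_at_top_dense)
  \<comment> \<open>The threshold is small_ball M 1 because the inverse was located on radii up to
    1.\<close>
  have irv: "inverse_regularly_varying (small_ball M) (small_ball_inv M) (small_ball M 1)"
    using small_ball_strict_antimono small_ball_inv[OF lim] regularly_varying_ratio[OF assms(7,8) _ _ assms(9) pos]
    by unfold_locales auto
  have T: "filterlim (\<lambda>R. (\<alpha> - 1) / \<alpha> * R) at_top at_top"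
    using assms(6) by (intro filterlim_tendsto_pos_mult_at_top[OF tendsto_const] filterlim_ident) auto
  have "\<alpha> / (\<alpha> - 1) * ((\<alpha> - 1) / \<alpha> * R) = R" for R using assms(6) by simp
  then show ?thesis
    using asymp_equiv_compose'[OF quantization_error_asymp(1)[OF irv assms(5,6)] T]
      asymp_equiv_symI[OF asymp_equiv_compose'[OF quantization_error_asymp(2)[OF irv assms(5,6)] T]]
    by simp
qed

end
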